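(* Let $Q$ be a real, symmetric, positive definite $n\times n$ matrix and let $B$ be a real $n\times n$ matrix all of whose eigenvalues have negative real parts. The Ornstein--Uhlenbeck maximal operator $\mathcal H_*f(x)=\sup_{t>0}|\mathcal H_tf(x)|$ is of weak type $(1,1)$ with respect to the invariant measure $\gamma_\infty$, with an operator quasinorm that depends only on $n$, $Q$ and $B$. That is, there exists a constant $C=C(n,Q,B)<\infty$ such that for all $f\in L^1(\gamma_\infty)$ and all $\alpha>0$ $$\gamma_\infty\{x\in\mathbb R^n:\mathcal H_*f(x)>\alpha\}\le \frac{C}{\alpha}\,\|f\|_{L^1(\gamma_\infty)}.$$
   Context: For $0<t\le+\infty$ let $Q_t=\int_0^t e^{sB}Qe^{sB^*}\,ds$, a symmetric positive definite matrix, and let $\gamma_t$ be the Gaussian probability measure on $\mathbb R^n$ with density $y\mapsto(2\pi)^{-n/2}(\det Q_t)^{-1/2}\exp\left(-\frac12\langle Q_t^{-1}y,y\rangle\right)$ with respect to Lebesgue measure. The Ornstein--Uhlenbeck semigroup $(\mathcal H_t)_{t>0}$ with covariance $Q$ and drift $B$ is given by Kolmogorov's formula $\mathcal H_tf(x)=\int f(e^{tB}x-y)\,d\gamma_t(y)$, $x\in\mathbb R^n$, for bounded continuous $f$. Equivalently, $\mathcal H_tf(x)=\int K_t(x,u)f(u)\,d\gamma_\infty(u)$, an absolutely convergent integral for every $f\in L^1(\gamma_\infty)$, $t>0$, $x\in\mathbb R^n$, which defines $\mathcal H_tf$ for $f\in L^1(\gamma_\infty)$. Here the Mehler kernel is $$K_t(x,u)=\Big(\frac{\det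 Q_\infty}{\det Q_t}\Big)^{1/2}\exp(R(x))\exp\Big[-\tfrac12\big\langle(Q_t^{-1}-Q_\infty^{-1})(u-D_tx),\,u-D_tx\big\rangle\Big],$$ with $R(x)=\frac12\langle Q_\infty^{-1}x,x\rangle$ and $D_t=Q_\infty e^{-tB^*}Q_\infty^{-1}$. The measure $\gamma_\infty$ is invariant under $\mathcal H_t$. *)

theory Defs
  imports "HOL-Analysis.Analysis"
begin

text \<open>The multiplication of the type of square matrices provided by the type classes is
  componentwise, so matrix powers and the matrix exponential are defined from the matrix
  product \<open>**\<close>.\<close>

primrec matrix_pow :: "real^'n^'n \<Rightarrow> nat \<Rightarrow> real^'n^'n" where
  "matrix_pow A 0 = mat 1"
| "matrix_pow A (Suc k) = A ** matrix_pow A k"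

definition matrix_exp :: "real^'n^'n \<Rightarrow> real^'n^'n" where
  "matrix_exp A = (\<Sum>k. (1 / fact k) *\<^sub>R matrix_pow A k)"

definition symmetric_matrix :: "real^'n^'n \<Rightarrow> bool" where
  "symmetric_matrix A \<longleftrightarrow> transpose A = A"

definition positive_definite :: "real^'n^'n \<Rightarrow> bool" where
  "positive_definite A \<longleftrightarrow> (\<forall>x. x \<noteq> 0 \<longrightarrow> 0 < (A *v x) \<bullet> x)"

text \<open>Eigenvalues of a real matrix are taken over the complex numbers.\<close>

definition complex_eigenvalue :: "real^'n^'n \<Rightarrow> complex \<Rightarrow> bool" where
  "complex_eigenvalue A z \<longleftrightarrow>
    (\<exists>v::complex^'n. v \<noteq> 0 \<and> map_matrix complex_of_real A *v v = z *s v)"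

definition ou_cov :: "real^'n^'n \<Rightarrow> real^'n^'n \<Rightarrow> ereal \<Rightarrow> real^'n^'n" where
  "ou_cov Q B t = integral {s::real. 0 \<le> s \<and> ereal s \<le> t}
     (\<lambda>s. matrix_exp (s *\<^sub>R B) ** Q ** matrix_exp (s *\<^sub>R transpose B))"

definition ou_gauss :: "real^'n^'n \<Rightarrow> real^'n^'n \<Rightarrow> ereal \<Rightarrow> (real^'n) measure" where
  "ou_gauss Q B t = density lborel (\<lambda>y. ennreal
     ((2 * pi) powr (- real CARD('n) / 2) * det (ou_cov Q B t) powr (- 1 / 2)
       * exp (- 1 / 2 * ((matrix_inv (ou_cov Q B t) *v y) \<bullet> y))))"

definition ou_R :: "real^'n^'n \<Rightarrow> real^'n^'n \<Rightarrow> real^'n \<Rightarrow> real" where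
  "ou_R Q B x = 1 / 2 * ((matrix_inv (ou_cov Q B \<infinity>) *v x) \<bullet> x)"

definition ou_D :: "real^'n^'n \<Rightarrow> real^'n^'n \<Rightarrow> real \<Rightarrow> real^'n^'n" where
  "ou_D Q B t = ou_cov Q B \<infinity> ** matrix_exp (- t *\<^sub>R transpose B)
     ** matrix_inv (ou_cov Q B \<infinity>)"

definition mehler_kernel ::
    "real^'n^'n \<Rightarrow> real^'n^'n \<Rightarrow> real \<Rightarrow> real^'n \<Rightarrow> real^'n \<Rightarrow> real" where
  "mehler_kernel Q B t x u =
     sqrt (det (ou_cov Q B \<infinity>) / det (ou_cov Q B (ereal t))) * exp (ou_R Q B x)
     * exp (- 1 / 2 *
         (((matrix_inv (ou_cov Q B (ereal t)) - matrix_inv (ou_cov Q B \<infinity>))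
             *v (u - ou_D Q B t *v x)) \<bullet> (u - ou_D Q B t *v x)))"

text \<open>The semigroup on \<open>L\<^sup>1\<close> of the invariant measure is given by the Mehler kernel, since
  Kolmogorov's formula is only posed for bounded continuous functions.\<close>

definition ou_semigroup :: "real^'n^'n \<Rightarrow> real^'n^'n \<Rightarrow> real \<Rightarrow>
    (real^'n \<Rightarrow> 'b::{banach, second_countable_topology}) \<Rightarrow> real^'n \<Rightarrow> 'b" where
  "ou_semigroup Q B t f x =
     (\<integral>u. mehler_kernel Q B t x u *\<^sub>R f u \<partial>ou_gauss Q B \<infinity>)"

text \<open>The supremum is taken in \<open>[0, \<infinity>]\<close>.\<close>

definition ou_maximal :: "real^'n^'n \<Rightarrow> real^'n^'n \<Rightarrow>
    (real^'n \<Rightarrow> 'b::{banach, second_countable_topology}) \<Rightarrow> real^'n \<Rightarrow> ennreal" where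
  "ou_maximal Q B f x = (SUP t\<in>{0<..}. ennreal (norm (ou_semigroup Q B t f x)))"

end

theory Submission
  imports Defs "HOL-Computational_Algebra.Fundamental_Theorem_Algebra"
begin

text \<open>Write \<open>w = D\<^sub>-\<^sub>t u - x\<close> and \<open>T = min t 1\<close>. The Mehler kernel is at most a constant times
  \<open>exp (R x) T\<^sup>-\<^sup>n\<^sup>/\<^sup>2 exp (- c \<bar>w\<bar>\<^sup>2 / T)\<close> for all \<open>t > 0\<close>, and splitting according to the integer part of
  \<open>\<bar>w\<bar> / \<surd>T\<close> reduces the theorem to a bound, of size \<open>exp (O(A))\<close>, for the maximal
  operator \<open>sup\<^sub>t exp (R x) T\<^sup>-\<^sup>n\<^sup>/\<^sup>2 \<mu> (tube A t x)\<close>, where \<open>tube A t x\<close> is the image under \<open>D\<^sub>t\<close>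
  of the ball of radius \<open>A \<surd>T\<close> about \<open>x\<close>.

  That bound is a Vitali covering argument. For \<open>t \<le> (1 + \<bar>x\<bar>)\<^sup>-\<^sup>2\<close> tubes are comparable to balls and
  are selected by decreasing \<open>t\<close>. For larger \<open>t\<close> they are selected by increasing \<open>R x\<close>: if the
  tube of \<open>x\<close> meets the tube of a selected \<open>x\<^sub>1\<close> then \<open>x\<close> lies near the orbit of \<open>x\<^sub>1\<close> under \<open>D\<close>, along
  which \<open>R\<close> grows at least like \<open>\<bar>x\<^sub>1\<bar>\<close> times the displacement. As \<open>1 / \<bar>x\<^sub>1\<bar>\<close> is bounded by a multiple of
  \<open>\<surd>T\<^sub>1\<close>, the distance \<open>\<bar>x - x\<^sub>1\<bar>\<close> is at most a multiple of \<open>(R x - R x\<^sub>1 + 2) \<surd>T\<^sub>1\<close>, and the Gaussian measure of the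
  points \<open>x\<close> with this property is at most a multiple of \<open>exp (- R x\<^sub>1) T\<^sub>1\<^sup>n\<^sup>/\<^sup>2\<close>.\<close>

section \<open>The matrix exponential\<close>

text \<open>The invariant measure is not doubling, so an enlarged tube cannot be compared in measure
  with the tube itself. The covering argument therefore uses two measures. Disjointness of the
  selected tubes is counted in the finite measure \<mu> with density |f| relative to the invariant
  measure, while the points that a selected tube accounts for are measured by the Gaussian. Both
  sides meet in one quantity: a tube qualifies when its \<mu>-mass exceeds \<alpha>
  \<open>exp (- R x)\<close> times the n-th power of its scale, and the Gaussian mass of its zone is
  at most a constant times the same product. The volume of a tube is never computed.

  All facts about the flow rest on the Lyapunov equation B S + S B^T = - Q for the limit covariance
  S. It makes R grow along an orbit at a rate comparable with the squared norm of the dual orbit,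
  which in turn bounds the speed and the initial distance from the origin. The spectral hypothesis
  gives the decay of exp(sB), hence S and this equation.

  The growth exp(O(A)) is harmless because the m-th layer of the kernel carries a factor exp(-c
  m^2).\<close>

lemma bounded_bilinear_matrix_mult:
  "bounded_bilinear ((**) :: real^'n^'m \<Rightarrow> real^'p^'n \<Rightarrow> real^'p^'m)"
proof -
  have "bilinear ((**) :: real^'n^'m \<Rightarrow> real^'p^'n \<Rightarrow> real^'p^'m)"
    unfolding bilinear_def linear_iff
    by (auto simp: vec_eq_iff matrix_matrix_mult_def sum.distrib sum_distrib_left algebra_simps)
  then show ?thesis
    by (simp add: bilinear_conv_bounded_bilinear)
qed

lemma bounded_bilinear_matrix_vector_mult:
  "bounded_bilinear ((*v) :: real^'n^'m \<Rightarrow> real^'n \<Rightarrow> real^'m)"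
proof -
  have "bilinear ((*v) :: real^'n^'m \<Rightarrow> real^'n \<Rightarrow> real^'m)"
    unfolding bilinear_def linear_iff
    by (auto simp: vec_eq_iff matrix_vector_mult_def sum.distrib sum_distrib_left algebra_simps)
  then show ?thesis
    by (simp add: bilinear_conv_bounded_bilinear)
qed

lemma bounded_linear_transpose: "bounded_linear (transpose :: real^'n^'m \<Rightarrow> real^'m^'n)"
  unfolding linear_conv_bounded_linear[symmetric] linear_iff
  by (auto simp: vec_eq_iff transpose_def)

lemmas matrix_mult_scaleR_left = bounded_bilinear.scaleR_left[OF bounded_bilinear_matrix_mult]
lemmas matrix_mult_scaleR_right = bounded_bilinear.scaleR_right[OF bounded_bilinear_matrix_mult]
lemmas matrix_mult_minus_left = bounded_bilinear.minus_left[OF bounded_bilinear_matrix_mult]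
lemmas matrix_mult_minus_right = bounded_bilinear.minus_right[OF bounded_bilinear_matrix_mult]
lemmas matrix_mult_add_left = bounded_bilinear.add_left[OF bounded_bilinear_matrix_mult]
lemmas matrix_vector_mult_minus_left =
  bounded_bilinear.minus_left[OF bounded_bilinear_matrix_vector_mult]
lemmas has_vector_derivative_matrix_mult =
  bounded_bilinear.has_vector_derivative[OF bounded_bilinear_matrix_mult]
lemmas has_vector_derivative_matrix_vector_mult =
  bounded_bilinear.has_vector_derivative[OF bounded_bilinear_matrix_vector_mult]

lemma matrix_pow_scaleR: "matrix_pow (s *\<^sub>R A) k = s ^ k *\<^sub>R matrix_pow A k"
  by (induction k) (simp_all add: matrix_mult_scaleR_left matrix_mult_scaleR_right)

lemma matrix_pow_commute: "matrix_pow A k ** A = A ** matrix_pow A k"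
  by (induction k) (simp_all add: matrix_mul_assoc[symmetric])

lemma transpose_matrix_pow: "transpose (matrix_pow A k) = matrix_pow (transpose A) k"
  by (induction k) (simp_all add: matrix_transpose_mul matrix_pow_commute)

lemma summable_matrix_exp:
  fixes A :: "real^'n^'n"
  shows "summable (\<lambda>k. (1 / fact k) *\<^sub>R matrix_pow A k)"
proof -
  obtain K where K: "0 \<le> K" "\<And>(a::real^'n^'n) (b::real^'n^'n). norm (a ** b) \<le> norm a * norm b * K"
    using bounded_bilinear.nonneg_bounded[OF bounded_bilinear_matrix_mult] by metis
  have pow: "norm (matrix_pow A k) \<le> norm (mat 1 :: real^'n^'n) * (K * norm A) ^ k" for k
  proof (induction k)
    case (Suc k)
    have "norm (matrix_pow A (Suc k)) \<le> norm A * norm (matrix_pow A k) * K"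
      unfolding matrix_pow.simps by (rule K(2))
    also have "\<dots> \<le> norm A * (norm (mat 1 :: real^'n^'n) * (K * norm A) ^ k) * K"
      using Suc.IH K(1) by (simp add: mult_left_mono mult_right_mono)
    finally show ?case by (simp add: mult_ac)
  qed simp
  have "summable (\<lambda>k. norm (mat 1 :: real^'n^'n) * (inverse (fact k) * (K * norm A) ^ k))"
    by (intro summable_mult summable_exp)
  then show ?thesis
  proof (rule summable_comparison_test[rotated], intro exI allI impI)
    fix k
    have "norm ((1 / fact k) *\<^sub>R matrix_pow A k) = inverse (fact k) * norm (matrix_pow A k)"
      by (simp add: divide_inverse)
    also have "\<dots> \<le> inverse (fact k) * (norm (mat 1 :: real^'n^'n) * (K * norm A) ^ k)"
      by (intro mult_left_mono pow) auto
    finally show "norm ((1 / fact k) *\<^sub>R matrix_pow A k)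
        \<le> norm (mat 1 :: real^'n^'n) * (inverse (fact k) * (K * norm A) ^ k)"
      by (simp add: algebra_simps)
  qed
qed

lemma matrix_exp_sums: "(\<lambda>k. (1 / fact k) *\<^sub>R matrix_pow A k) sums matrix_exp A"
  unfolding matrix_exp_def using summable_matrix_exp by (rule summable_sums)

lemma matrix_exp_commute: "matrix_exp (s *\<^sub>R A) ** A = A ** matrix_exp (s *\<^sub>R A)"
proof (rule sums_unique2)
  show "(\<lambda>k. (1 / fact k) *\<^sub>R matrix_pow (s *\<^sub>R A) k ** A) sums (matrix_exp (s *\<^sub>R A) ** A)"
    using bounded_linear.sums[OF bounded_bilinear.bounded_linear_left[OF bounded_bilinear_matrix_mult]
        matrix_exp_sums] .
  have "(\<lambda>k. A ** (1 / fact k) *\<^sub>R matrix_pow (s *\<^sub>R A) k) sums (A ** matrix_exp (s *\<^sub>R A))"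
    using bounded_linear.sums[OF bounded_bilinear.bounded_linear_right[OF bounded_bilinear_matrix_mult]
        matrix_exp_sums] .
  then show "(\<lambda>k. (1 / fact k) *\<^sub>R matrix_pow (s *\<^sub>R A) k ** A) sums (A ** matrix_exp (s *\<^sub>R A))"
    by (simp add: matrix_pow_scaleR matrix_mult_scaleR_left matrix_mult_scaleR_right
        matrix_pow_commute)
qed

lemma transpose_matrix_exp: "transpose (matrix_exp A) = matrix_exp (transpose A)"
proof (rule sums_unique2)
  show "(\<lambda>k. transpose ((1 / fact k) *\<^sub>R matrix_pow A k)) sums transpose (matrix_exp A)"
    by (rule bounded_linear.sums[OF bounded_linear_transpose matrix_exp_sums])
  then show "(\<lambda>k. transpose ((1 / fact k) *\<^sub>R matrix_pow A k)) sums matrix_exp (transpose A)"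
    using matrix_exp_sums[of "transpose A"]
    by (simp add: linear_scale[OF bounded_linear.linear[OF bounded_linear_transpose]] transpose_matrix_pow)
qed

lemma matrix_exp_zero [simp]: "matrix_exp 0 = mat 1"
proof (rule sums_unique2[OF matrix_exp_sums])
  have "(\<lambda>k. (1 / fact k) *\<^sub>R matrix_pow (0::real^'a^'a) k)
      = (\<lambda>k. if k = 0 then mat 1 else 0)"
  proof
    show "(1 / fact k) *\<^sub>R matrix_pow (0::real^'a^'a) k = (if k = 0 then mat 1 else 0)" for k
      by (cases k) simp_all
  qed
  then show "(\<lambda>k. (1 / fact k) *\<^sub>R matrix_pow (0::real^'a^'a) k) sums mat 1"
    using sums_single[of 0 "\<lambda>_. mat 1 :: real^'a^'a"] by simp
qed

text \<open>Pairing with a fixed matrix \<open>i\<close> turns the series into a scalar power series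
  in \<open>s\<close>, which may be differentiated term by term; the components are then
  reassembled.\<close>

lemma has_vector_derivative_matrix_exp:
  fixes A :: "real^'n^'n"
  shows "((\<lambda>s. matrix_exp (s *\<^sub>R A)) has_vector_derivative A ** matrix_exp (s *\<^sub>R A)) (at s within X)"
proof -
  have "((\<lambda>s. matrix_exp (s *\<^sub>R A) \<bullet> i) has_real_derivative (A ** matrix_exp (s *\<^sub>R A)) \<bullet> i) (at s)"
    for i :: "real^'n^'n"
  proof -
    define c where "c k = (matrix_pow A k \<bullet> i) / fact k" for k
    have c: "(\<lambda>k. c k * s ^ k) sums (matrix_exp (s *\<^sub>R A) \<bullet> i)" for s
      using bounded_linear.sums[OF bounded_linear_inner_left[of i] matrix_exp_sums[of "s *\<^sub>R A"]]
      by (simp add: c_def matrix_pow_scaleR field_simps)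
    have d: "(\<lambda>k. diffs c k * s ^ k) sums ((A ** matrix_exp (s *\<^sub>R A)) \<bullet> i)"
    proof -
      have *: "(\<lambda>k. (A ** (1 / fact k) *\<^sub>R matrix_pow (s *\<^sub>R A) k) \<bullet> i) sums ((A ** matrix_exp (s *\<^sub>R A)) \<bullet> i)"
        using bounded_linear.sums[OF bounded_linear_inner_left[of i]
          bounded_linear.sums[OF bounded_bilinear.bounded_linear_right[OF bounded_bilinear_matrix_mult]
            matrix_exp_sums]] .
      have "(A ** (1 / fact k) *\<^sub>R matrix_pow (s *\<^sub>R A) k) \<bullet> i = diffs c k * s ^ k" for k
      proof -
        have "diffs c k = (A ** matrix_pow A k) \<bullet> i / fact k"
          by (simp add: diffs_def c_def del: of_nat_Suc)
        then show ?thesis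
          by (simp add: matrix_pow_scaleR matrix_mult_scaleR_right field_simps)
      qed
      with * show ?thesis by simp
    qed
    have "DERIV (\<lambda>s. \<Sum>k. c k * s ^ k) s :> (\<Sum>k. diffs c k * s ^ k)"
      by (rule termdiffs_strong_converges_everywhere) (rule sums_summable[OF c])
    then show ?thesis
      using c d by (simp add: sums_iff)
  qed
  then have "((\<lambda>s. matrix_exp (s *\<^sub>R A)) has_vector_derivative A ** matrix_exp (s *\<^sub>R A)) (at s)"
    unfolding has_vector_derivative_def
    by (subst has_derivative_componentwise_within) (simp add: has_field_derivative_def mult_commute_abs)
  then show ?thesis
    by (rule has_vector_derivative_at_within)
qed

lemma has_vector_derivative_matrix_exp':
  assumes "(g has_real_derivative g') (at s within X)"
  shows "((\<lambda>s. matrix_exp (g s *\<^sub>R A)) has_vector_derivative g' *\<^sub>R (A ** matrix_exp (g s *\<^sub>R A)))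
    (at s within X)"
  using vector_diff_chain_within[OF _ has_vector_derivative_matrix_exp, of g g' s X A] assms
  by (simp add: has_real_derivative_iff_has_vector_derivative o_def)

text \<open>With \<open>t\<close> fixed the product has derivative zero in \<open>s\<close>, so it
  equals its value at \<open>s = 0\<close>. This form yields both the inverse (\<open>t = 0\<close>)
  and the group law (\<open>- s\<close> for \<open>s\<close>, \<open>s + t\<close> for
  \<open>t\<close>).\<close>

lemma matrix_exp_minus_add: "matrix_exp (- s *\<^sub>R A) ** matrix_exp ((s + t) *\<^sub>R A) = matrix_exp (t *\<^sub>R A)"
proof -
  let ?f = "\<lambda>s. matrix_exp (- s *\<^sub>R A) ** matrix_exp ((s + t) *\<^sub>R A)"
  have "(?f has_vector_derivative 0) (at s within UNIV)" for s
  proof -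
    have "(?f has_vector_derivative
        matrix_exp (- s *\<^sub>R A) ** (1 *\<^sub>R (A ** matrix_exp ((s + t) *\<^sub>R A)))
        + (- 1 *\<^sub>R (A ** matrix_exp (- s *\<^sub>R A))) ** matrix_exp ((s + t) *\<^sub>R A)) (at s within UNIV)"
      by (intro has_vector_derivative_matrix_mult has_vector_derivative_matrix_exp')
        (auto intro!: derivative_eq_intros)
    moreover have "matrix_exp (- s *\<^sub>R A) ** (A ** matrix_exp ((s + t) *\<^sub>R A))
        = A ** matrix_exp (- s *\<^sub>R A) ** matrix_exp ((s + t) *\<^sub>R A)"
      by (metis matrix_mul_assoc matrix_exp_commute)
    ultimately show ?thesis
      by (simp add: matrix_mult_minus_left)
  qed
  then obtain c where "\<And>x. ?f x = c"
    using has_vector_derivative_zero_constant[of UNIV ?f] by auto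
  then have "?f s = ?f 0" by metis
  then show ?thesis by simp
qed

lemma matrix_exp_minus: "matrix_exp (- s *\<^sub>R A) ** matrix_exp (s *\<^sub>R A) = mat 1"
  using matrix_exp_minus_add[of s A 0] by simp

lemma matrix_exp_add: "matrix_exp ((s + t) *\<^sub>R A) = matrix_exp (s *\<^sub>R A) ** matrix_exp (t *\<^sub>R A)"
  using matrix_exp_minus_add[of "-s" A "s + t"] by simp

section \<open>Exponential decay of exp(sB) from the location of the eigenvalues\<close>

definition exp_decay :: "(real \<Rightarrow> complex) \<Rightarrow> bool" where
  "exp_decay g \<longleftrightarrow> (\<exists>C c. 0 < c \<and> (\<forall>s\<ge>0. cmod (g s) \<le> C * exp (- c * s)))"

text \<open>Variation of constants: multiplying by exp(-\<mu> s) leaves only the forcing term in the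
  derivative, which is compared with a scalar majorant. The rate stays existential because every
  eigenvalue factor may lower it.\<close>

lemma exp_decay_ode:
  assumes g: "\<And>s. (g has_vector_derivative \<mu> * g s + h s) (at s)"
    and h: "exp_decay h" and \<mu>: "Re \<mu> < 0"
  shows "exp_decay g"
proof -
  obtain C c where c: "0 < c" and C: "\<And>s. 0 \<le> s \<Longrightarrow> cmod (h s) \<le> C * exp (- c * s)"
    using h unfolding exp_decay_def by blast
  have C0: "0 \<le> C" using C[of 0] norm_ge_zero[of "h 0"] by (simp del: norm_ge_zero)
  \<comment> \<open>Halving - Re \<mu> keeps \<open>a\<close> positive even if \<open>h\<close>
    decays exactly at the rate - Re \<mu>, where a solution may carry an extra factor
    \<open>s\<close>.\<close>
  define d where "d = min c (- Re \<mu> / 2)"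
  define a where "a = - Re \<mu> - d"
  have d: "0 < d" "d \<le> c" "0 < a" "Re \<mu> \<le> - d"
    using c \<mu> by (auto simp: d_def a_def min_def)
  have bound: "cmod (g s) \<le> (cmod (g 0) + C / a) * exp (- d * s)" if s: "0 \<le> s" for s
  proof (cases "s = 0")
    case True
    then show ?thesis using d C0 by simp
  next
    case False
    define z where "z r = exp (- \<mu> * of_real r) * g r" for r
    have z': "(z has_vector_derivative exp (- \<mu> * of_real r) * h r) (at r)" for r
    proof -
      have "((\<lambda>r. exp (- \<mu> * of_real r)) has_vector_derivative - \<mu> * exp (- \<mu> * of_real r)) (at r)"
        by (rule has_vector_derivative_real_field) (auto intro!: derivative_eq_intros)
      then have "(z has_vector_derivative exp (- \<mu> * of_real r) * (\<mu> * g r + h r)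
          + (- \<mu> * exp (- \<mu> * of_real r)) * g r) (at r)"
        unfolding z_def by (rule has_vector_derivative_mult[OF _ g])
      then show ?thesis by (simp add: algebra_simps)
    qed
    have phi': "((\<lambda>r. C / a * exp (a * r)) has_vector_derivative C * exp (a * r)) (at r)" for r
      unfolding has_real_derivative_iff_has_vector_derivative[symmetric]
      using d by (auto intro!: derivative_eq_intros)
    have "norm (z s - z 0) \<le> C / a * exp (a * s) - C / a * exp (a * 0)"
    proof (rule differentiable_bound_general[OF _ _ _ z' phi'])
      show "0 < s" using False s by simp
      show "continuous_on {0..s} z"
        by (meson z' continuous_at_imp_continuous_on has_vector_derivative_continuous)
      show "continuous_on {0..s} (\<lambda>r. C / a * exp (a * r))"
        by (intro continuous_intros)
      show "norm (exp (- \<mu> * of_real r) * h r) \<le> C * exp (a * r)" if "0 < r" for r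
      proof -
        have "norm (exp (- \<mu> * of_real r) * h r) = exp (- Re \<mu> * r) * cmod (h r)"
          by (simp add: norm_mult)
        also have "\<dots> \<le> exp (- Re \<mu> * r) * (C * exp (- d * r))"
        proof (intro mult_left_mono)
          have "cmod (h r) \<le> C * exp (- c * r)" using C that by simp
          also have "\<dots> \<le> C * exp (- d * r)"
            using C0 d that by (intro mult_left_mono) (auto intro: mult_right_mono)
          finally show "cmod (h r) \<le> C * exp (- d * r)" .
        qed simp
        also have "\<dots> = C * exp (a * r)"
          by (simp add: a_def mult_exp_exp algebra_simps)
        finally show ?thesis .
      qed
    qed
    then have "cmod (z s) \<le> cmod (g 0) + C / a * exp (a * s) - C / a"
      using norm_triangle_ineq2[of "z s" "z 0"] by (simp add: z_def)
    also have "\<dots> \<le> cmod (g 0) + C / a * exp (a * s)" using C0 d by simp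
    finally have zs: "cmod (z s) \<le> cmod (g 0) + C / a * exp (a * s)" .
    have "cmod (g s) = exp (Re \<mu> * s) * cmod (z s)"
      by (simp add: z_def norm_mult mult.assoc[symmetric] mult_exp_exp)
    also have "\<dots> \<le> exp (Re \<mu> * s) * (cmod (g 0) + C / a * exp (a * s))"
      using zs by (intro mult_left_mono) auto
    also have "\<dots> = exp (Re \<mu> * s) * cmod (g 0) + C / a * exp (- d * s)"
      by (simp add: a_def algebra_simps mult_exp_exp)
    also have "\<dots> \<le> exp (- d * s) * cmod (g 0) + C / a * exp (- d * s)"
      using d s mult_right_mono[of "Re \<mu>" "- d" s] by (intro add_mono mult_right_mono) auto
    finally show ?thesis by (simp add: algebra_simps)
  qed
  then show ?thesis
    unfolding exp_decay_def using d(1) by blast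
qed

text \<open>The vector p(A) v. Acting on one vector at a time lets an annihilating polynomial of
  that vector take the place of the Jordan form.\<close>

definition poly_apply :: "complex^'n^'n \<Rightarrow> complex poly \<Rightarrow> complex^'n \<Rightarrow> complex^'n" where
  "poly_apply A p v = (\<Sum>i\<le>degree p. coeff p i *s ((*v) A ^^ i) v)"

lemma poly_apply_eq:
  assumes "degree p \<le> N"
  shows "poly_apply A p v = (\<Sum>i\<le>N. coeff p i *s ((*v) A ^^ i) v)"
  unfolding poly_apply_def
  by (rule sum.mono_neutral_left) (use assms in \<open>auto simp: coeff_eq_0\<close>)

lemma poly_apply_0 [simp]: "poly_apply A 0 v = 0"
  by (simp add: poly_apply_def)

lemma poly_apply_add: "poly_apply A (p + q) v = poly_apply A p v + poly_apply A q v"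
  using poly_apply_eq[of "p + q" "max (degree p) (degree q)" A v]
    poly_apply_eq[of p "max (degree p) (degree q)" A v]
    poly_apply_eq[of q "max (degree p) (degree q)" A v]
  by (simp add: degree_add_le vec.scale_left_distrib sum.distrib)

lemma poly_apply_smult: "poly_apply A (smult c p) v = c *s poly_apply A p v"
  using poly_apply_eq[of "smult c p" "degree p" A v]
  by (simp add: poly_apply_def vec.scale_sum_right)

lemma poly_apply_pCons: "poly_apply A (pCons a p) v = a *s v + poly_apply A p (A *v v)"
proof -
  have "poly_apply A (pCons a p) v = (\<Sum>i\<le>Suc (degree p). coeff (pCons a p) i *s ((*v) A ^^ i) v)"
    by (rule poly_apply_eq) (rule degree_pCons_le)
  also have "\<dots> = a *s v + (\<Sum>i\<le>degree p. coeff p i *s ((*v) A ^^ Suc i) v)"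
    by (subst sum.atMost_Suc_shift) simp
  finally show ?thesis
    by (simp add: poly_apply_def funpow_swap1)
qed

lemma poly_apply_diff: "poly_apply A p (v - w) = poly_apply A p v - poly_apply A p w"
  by (induction p arbitrary: v w)
    (simp_all add: poly_apply_pCons vec.scale_right_diff_distrib matrix_vector_mult_diff_distrib)

lemma poly_apply_scale: "poly_apply A p (c *s v) = c *s poly_apply A p v"
  by (induction p arbitrary: v)
    (simp_all add: poly_apply_pCons vec.scale_right_distrib vector_scalar_commute mult.commute)

lemma poly_apply_mult_vec: "poly_apply A p (A *v v) = A *v poly_apply A p v"
  by (induction p arbitrary: v)
    (simp_all add: poly_apply_pCons matrix_vector_right_distrib vector_scalar_commute)

lemma poly_apply_linear_factor:
  "poly_apply A ([:- \<mu>, 1:] * q) v = poly_apply A q (A *v v - \<mu> *s v)"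
proof -
  have "[:- \<mu>, 1:] * q = smult (- \<mu>) q + pCons 0 q"
    by simp
  then have "poly_apply A ([:- \<mu>, 1:] * q) v = (- \<mu>) *s poly_apply A q v + (0 *s v + poly_apply A q (A *v v))"
    by (simp only: poly_apply_add poly_apply_smult poly_apply_pCons)
  then show ?thesis
    by (simp add: poly_apply_diff poly_apply_scale)
qed

text \<open>Stated for a sequence because iterates of a vector may repeat. A repetition is itself a
  relation, but linear dependence of the set of values would not see it.\<close>

lemma ex_sequence_dependence:
  fixes V :: "nat \<Rightarrow> 'a::euclidean_space"
  obtains c :: "nat \<Rightarrow> real" and i where "i \<le> DIM('a)" "c i \<noteq> 0"
    "(\<Sum>i\<le>DIM('a). c i *\<^sub>R V i) = 0"
proof (cases "inj_on V {..DIM('a)}")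
  case True
  then have "dependent (V ` {..DIM('a)})"
    by (intro dependent_biggerset) (simp add: card_image)
  then obtain u v where u: "v \<in> V ` {..DIM('a)}" "u v \<noteq> 0" "(\<Sum>v\<in>V ` {..DIM('a)}. u v *\<^sub>R v) = 0"
    using real_vector.dependent_finite[of "V ` {..DIM('a)}"] by auto
  then obtain i where "i \<le> DIM('a)" "v = V i" by auto
  with u True that[of i "\<lambda>i. u (V i)"] show ?thesis
    by (simp add: sum.reindex)
next
  case False
  then obtain i j where ij: "i \<le> DIM('a)" "j \<le> DIM('a)" "i \<noteq> j" "V i = V j"
    unfolding inj_on_def by auto
  have "(\<Sum>k\<le>DIM('a). ((if k = i then 1 else 0) - (if k = j then 1 else 0)) *\<^sub>R V k)
      = (\<Sum>k\<le>DIM('a). if k = i then V k else 0) - (\<Sum>k\<le>DIM('a). if k = j then V k else 0)"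
    unfolding sum_subtractf[symmetric] by (rule sum.cong) auto
  also have "\<dots> = 0" using ij by (simp add: sum.delta)
  finally show ?thesis
    using that[of i "\<lambda>k. (if k = i then 1 else 0) - (if k = j then 1 else 0)"] ij by simp
qed

lemma ex_annihilating_poly:
  fixes A :: "complex^'n^'n"
  obtains p where "p \<noteq> 0" "poly_apply A p v = 0"
proof -
  \<comment> \<open>This is the dimension over the reals, so the relation found has real
    coefficients.\<close>
  let ?N = "DIM(complex^'n)"
  obtain c i where c: "i \<le> ?N" "c i \<noteq> 0" "(\<Sum>i\<le>?N. c i *\<^sub>R ((*v) A ^^ i) v) = 0"
    using ex_sequence_dependence[of "\<lambda>i. ((*v) A ^^ i) v"] by blast
  define p where "p = (\<Sum>i\<le>?N. monom (complex_of_real (c i)) i)"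
  have co: "coeff p k = (if k \<le> ?N then of_real (c k) else 0)" for k
    unfolding p_def by (simp add: coeff_sum sum.delta)
  have "poly_apply A p v = (\<Sum>i\<le>?N. coeff p i *s ((*v) A ^^ i) v)"
    by (rule poly_apply_eq, rule degree_le) (simp add: co)
  also have "\<dots> = (\<Sum>i\<le>?N. c i *\<^sub>R ((*v) A ^^ i) v)"
    by (rule sum.cong) (auto simp: co vec_eq_iff scaleR_conv_of_real[where 'a = complex])
  finally show ?thesis
    using that[of p] c co[of i] by (metis coeff_0 of_real_eq_0_iff)
qed

text \<open>Here \<phi> v s stands for one coordinate of exp(sA) v. Splitting off a root \<mu> of
  the annihilating polynomial leaves a scalar linear equation for \<phi> v, forced by \<phi> w with
  \<open>w\<close> annihilated by the quotient; hence the induction on the degree.\<close>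

lemma exp_decay_of_annihilated:
  fixes A :: "complex^'n^'n" and \<phi> :: "complex^'n \<Rightarrow> real \<Rightarrow> complex"
  assumes eig: "\<And>z v. v \<noteq> 0 \<Longrightarrow> A *v v = z *s v \<Longrightarrow> Re z < 0"
    and deriv: "\<And>v s. (\<phi> v has_vector_derivative \<phi> (A *v v) s) (at s)"
    and diff: "\<And>v w s. \<phi> (v - w) s = \<phi> v s - \<phi> w s"
    and scale: "\<And>c v s. \<phi> (c *s v) s = c * \<phi> v s"
    and p: "p \<noteq> 0" "poly_apply A p v = 0"
  shows "exp_decay (\<phi> v)"
  using p
proof (induction "degree p" arbitrary: p v)
  case 0
  then obtain a where "p = [:a:]" "a \<noteq> 0"
    by (metis degree_eq_zeroE pCons_eq_0_iff)
  with 0 have "v = 0" by (simp add: poly_apply_pCons)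
  then have "\<phi> v s = 0" for s
    using scale[of 0 v s] by simp
  then show ?case
    unfolding exp_decay_def by (auto intro!: exI[of _ 0] exI[of _ 1])
next
  case (Suc n)
  then obtain \<mu> where "poly p \<mu> = 0"
    using fundamental_theorem_of_algebra[of p] constant_degree[of p] by auto
  then obtain q where q: "p = [:- \<mu>, 1:] * q"
    by (auto simp: poly_eq_0_iff_dvd)
  with Suc.prems have "q \<noteq> 0" by auto
  then have deg: "n = degree q"
    using Suc.hyps(2) q by (simp add: degree_mult_eq del: mult_pCons_left)
  define w where "w = A *v v - \<mu> *s v"
  have w: "poly_apply A q w = 0"
    using Suc.prems(2) unfolding q poly_apply_linear_factor w_def .
  show ?case
  proof (cases "Re \<mu> < 0")
    case True
    have "\<phi> (A *v v) s = \<mu> * \<phi> v s + \<phi> w s" for s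
      by (simp add: w_def diff scale)
    with deriv[of v] have "(\<phi> v has_vector_derivative \<mu> * \<phi> v s + \<phi> w s) (at s)" for s
      by metis
    then show ?thesis
      using exp_decay_ode Suc.hyps(1)[OF deg \<open>q \<noteq> 0\<close> w] True by blast
  next
    case False
    \<comment> \<open>A root with nonnegative real part is no eigenvalue, so q(A) v, which satisfies
      the eigenvector equation for \<mu>, must vanish. Thus \<open>q\<close> already annihilates
      \<open>v\<close>.\<close>
    have "A *v poly_apply A q v = \<mu> *s poly_apply A q v"
      using w by (simp add: w_def poly_apply_diff poly_apply_scale poly_apply_mult_vec)
    with False eig have "poly_apply A q v = 0" by blast
    then show ?thesis
      using Suc.hyps(1)[OF deg \<open>q \<noteq> 0\<close>] by blast
  qed
qed

lemma matrix_exp_decay: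
  fixes B :: "real^'n^'n"
  assumes "\<And>z. complex_eigenvalue B z \<Longrightarrow> Re z < 0"
  obtains C c where "0 < c" "0 \<le> C" "\<And>s. 0 \<le> s \<Longrightarrow> norm (matrix_exp (s *\<^sub>R B)) \<le> C * exp (- c * s)"
proof -
  let ?c = "map_matrix complex_of_real :: real^'n^'n \<Rightarrow> complex^'n^'n"
  have mult: "?c (X ** Y) *v v = ?c X *v (?c Y *v v)" for X Y :: "real^'n^'n" and v
    unfolding matrix_vector_mul_assoc
    by (rule arg_cong[where f = "\<lambda>M. M *v v"]) (simp add: vec_eq_iff matrix_matrix_mult_def)
  have "\<exists>C c. 0 < c \<and> (\<forall>s\<ge>0. \<bar>matrix_exp (s *\<^sub>R B) $ i $ j\<bar> \<le> C * exp (- c * s))" for i j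
  proof -
    define \<phi> where "\<phi> v s = (?c (matrix_exp (s *\<^sub>R B)) *v v) $ i" for v s
    have "exp_decay (\<phi> v)" for v
    proof -
      obtain p where p: "p \<noteq> 0" "poly_apply (?c B) p v = 0"
        using ex_annihilating_poly by blast
      show ?thesis
      proof (rule exp_decay_of_annihilated[OF _ _ _ _ p])
        show "Re z < 0" if "v \<noteq> 0" "?c B *v v = z *s v" for z v
          using assms that unfolding complex_eigenvalue_def by blast
        show "(\<phi> v has_vector_derivative \<phi> (?c B *v v) s) (at s)" for v s
        proof -
          have "linear (\<lambda>X. (?c X *v v) $ i)"
            unfolding linear_iff
            by (auto simp: matrix_vector_mult_def sum.distrib scaleR_sum_right
                algebra_simps scaleR_conv_of_real[where 'a = complex] sum_distrib_left)
          then have "bounded_linear (\<lambda>X. (?c X *v v) $ i)"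
            by (simp add: linear_conv_bounded_linear)
          from bounded_linear.has_vector_derivative[OF this has_vector_derivative_matrix_exp]
          have "(\<phi> v has_vector_derivative (?c (B ** matrix_exp (s *\<^sub>R B)) *v v) $ i) (at s)"
            unfolding \<phi>_def .
          then show ?thesis
            unfolding matrix_exp_commute[symmetric] mult \<phi>_def .
        qed
        show "\<phi> (v - w) s = \<phi> v s - \<phi> w s" for v w s
          by (simp add: \<phi>_def matrix_vector_mult_diff_distrib)
        show "\<phi> (c *s v) s = c * \<phi> v s" for c v s
          by (simp add: \<phi>_def vector_scalar_commute)
      qed
    qed
    from this[of "axis j 1"] show ?thesis
      unfolding exp_decay_def \<phi>_def
      by (simp add: matrix_vector_mult_def axis_def if_distrib sum.delta cong: if_cong)
  qed
  then obtain C c where c: "\<And>i j. 0 < c i j"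
    and C: "\<And>i j s. 0 \<le> s \<Longrightarrow> \<bar>matrix_exp (s *\<^sub>R B) $ i $ j\<bar> \<le> C i j * exp (- c i j * s)"
    by metis
  have C0: "0 \<le> C i j" for i j
    using C[of 0 i j] abs_ge_zero[of "matrix_exp (0 *\<^sub>R B) $ i $ j"] by simp
  define d where "d = Min (range (\<lambda>(i, j). c i j))"
  have d: "0 < d" "d \<le> c i j" for i j
    unfolding d_def using c by (auto intro!: Min_le image_eqI[of _ _ "(i, j)"])
  have "norm (matrix_exp (s *\<^sub>R B)) \<le> (\<Sum>i\<in>UNIV. \<Sum>j\<in>UNIV. C i j) * exp (- d * s)" if s: "0 \<le> s" for s
  proof -
    have "norm (matrix_exp (s *\<^sub>R B)) \<le> (\<Sum>i\<in>UNIV. norm (matrix_exp (s *\<^sub>R B) $ i))"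
      unfolding norm_vec_def by (rule L2_set_le_sum) simp
    also have "\<dots> \<le> (\<Sum>i\<in>UNIV. \<Sum>j\<in>UNIV. \<bar>matrix_exp (s *\<^sub>R B) $ i $ j\<bar>)"
      by (intro sum_mono norm_le_l1_cart)
    also have "\<dots> \<le> (\<Sum>i\<in>UNIV. \<Sum>j\<in>UNIV. C i j * exp (- d * s))"
    proof (intro sum_mono)
      fix i j
      have "\<bar>matrix_exp (s *\<^sub>R B) $ i $ j\<bar> \<le> C i j * exp (- c i j * s)" using C s by blast
      also have "\<dots> \<le> C i j * exp (- d * s)"
        using C0 d s by (intro mult_left_mono) (auto intro: mult_right_mono)
      finally show "\<bar>matrix_exp (s *\<^sub>R B) $ i $ j\<bar> \<le> C i j * exp (- d * s)" .
    qed
    finally show ?thesis by (simp add: sum_distrib_right)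
  qed
  moreover have "0 \<le> (\<Sum>i\<in>UNIV. \<Sum>j\<in>UNIV. C i j)"
    using C0 by (intro sum_nonneg) auto
  ultimately show ?thesis using that d(1) by blast
qed

section \<open>Covariance matrices\<close>

text \<open>The interval is symmetric so that the bound also covers the inverse exponential, from
  which lower bounds for exp(sA) x follow.\<close>

lemma matrix_exp_local_bound:
  fixes A :: "real^'n^'n"
  obtains b where "1 \<le> b" "\<And>s x. \<bar>s\<bar> \<le> 1 \<Longrightarrow> norm (matrix_exp (s *\<^sub>R A) *v x) \<le> b * norm x"
proof -
  have "continuous_on {-1..1} (\<lambda>s. matrix_exp (s *\<^sub>R A))"
    by (rule continuous_on_vector_derivative[OF has_vector_derivative_matrix_exp])
  then have "compact ((\<lambda>s. matrix_exp (s *\<^sub>R A)) ` {-1..1})"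
    by (rule compact_continuous_image) simp
  then have "bounded ((\<lambda>s. matrix_exp (s *\<^sub>R A)) ` {-1..1})"
    by (rule compact_imp_bounded)
  then obtain a where a: "0 < a" "\<And>s. s \<in> {-1..1} \<Longrightarrow> norm (matrix_exp (s *\<^sub>R A)) \<le> a"
    unfolding bounded_pos by auto
  obtain k where k: "0 < k" "\<And>(M::real^'n^'n) x. norm (M *v x) \<le> norm M * norm x * k"
    using bounded_bilinear.pos_bounded[OF bounded_bilinear_matrix_vector_mult] by metis
  show ?thesis
  proof
    show "1 \<le> max 1 (a * k)" by simp
    fix s :: real and x :: "real^'n" assume s: "\<bar>s\<bar> \<le> 1"
    have "s \<in> {-1..1}" using s by auto
    have "norm (matrix_exp (s *\<^sub>R A) *v x) \<le> norm (matrix_exp (s *\<^sub>R A)) * norm x * k"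
      by (rule k(2))
    also have "\<dots> \<le> a * norm x * k"
      using a(2)[OF \<open>s \<in> {-1..1}\<close>] k(1) by (intro mult_right_mono) auto
    also have "\<dots> = (a * k) * norm x" by simp
    also have "\<dots> \<le> max 1 (a * k) * norm x" by (intro mult_right_mono) auto
    finally show "norm (matrix_exp (s *\<^sub>R A) *v x) \<le> max 1 (a * k) * norm x" .
  qed
qed

section \<open>Quantitative bounds for matrices, their inverses and determinants\<close>

lemma matrix_vector_bound:
  fixes A :: "real^'n^'m"
  obtains k where "0 < k" "\<And>x. norm (A *v x) \<le> k * norm x"
  using bounded_linear.pos_bounded[OF matrix_vector_mul_bounded_linear[of A]] by (metis mult.commute)

lemma inner_matrix_vector: "(A *v x) \<bullet> y = x \<bullet> (transpose A *v y)" for A :: "real^'n^'m"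
  by (simp add: dot_lmul_matrix[symmetric] inner_commute)

lemma positive_definite_lower_bound:
  fixes A :: "real^'n^'n"
  assumes "positive_definite A"
  obtains q where "0 < q" "\<And>x. q * (norm x)\<^sup>2 \<le> (A *v x) \<bullet> x"
proof -
  have cont: "continuous_on (sphere 0 1) (\<lambda>x::real^'n. (A *v x) \<bullet> x)"
    by (intro continuous_intros)
  have "sphere (0::real^'n) 1 \<noteq> {}" by simp
  from continuous_attains_inf[OF compact_sphere this cont]
  obtain x0 where x0: "x0 \<in> sphere 0 1" "\<And>x. x \<in> sphere 0 1 \<Longrightarrow> (A *v x0) \<bullet> x0 \<le> (A *v x) \<bullet> x"
    by auto
  show ?thesis
  proof
    show "0 < (A *v x0) \<bullet> x0"
    proof -
      have "x0 \<noteq> 0" using x0(1) by auto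
      then show ?thesis using assms unfolding positive_definite_def by blast
    qed
    fix x :: "real^'n"
    show "(A *v x0) \<bullet> x0 * (norm x)\<^sup>2 \<le> (A *v x) \<bullet> x"
    proof (cases "x = 0")
      case False
      define e where "e = (1 / norm x) *\<^sub>R x"
      have "e \<in> sphere 0 1" using False by (simp add: e_def)
      then have "(A *v x0) \<bullet> x0 * (norm x)\<^sup>2 \<le> (A *v e) \<bullet> e * (norm x)\<^sup>2"
        using x0(2) by (intro mult_right_mono) auto
      also have "\<dots> = (A *v (norm x *\<^sub>R e)) \<bullet> (norm x *\<^sub>R e)"
        by (simp add: matrix_vector_mult_scaleR power2_eq_square)
      also have "norm x *\<^sub>R e = x" using False by (simp add: e_def)
      finally show ?thesis .
    qed simp
  qed
qed

lemma det_le_of_entries: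
  fixes A :: "real^'n^'n"
  assumes "\<And>i j. \<bar>A $ i $ j\<bar> \<le> k"
  shows "\<bar>det A\<bar> \<le> fact CARD('n) * k ^ CARD('n)"
proof -
  have "\<bar>det A\<bar> \<le> (\<Sum>p | p permutes (UNIV::'n set). \<bar>of_int (sign p) * (\<Prod>i\<in>UNIV. A $ i $ p i)\<bar>)"
    unfolding det_def by (rule sum_abs)
  also have "\<dots> \<le> (\<Sum>p | p permutes (UNIV::'n set). k ^ CARD('n))"
  proof (rule sum_mono)
    fix p :: "'n \<Rightarrow> 'n"
    have "\<bar>of_int (sign p) * (\<Prod>i\<in>UNIV. A $ i $ p i)\<bar> = (\<Prod>i\<in>UNIV. \<bar>A $ i $ p i\<bar>)"
      by (simp add: abs_mult sign_def abs_prod)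
    also have "\<dots> \<le> (\<Prod>i\<in>(UNIV::'n set). k)"
      using assms by (intro prod_mono) auto
    finally show "\<bar>of_int (sign p) * (\<Prod>i\<in>UNIV. A $ i $ p i)\<bar> \<le> k ^ CARD('n)" by simp
  qed
  also have "\<dots> = fact CARD('n) * k ^ CARD('n)"
    using card_permutations[of "UNIV::'n set" "CARD('n)"] by simp
  finally show ?thesis .
qed

text \<open>The entries of the inverse are at most 1/l, so the Leibniz formula bounds the
  determinant of the inverse, and multiplicativity turns this into a lower bound for det A. The
  factorial is wasteful, but only the power of \<open>l\<close> matters later.\<close>

lemma matrix_inv_of_lower_bound:
  fixes A :: "real^'n^'n"
  assumes "0 < l" "\<And>y. l * norm y \<le> norm (A *v y)"
  shows "A ** matrix_inv A = mat 1" "matrix_inv A ** A = mat 1" "l ^ CARD('n) \<le> fact CARD('n) * \<bar>det A\<bar>"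
proof -
  have "inj ((*v) A)"
  proof (rule injI)
    fix x y assume "A *v x = A *v y"
    then have "A *v (x - y) = 0" by (simp add: matrix_vector_mult_diff_distrib)
    with assms(2)[of "x - y"] have "l * norm (x - y) \<le> 0" by simp
    with \<open>0 < l\<close> show "x = y" by (simp add: mult_le_0_iff)
  qed
  then have inv: "invertible A"
    by (metis inj_matrix_vector_mult invertible_left_inverse matrix_left_invertible_injective)
  then have ex: "\<exists>A'. A ** A' = mat 1 \<and> A' ** A = mat 1"
    by (simp add: invertible_def)
  have "A ** matrix_inv A = mat 1 \<and> matrix_inv A ** A = mat 1"
    unfolding matrix_inv_def by (rule someI_ex[OF ex])
  then show I: "A ** matrix_inv A = mat 1" "matrix_inv A ** A = mat 1" by auto
  have entry: "\<bar>matrix_inv A $ i $ j\<bar> \<le> 1 / l" for i j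
  proof -
    have "A *v (matrix_inv A *v axis j 1) = axis j 1" by (simp add: matrix_vector_mul_assoc I)
    then have "l * norm (matrix_inv A *v axis j 1) \<le> 1" using assms(2)[of "matrix_inv A *v axis j 1"] by simp
    moreover have "matrix_inv A $ i $ j = (matrix_inv A *v axis j 1) $ i"
      by (simp add: matrix_vector_mult_basis column_def)
    then have "\<bar>matrix_inv A $ i $ j\<bar> \<le> norm (matrix_inv A *v axis j 1)"
      using component_le_norm_cart by metis
    then have "l * \<bar>matrix_inv A $ i $ j\<bar> \<le> l * norm (matrix_inv A *v axis j 1)"
      using \<open>0 < l\<close> by (intro mult_left_mono) auto
    ultimately have "l * \<bar>matrix_inv A $ i $ j\<bar> \<le> 1" by linarith
    then show ?thesis
      using \<open>0 < l\<close> by (simp add: pos_le_divide_eq mult.commute)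
  qed
  have "\<bar>det (matrix_inv A)\<bar> \<le> fact CARD('n) * (1 / l) ^ CARD('n)"
    using det_le_of_entries[OF entry] .
  then have "\<bar>det A\<bar> * \<bar>det (matrix_inv A)\<bar> \<le> \<bar>det A\<bar> * (fact CARD('n) * (1 / l) ^ CARD('n))"
    by (rule mult_left_mono) simp
  moreover have "\<bar>det A\<bar> * \<bar>det (matrix_inv A)\<bar> = 1"
    using det_mul[of A "matrix_inv A"] by (simp add: I abs_mult[symmetric])
  ultimately show "l ^ CARD('n) \<le> fact CARD('n) * \<bar>det A\<bar>"
    using \<open>0 < l\<close> by (simp add: power_one_over field_simps)
qed

lemma norm_lower_bound_of_form:
  fixes A :: "real^'n^'n"
  assumes "\<And>y. l * (norm y)\<^sup>2 \<le> (A *v y) \<bullet> y"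
  shows "l * norm y \<le> norm (A *v y)"
proof (cases "y = 0")
  case False
  have "(l * norm y) * norm y \<le> (A *v y) \<bullet> y"
    using assms[of y] by (simp add: power2_eq_square mult.assoc)
  also have "\<dots> \<le> norm (A *v y) * norm y" by (rule norm_cauchy_schwarz)
  finally show ?thesis using False by simp
qed simp

text \<open>With b = A y this is the bound |b|^2 / C \<le> <A^(-1) b, b>, phrased without an
  inverse.\<close>

lemma inverse_form_lower_bound:
  fixes A :: "real^'n^'n"
  assumes C: "0 < C" and A: "transpose A = A" "\<And>y. 0 \<le> (A *v y) \<bullet> y"
    "\<And>y. (A *v y) \<bullet> y \<le> C * (norm y)\<^sup>2"
  shows "(norm (A *v y))\<^sup>2 / C \<le> y \<bullet> (A *v y)"
proof -
  define b where "b = A *v y"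
  have sw: "(A *v b) \<bullet> y = b \<bullet> b"
    using inner_matrix_vector[of A b y] A(1) by (simp add: b_def)
  \<comment> \<open>minimising \<open>s \<mapsto> A(y - s b) \<bullet> (y - s b)\<close>, with the upper bound for \<open>A b \<bullet> b\<close>, gives \<open>s = 1 / C\<close>\<close>
  have "0 \<le> (A *v (y - (1 / C) *\<^sub>R b)) \<bullet> (y - (1 / C) *\<^sub>R b)" by (rule A(2))
  also have "\<dots> = b \<bullet> y - (1 / C) * (b \<bullet> b) - (1 / C) * ((A *v b) \<bullet> y) + (1 / C) * ((1 / C) * ((A *v b) \<bullet> b))"
    by (simp add: matrix_vector_mult_diff_distrib matrix_vector_mult_scaleR inner_diff_left inner_diff_right
        b_def[symmetric] algebra_simps)
  also have "(1 / C) * ((1 / C) * ((A *v b) \<bullet> b)) \<le> (1 / C) * ((1 / C) * (C * (norm b)\<^sup>2))"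
    using C A(3)[of b] by (intro mult_left_mono) auto
  also have "\<dots> = (1 / C) * (b \<bullet> b)" using C by (simp add: power2_norm_eq_inner)
  finally have "(1 / C) * (b \<bullet> b) \<le> b \<bullet> y" using sw by simp
  then show ?thesis by (simp add: b_def power2_norm_eq_inner inner_commute)
qed

lemma nonneg_derivative_imp_le:
  fixes f :: "real \<Rightarrow> real"
  assumes "a \<le> b" "\<And>x. a \<le> x \<Longrightarrow> x \<le> b \<Longrightarrow> (f has_real_derivative f' x) (at x)"
    "\<And>x. a \<le> x \<Longrightarrow> x \<le> b \<Longrightarrow> 0 \<le> f' x"
  shows "f a \<le> f b"
  using assms by (intro DERIV_nonneg_imp_nondecreasing[of a b f]) blast+

section \<open>Covariance matrices and the Lyapunov equation\<close>

locale ornstein_uhlenbeck =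
  fixes Q B :: "real^'n^'n"
  assumes symmetric: "symmetric_matrix Q" and positive: "positive_definite Q"
    and stable: "\<And>z. complex_eigenvalue B z \<Longrightarrow> Re z < 0"
begin

definition M :: "real \<Rightarrow> real^'n^'n" where "M s = matrix_exp (s *\<^sub>R B)"
definition N :: "real \<Rightarrow> real^'n^'n" where "N s = matrix_exp (s *\<^sub>R transpose B)"
definition G :: "real \<Rightarrow> real^'n^'n" where "G s = M s ** Q ** N s"
definition S :: "real^'n^'n" where "S = ou_cov Q B \<infinity>"
definition T :: "real \<Rightarrow> real^'n^'n" where "T t = ou_cov Q B (ereal t)"

lemma transpose_M: "transpose (M s) = N s"
  by (simp add: M_def N_def transpose_matrix_exp linear_scale[OF bounded_linear.linear[OF bounded_linear_transpose]])

lemma transpose_N: "transpose (N s) = M s"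
  by (simp add: transpose_M[symmetric])

lemma transpose_Q: "transpose Q = Q"
  using symmetric by (simp add: symmetric_matrix_def)

lemma transpose_G: "transpose (G s) = G s"
  by (simp add: G_def matrix_transpose_mul transpose_M transpose_N transpose_Q matrix_mul_assoc)

lemma M_minus: "M (- s) ** M s = mat 1" "M s ** M (- s) = mat 1"
  and N_minus: "N (- s) ** N s = mat 1" "N s ** N (- s) = mat 1"
  unfolding M_def N_def using matrix_exp_minus[of s] matrix_exp_minus[of "- s"] by auto

lemma N_add: "N (s + t) = N s ** N t"
  by (simp add: N_def matrix_exp_add)

lemma M_commute: "B ** M s = M s ** B" and N_commute: "transpose B ** N s = N s ** transpose B"
  by (simp_all add: M_def N_def matrix_exp_commute)

lemma M_deriv: "(M has_vector_derivative B ** M s) (at s within X)"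
  and N_deriv: "(N has_vector_derivative transpose B ** N s) (at s within X)"
  unfolding M_def N_def by (rule has_vector_derivative_matrix_exp)+

text \<open>Since B commutes with \<open>M s\<close>, the derivative is again a conjugated matrix.
  It is used with \<open>A = Q\<close> for the integrand and with \<open>A = S\<close> for the
  remainder of the covariance integral.\<close>

lemma conj_deriv: "((\<lambda>s. M s ** A ** N s) has_vector_derivative M s ** (B ** A + A ** transpose B) ** N s) (at s within X)"
proof -
  have "((\<lambda>s. M s ** A) has_vector_derivative M s ** 0 + (B ** M s) ** A) (at s within X)"
    by (rule has_vector_derivative_matrix_mult[OF M_deriv has_vector_derivative_const])
  from has_vector_derivative_matrix_mult[OF this N_deriv] have "((\<lambda>s. M s ** A ** N s) has_vector_derivative
      M s ** A ** (transpose B ** N s) + (M s ** 0 + (B ** M s) ** A) ** N s) (at s within X)"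
    .
  then show ?thesis
    by (simp add: M_commute matrix_add_ldistrib matrix_mult_add_left matrix_mul_assoc add.commute)
qed

lemma G_deriv: "(G has_vector_derivative B ** G s + G s ** transpose B) (at s within X)"
proof -
  have "M s ** (B ** Q + Q ** transpose B) ** N s = B ** G s + G s ** transpose B"
  proof -
    have "B ** G s = M s ** (B ** Q) ** N s"
      by (simp add: G_def matrix_mul_assoc M_commute)
    moreover have "G s ** transpose B = M s ** (Q ** transpose B) ** N s"
      by (simp add: G_def matrix_mul_assoc[symmetric] N_commute)
    ultimately show ?thesis
      by (simp add: matrix_add_ldistrib matrix_mult_add_left)
  qed
  then show ?thesis
    using conj_deriv[of Q s X] by (simp add: G_def[abs_def])
qed

lemma G_continuous: "continuous_on X G"
  by (rule continuous_on_vector_derivative[OF G_deriv])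

text \<open>The eigenvalue hypothesis enters the estimates here: it makes the integral for the limit
  covariance converge and kills the boundary term in \<open>lyapunov\<close>.\<close>

lemma G_decay:
  obtains C c where "0 < c" "\<And>s. 0 \<le> s \<Longrightarrow> norm (G s) \<le> C * exp (- c * s)"
proof -
  obtain C c where c: "0 < c" "0 \<le> C" and C: "\<And>s. 0 \<le> s \<Longrightarrow> norm (M s) \<le> C * exp (- c * s)"
    using matrix_exp_decay[OF stable] unfolding M_def by metis
  obtain k where k: "0 < k" "\<And>(X::real^'n^'n) (Y::real^'n^'n). norm (X ** Y) \<le> norm X * norm Y * k"
    using bounded_bilinear.pos_bounded[OF bounded_bilinear_matrix_mult] by metis
  obtain l where l: "0 < l" "\<And>X::real^'n^'n. norm (transpose X) \<le> norm X * l"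
    using bounded_linear.pos_bounded[OF bounded_linear_transpose] by metis
  have "norm (G s) \<le> (C * norm Q * k * l * C * k) * exp (- c * s)" if s: "0 \<le> s" for s
  proof -
    have "norm (G s) \<le> norm (M s ** Q) * norm (N s) * k"
      unfolding G_def by (rule k)
    also have "\<dots> \<le> (norm (M s) * norm Q * k) * (norm (M s) * l) * k"
      using k l(2)[of "M s"] l(1) by (intro mult_right_mono mult_mono) (auto simp: transpose_M)
    also have "\<dots> = (norm (M s) * norm (M s)) * (norm Q * k * l * k)" by simp
    also have "norm (M s) * norm (M s) \<le> (C * exp (- c * s)) * (C * 1)"
    proof -
      have "C * exp (- c * s) \<le> C * 1" using c s by (intro mult_left_mono) auto
      with C[OF s] c show ?thesis by (intro mult_mono) auto
    qed
    finally show ?thesis using k l by (simp add: mult_ac mult_right_mono)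
  qed
  with c(1) that show ?thesis by blast
qed

lemma T_eq: "T t = integral {0..t} G" if "0 \<le> t"
proof -
  have "{s. 0 \<le> s \<and> ereal s \<le> ereal t} = {0..t}" by auto
  then show ?thesis by (simp add: T_def ou_cov_def G_def[abs_def] M_def N_def)
qed

lemma S_eq: "S = integral {0..} G"
proof -
  have "{s. 0 \<le> s \<and> ereal s \<le> \<infinity>} = {0..}" by auto
  then show ?thesis by (simp add: S_def ou_cov_def G_def[abs_def] M_def N_def)
qed

lemma T_tendsto_S: "(\<lambda>k::nat. T (real k)) \<longlonglongrightarrow> S"
proof -
  obtain C c where c: "0 < c" and C: "\<And>s. 0 \<le> s \<Longrightarrow> norm (G s) \<le> C * exp (- c * s)"
    using G_decay by metis
  let ?f = "\<lambda>k s. if s \<in> {0..real k} then G s else 0"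
  have G_int: "G integrable_on {0..real k}" for k
    by (intro integrable_continuous_real G_continuous)
  have "(\<lambda>k. integral {0..} (?f k)) \<longlonglongrightarrow> integral {0..} G"
  proof (rule dominated_convergence(2))
    have restr: "{0..real k} \<inter> {0..} = {0..real k}" for k by auto
    show "?f k integrable_on {0..}" for k
      using G_int[of k] integrable_restrict_Int[of "{0..real k}" G "{0..}"] by (simp add: restr)
    have "(\<lambda>s. exp (- c * s)) integrable_on {0..}"
      using integrable_on_exp_minus_to_infinity[OF c] by simp
    then show "(\<lambda>s. C * exp (- c * s)) integrable_on {0..}"
      by (rule integrable_on_mult_right)
    have "0 \<le> C" using C[of 0] norm_ge_zero[of "G 0"] by (simp del: norm_ge_zero)
    then show "norm (?f k s) \<le> C * exp (- c * s)" if "s \<in> {0..}" for k s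
      using C[of s] that by auto
    show "(\<lambda>k. ?f k s) \<longlonglongrightarrow> G s" if "s \<in> {0..}" for s
    proof (rule tendsto_eventually)
      have "\<forall>\<^sub>F k in sequentially. s \<le> real k"
        using eventually_ge_at_top[of "nat \<lceil>s\<rceil>"] by eventually_elim linarith
      then show "\<forall>\<^sub>F k in sequentially. ?f k s = G s"
        by eventually_elim (use that in auto)
    qed
  qed
  moreover have "integral {0..} (?f k) = T (real k)" for k
  proof -
    have "{0..real k} \<inter> {0..} = {0..real k}" by auto
    then show ?thesis
      using integral_restrict_Int[of "{0..}" "{0..real k}" G] by (simp add: T_eq Int_commute)
  qed
  ultimately show ?thesis by (simp add: S_eq)
qed

lemma G_tendsto_0: "(\<lambda>k::nat. G (real k)) \<longlonglongrightarrow> 0"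
proof -
  obtain C c where c: "0 < c" and C: "\<And>s. 0 \<le> s \<Longrightarrow> norm (G s) \<le> C * exp (- c * s)"
    using G_decay by metis
  have 1: "(\<lambda>k::nat. C * exp (- c) ^ k) \<longlonglongrightarrow> C * 0"
    using c by (intro tendsto_mult tendsto_const LIMSEQ_realpow_zero) auto
  have 2: "norm (G (real k)) \<le> C * exp (- c) ^ k" for k
    using C[of "real k"] exp_of_nat_mult[of k "- c"] by (simp add: mult.commute)
  show ?thesis
  proof (rule Lim_null_comparison)
    show "\<forall>\<^sub>F k in sequentially. norm (G (real k)) \<le> C * exp (- c) ^ k"
      using 2 by (intro always_eventually) blast
    show "(\<lambda>k::nat. C * exp (- c) ^ k) \<longlonglongrightarrow> 0" using 1 by simp
  qed
qed

text \<open>The derivative of \<open>G\<close> is B G + G B^T. Integrated over {0..t} it gives G t -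
  Q on one side and the Lyapunov expression of \<open>T t\<close> on the other; then t tends to
  infinity along the integers.\<close>

lemma lyapunov: "B ** S + S ** transpose B = - Q"
proof (rule LIMSEQ_unique)
  show "(\<lambda>k. B ** T (real k) + T (real k) ** transpose B) \<longlonglongrightarrow> B ** S + S ** transpose B"
    by (intro tendsto_add bounded_bilinear.tendsto[OF bounded_bilinear_matrix_mult] tendsto_const T_tendsto_S)
  have "B ** T t + T t ** transpose B = G t - Q" if t: "0 \<le> t" for t
  proof -
    have "(G has_integral T t) {0..t}"
      unfolding T_eq[OF t] by (intro integrable_integral integrable_continuous_real G_continuous)
    then have "((\<lambda>s. B ** G s + G s ** transpose B) has_integral B ** T t + T t ** transpose B) {0..t}"
      by (intro has_integral_add
          has_integral_linear[OF _ bounded_bilinear.bounded_linear_right[OF bounded_bilinear_matrix_mult], unfolded o_def]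
          has_integral_linear[OF _ bounded_bilinear.bounded_linear_left[OF bounded_bilinear_matrix_mult], unfolded o_def])
    moreover have "((\<lambda>s. B ** G s + G s ** transpose B) has_integral G t - G 0) {0..t}"
      using t by (intro fundamental_theorem_of_calculus G_deriv)
    ultimately have "B ** T t + T t ** transpose B = G t - G 0"
      by (rule has_integral_unique)
    then show ?thesis by (simp add: G_def M_def N_def)
  qed
  moreover have "(\<lambda>k. G (real k) - Q) \<longlonglongrightarrow> 0 - Q"
    by (intro tendsto_diff tendsto_const G_tendsto_0)
  ultimately show "(\<lambda>k. B ** T (real k) + T (real k) ** transpose B) \<longlonglongrightarrow> - Q"
    by simp
qed

text \<open>By \<open>lyapunov\<close> the right side has derivative \<open>G t\<close> and vanishes
  at 0. This closed form replaces the integral in all later computations with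
  \<open>T t\<close>.\<close>

lemma T_decomp: "T t = S - M t ** S ** N t" if t: "0 \<le> t"
proof -
  have "((\<lambda>s. S - M s ** S ** N s) has_vector_derivative G s) (at s within {0..t})" for s
  proof -
    have "((\<lambda>s. S - M s ** S ** N s) has_vector_derivative 0 - M s ** (B ** S + S ** transpose B) ** N s) (at s within {0..t})"
      by (intro has_vector_derivative_diff conj_deriv has_vector_derivative_const)
    then show ?thesis
      by (simp add: lyapunov G_def matrix_mult_minus_left matrix_mult_minus_right)
  qed
  then have "(G has_integral (S - M t ** S ** N t) - (S - M 0 ** S ** N 0)) {0..t}"
    using t by (intro fundamental_theorem_of_calculus) auto
  then have "integral {0..t} G = S - M t ** S ** N t"
    by (simp add: integral_unique M_def N_def)
  then show ?thesis by (simp add: T_eq t)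
qed

lemma transpose_S: "transpose S = S"
proof (rule LIMSEQ_unique)
  have "transpose (T (real k)) = T (real k)" for k
  proof -
    have "transpose (integral {0..real k} G) = integral {0..real k} (transpose \<circ> G)"
      by (intro integral_linear[symmetric] bounded_linear_transpose integrable_continuous_real G_continuous)
    then show ?thesis by (simp add: T_eq o_def transpose_G)
  qed
  then show "(\<lambda>k. T (real k)) \<longlonglongrightarrow> transpose S"
    using bounded_linear.tendsto[OF bounded_linear_transpose T_tendsto_S] by simp
qed (rule T_tendsto_S)

lemma transpose_T: "transpose (T t) = T t" if "0 \<le> t"
  by (simp add: T_decomp that matrix_transpose_mul transpose_M transpose_N transpose_S matrix_mul_assoc
      linear_diff[OF bounded_linear.linear[OF bounded_linear_transpose]])

lemma T_form_deriv: "((\<lambda>t. (T t *v y) \<bullet> y) has_real_derivative (Q *v (N t *v y)) \<bullet> (N t *v y)) (at t)" if "0 < t"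
proof -
  have "((\<lambda>s. S - M s ** S ** N s) has_vector_derivative 0 - M t ** (B ** S + S ** transpose B) ** N t) (at t)"
    by (intro has_vector_derivative_diff conj_deriv has_vector_derivative_const)
  then have "((\<lambda>s. S - M s ** S ** N s) has_vector_derivative G t) (at t)"
    by (simp add: lyapunov G_def matrix_mult_minus_left matrix_mult_minus_right)
  then have "(T has_vector_derivative G t) (at t)"
    by (rule has_vector_derivative_transform_within_open[of _ _ _ "{0<..}"]) (use that in \<open>auto simp: T_decomp\<close>)
  moreover have "bounded_linear (\<lambda>A::real^'n^'n. (A *v y) \<bullet> y)"
    by (rule bounded_linear_compose[OF bounded_linear_inner_left[of y]
          bounded_bilinear.bounded_linear_left[OF bounded_bilinear_matrix_vector_mult, of y]])
  ultimately have "((\<lambda>t. (T t *v y) \<bullet> y) has_vector_derivative (G t *v y) \<bullet> y) (at t)"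
    by (intro bounded_linear.has_vector_derivative[of "\<lambda>A. (A *v y) \<bullet> y" T])
  moreover have "(G t *v y) \<bullet> y = (Q *v (N t *v y)) \<bullet> (N t *v y)"
    by (simp add: G_def matrix_vector_mul_assoc[symmetric] inner_matrix_vector[of "M t"] transpose_M)
  ultimately show ?thesis
    by (simp add: has_real_derivative_iff_has_vector_derivative)
qed


lemma Q_bounds:
  obtains q where "1 \<le> q" "\<And>x. (norm x)\<^sup>2 \<le> q * ((Q *v x) \<bullet> x)" "\<And>x. (Q *v x) \<bullet> x \<le> q * (norm x)\<^sup>2"
proof -
  obtain p where p: "0 < p" "\<And>x. p * (norm x)\<^sup>2 \<le> (Q *v x) \<bullet> x"
    by (rule positive_definite_lower_bound[OF positive]) (rule that)
  obtain k where k: "0 < k" "\<And>x. norm (Q *v x) \<le> k * norm x"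
    by (rule matrix_vector_bound[of Q]) (rule that)
  define q where "q = max 1 (max (1 / p) k)"
  show ?thesis
  proof
    show "1 \<le> q" by (simp add: q_def)
    fix x
    have Q0: "0 \<le> (Q *v x) \<bullet> x" using p(2)[of x] p(1) by (meson order_trans mult_nonneg_nonneg less_imp_le zero_le_power2)
    have "(norm x)\<^sup>2 \<le> (1 / p) * ((Q *v x) \<bullet> x)"
      using p by (simp add: pos_le_divide_eq mult.commute)
    also have "\<dots> \<le> q * ((Q *v x) \<bullet> x)"
      using Q0 by (intro mult_right_mono) (auto simp: q_def)
    finally show "(norm x)\<^sup>2 \<le> q * ((Q *v x) \<bullet> x)" .
    have "(Q *v x) \<bullet> x \<le> norm (Q *v x) * norm x" by (rule norm_cauchy_schwarz)
    also have "\<dots> \<le> (k * norm x) * norm x" using k(2)[of x] by (intro mult_right_mono) auto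
    also have "\<dots> = k * (norm x)\<^sup>2" by (simp add: power2_eq_square)
    also have "\<dots> \<le> q * (norm x)\<^sup>2" by (intro mult_right_mono) (auto simp: q_def)
    finally show "(Q *v x) \<bullet> x \<le> q * (norm x)\<^sup>2" .
  qed
qed

lemma Q_form_nonneg: "0 \<le> (Q *v x) \<bullet> x"
proof -
  obtain q where q: "1 \<le> q" "\<And>x. (norm x)\<^sup>2 \<le> q * ((Q *v x) \<bullet> x)" "\<And>x. (Q *v x) \<bullet> x \<le> q * (norm x)\<^sup>2"
    by (rule Q_bounds) (rule that)
  have "0 \<le> q * ((Q *v x) \<bullet> x)" using q(2)[of x] zero_le_power2[of "norm x"] by linarith
  then show ?thesis using q(1) by (simp add: zero_le_mult_iff)
qed

lemma T_zero: "T 0 = 0"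
  by (simp add: T_decomp M_def N_def)

lemma T_continuous: "continuous_on {0..} (\<lambda>t. (T t *v y) \<bullet> y)"
proof -
  have "continuous_on {0..} (\<lambda>t. S - M t ** S ** N t)"
    by (intro continuous_on_diff continuous_on_const continuous_on_vector_derivative[OF conj_deriv])
  then have "continuous_on {0..} T"
    by (rule continuous_on_eq) (simp add: T_decomp)
  then show ?thesis
    by (intro continuous_on_inner continuous_on_const
        bounded_linear.continuous_on[OF bounded_bilinear.bounded_linear_left[OF bounded_bilinear_matrix_vector_mult]])
qed

lemma T_form_increment:
  assumes "0 \<le> s" "s \<le> t" and d: "\<And>r. s < r \<Longrightarrow> r < t \<Longrightarrow> a \<le> (Q *v (N r *v y)) \<bullet> (N r *v y)"
  shows "a * (t - s) \<le> (T t *v y) \<bullet> y - (T s *v y) \<bullet> y"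
proof -
  have "(T s *v y) \<bullet> y - a * s \<le> (T t *v y) \<bullet> y - a * t"
  proof (rule DERIV_nonneg_imp_increasing_open[OF \<open>s \<le> t\<close>])
    fix r assume r: "s < r" "r < t"
    have "((\<lambda>t. (T t *v y) \<bullet> y - a * t) has_real_derivative (Q *v (N r *v y)) \<bullet> (N r *v y) - a) (at r)"
      using r assms by (auto intro!: derivative_eq_intros T_form_deriv)
    then show "\<exists>z. ((\<lambda>t. (T t *v y) \<bullet> y - a * t) has_real_derivative z) (at r) \<and> 0 \<le> z"
      using d[OF r] by force
  next
    show "continuous_on {s..t} (\<lambda>t. (T t *v y) \<bullet> y - a * t)"
      using assms by (intro continuous_intros continuous_on_subset[OF T_continuous]) auto
  qed
  then show ?thesis by (simp add: algebra_simps)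
qed

lemma T_form_increment_upper:
  assumes "0 \<le> s" "s \<le> t" and d: "\<And>r. s < r \<Longrightarrow> r < t \<Longrightarrow> (Q *v (N r *v y)) \<bullet> (N r *v y) \<le> a"
  shows "(T t *v y) \<bullet> y - (T s *v y) \<bullet> y \<le> a * (t - s)"
proof -
  have "a * s - (T s *v y) \<bullet> y \<le> a * t - (T t *v y) \<bullet> y"
  proof (rule DERIV_nonneg_imp_increasing_open[OF \<open>s \<le> t\<close>])
    fix r assume r: "s < r" "r < t"
    have "((\<lambda>t. a * t - (T t *v y) \<bullet> y) has_real_derivative a - (Q *v (N r *v y)) \<bullet> (N r *v y)) (at r)"
      using r assms by (auto intro!: derivative_eq_intros T_form_deriv)
    then show "\<exists>z. ((\<lambda>t. a * t - (T t *v y) \<bullet> y) has_real_derivative z) (at r) \<and> 0 \<le> z"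
      using d[OF r] by force
  next
    show "continuous_on {s..t} (\<lambda>t. a * t - (T t *v y) \<bullet> y)"
      using assms by (intro continuous_intros continuous_on_subset[OF T_continuous]) auto
  qed
  then show ?thesis by (simp add: algebra_simps)
qed

text \<open>Up to time 1 the derivative of the form is comparable with |y|^2, because
  \<open>N r\<close> and its inverse \<open>N (- r)\<close> are bounded there. After time 1
  monotonicity alone preserves the lower bound, whence \<open>min t 1\<close>.\<close>

lemma T_form_bounds:
  obtains l C where "0 < l" "0 < C"
    "\<And>t y. 0 \<le> t \<Longrightarrow> l * min t 1 * (norm y)\<^sup>2 \<le> (T t *v y) \<bullet> y"
    "\<And>t y. 0 \<le> t \<Longrightarrow> t \<le> 1 \<Longrightarrow> (T t *v y) \<bullet> y \<le> C * t * (norm y)\<^sup>2"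
proof -
  obtain q where q: "1 \<le> q" "\<And>x. (norm x)\<^sup>2 \<le> q * ((Q *v x) \<bullet> x)" "\<And>x. (Q *v x) \<bullet> x \<le> q * (norm x)\<^sup>2"
    by (rule Q_bounds) (rule that)
  obtain b where b: "1 \<le> b" "\<And>s x. \<bar>s\<bar> \<le> 1 \<Longrightarrow> norm (N s *v x) \<le> b * norm x"
    by (rule matrix_exp_local_bound[of "transpose B", folded N_def]) (rule that)
  define l where "l = 1 / (q * b\<^sup>2)"
  have l: "0 < l" using q b by (simp add: l_def)
  have lower: "l * (norm y)\<^sup>2 \<le> (Q *v (N r *v y)) \<bullet> (N r *v y)" if "\<bar>r\<bar> \<le> 1" for r y
  proof -
    have "y = N (- r) *v (N r *v y)" by (simp add: matrix_vector_mul_assoc N_minus)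
    then have "norm y \<le> b * norm (N r *v y)" using b(2)[of "- r" "N r *v y"] that by simp
    then have "(norm y)\<^sup>2 \<le> (b * norm (N r *v y))\<^sup>2" by (intro power_mono) auto
    also have "\<dots> = b\<^sup>2 * (norm (N r *v y))\<^sup>2" by (simp add: power_mult_distrib)
    also have "\<dots> \<le> b\<^sup>2 * (q * ((Q *v (N r *v y)) \<bullet> (N r *v y)))"
      by (intro mult_left_mono q) auto
    finally show ?thesis using q b by (simp add: l_def divide_le_eq mult_ac)
  qed
  show ?thesis
  proof
    show "0 < l" by fact
    show "0 < q * b\<^sup>2" using q b by simp
    fix t :: real and y :: "real^'n" assume t: "0 \<le> t"
    have "l * (norm y)\<^sup>2 * (min t 1 - 0) \<le> (T (min t 1) *v y) \<bullet> y - (T 0 *v y) \<bullet> y"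
      using t by (intro T_form_increment lower) auto
    moreover have "0 * (t - min t 1) \<le> (T t *v y) \<bullet> y - (T (min t 1) *v y) \<bullet> y"
      using t by (intro T_form_increment Q_form_nonneg) auto
    ultimately show "l * min t 1 * (norm y)\<^sup>2 \<le> (T t *v y) \<bullet> y"
      by (simp add: T_zero mult_ac)
    assume t1: "t \<le> 1"
    have "(T t *v y) \<bullet> y - (T 0 *v y) \<bullet> y \<le> (q * b\<^sup>2 * (norm y)\<^sup>2) * (t - 0)"
    proof (rule T_form_increment_upper)
      fix r assume r: "0 < r" "r < t"
      have "(Q *v (N r *v y)) \<bullet> (N r *v y) \<le> q * (norm (N r *v y))\<^sup>2" by (rule q)
      also have "\<dots> \<le> q * (b * norm y)\<^sup>2"
        using q b(2)[of r y] r t1 by (intro mult_left_mono power_mono) auto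
      finally show "(Q *v (N r *v y)) \<bullet> (N r *v y) \<le> q * b\<^sup>2 * (norm y)\<^sup>2"
        by (simp add: power_mult_distrib mult_ac)
    qed (use t in auto)
    then show "(T t *v y) \<bullet> y \<le> q * b\<^sup>2 * t * (norm y)\<^sup>2"
      by (simp add: T_zero mult_ac)
  qed
qed

lemma S_form_bound:
  obtains l where "0 < l" "\<And>y. l * (norm y)\<^sup>2 \<le> (S *v y) \<bullet> y"
proof -
  obtain l C where l: "0 < l" "0 < C"
    "\<And>t y. 0 \<le> t \<Longrightarrow> l * min t 1 * (norm y)\<^sup>2 \<le> (T t *v y) \<bullet> y"
    "\<And>t y. 0 \<le> t \<Longrightarrow> t \<le> 1 \<Longrightarrow> (T t *v y) \<bullet> y \<le> C * t * (norm y)\<^sup>2"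
    by (rule T_form_bounds) (rule that)
  have "l * (norm y)\<^sup>2 \<le> (S *v y) \<bullet> y" for y
  proof (rule LIMSEQ_le_const)
    show "(\<lambda>k. (T (real k) *v y) \<bullet> y) \<longlonglongrightarrow> (S *v y) \<bullet> y"
      by (intro tendsto_inner tendsto_const bounded_bilinear.tendsto[OF bounded_bilinear_matrix_vector_mult] T_tendsto_S)
    have "l * (norm y)\<^sup>2 \<le> (T (real k) *v y) \<bullet> y" if "1 \<le> k" for k
      using l(3)[of "real k" y] that by (simp add: min_def split: if_splits)
    then show "\<exists>N. \<forall>k\<ge>N. l * (norm y)\<^sup>2 \<le> (T (real k) *v y) \<bullet> y" by blast
  qed
  with l(1) that show ?thesis by blast
qed

section \<open>Inverse covariances, the flow D and the form R along its orbits\<close>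

lemma S_inverse: "S ** matrix_inv S = mat 1" "matrix_inv S ** S = mat 1"
proof -
  obtain l where l: "0 < l" "\<And>y. l * (norm y)\<^sup>2 \<le> (S *v y) \<bullet> y"
    by (rule S_form_bound) (rule that)
  from matrix_inv_of_lower_bound[OF l(1) norm_lower_bound_of_form[OF l(2)]]
  show "S ** matrix_inv S = mat 1" "matrix_inv S ** S = mat 1" by auto
qed

lemma T_inverse:
  assumes "0 < t"
  shows "T t ** matrix_inv (T t) = mat 1" "matrix_inv (T t) ** T t = mat 1"
proof -
  obtain l C where l: "0 < l" "0 < C"
    "\<And>t y. 0 \<le> t \<Longrightarrow> l * min t 1 * (norm y)\<^sup>2 \<le> (T t *v y) \<bullet> y"
    "\<And>t y. 0 \<le> t \<Longrightarrow> t \<le> 1 \<Longrightarrow> (T t *v y) \<bullet> y \<le> C * t * (norm y)\<^sup>2"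
    by (rule T_form_bounds) (rule that)
  have "0 < l * min t 1" using l assms by simp
  from matrix_inv_of_lower_bound[OF this norm_lower_bound_of_form[OF l(3)]] assms
  show "T t ** matrix_inv (T t) = mat 1" "matrix_inv (T t) ** T t = mat 1" by auto
qed

lemma transpose_S_inv: "transpose (matrix_inv S) = matrix_inv S"
proof -
  have "transpose (matrix_inv S) ** S = mat 1"
    using arg_cong[OF S_inverse(1), of transpose] by (simp add: matrix_transpose_mul transpose_S transpose_mat)
  then show ?thesis
    by (metis S_inverse(1) matrix_mul_assoc matrix_mul_lid matrix_mul_rid)
qed

lemma S_inv_self: "(matrix_inv S *v x) \<bullet> y = x \<bullet> (matrix_inv S *v y)"
  by (simp add: inner_matrix_vector transpose_S_inv)

text \<open>The orbit of \<open>x\<close> under D, seen in the coordinates S^(-1) x. There D acts as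
  the plain exponential \<open>N (- s)\<close>, and R becomes half the form of S, to which the
  Lyapunov equation applies directly.\<close>

definition dual_orbit :: "real^'n \<Rightarrow> real \<Rightarrow> real^'n" where
  "dual_orbit x s = N (- s) *v (matrix_inv S *v x)"

lemma ou_D_eq: "ou_D Q B s *v x = S *v dual_orbit x s"
  by (simp add: ou_D_def dual_orbit_def N_def S_def matrix_vector_mul_assoc matrix_mul_assoc)

lemma S_inv_ou_D: "matrix_inv S *v (ou_D Q B s *v x) = dual_orbit x s"
  by (simp add: ou_D_eq matrix_vector_mul_assoc S_inverse)

lemma ou_D_add: "ou_D Q B s *v (ou_D Q B t *v x) = ou_D Q B (s + t) *v x"
proof -
  have "N (- (s + t)) = N (- s) ** N (- t)"
    using N_add[of "- s" "- t"] by simp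
  then show ?thesis
    unfolding ou_D_eq[of s] ou_D_eq[of "s + t"] dual_orbit_def S_inv_ou_D
    by (simp add: matrix_vector_mul_assoc matrix_mul_assoc)
qed

lemma ou_D_zero: "ou_D Q B 0 *v x = x"
  by (simp add: ou_D_eq dual_orbit_def N_def matrix_vector_mul_assoc S_inverse)

lemma ou_R_eq: "ou_R Q B x = 1 / 2 * ((matrix_inv S *v x) \<bullet> x)"
  by (simp add: ou_R_def S_def)

lemma ou_R_orbit: "ou_R Q B (ou_D Q B s *v x) = 1 / 2 * (dual_orbit x s \<bullet> (S *v dual_orbit x s))"
  by (simp add: ou_R_eq S_inv_ou_D) (simp add: ou_D_eq)

lemma dual_orbit_deriv: "(dual_orbit x has_vector_derivative - (transpose B *v dual_orbit x s)) (at s)"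
proof -
  have "((\<lambda>s. N (- s)) has_vector_derivative - 1 *\<^sub>R (transpose B ** N (- s))) (at s)"
    unfolding N_def by (rule has_vector_derivative_matrix_exp') (auto intro!: derivative_eq_intros)
  from has_vector_derivative_matrix_vector_mult[OF this has_vector_derivative_const, of "matrix_inv S *v x"]
  show ?thesis
    by (simp add: dual_orbit_def[abs_def] matrix_vector_mul_assoc matrix_mul_assoc
        matrix_mult_minus_left matrix_vector_mult_minus_left)
qed

lemma ou_D_deriv: "((\<lambda>s. ou_D Q B s *v x) has_vector_derivative - (S *v (transpose B *v dual_orbit x s))) (at s)"
  unfolding ou_D_eq
  using bounded_linear.has_vector_derivative[OF matrix_vector_mul_bounded_linear[of S] dual_orbit_deriv[of x s]]
  by (simp add: linear_neg[OF matrix_vector_mul_linear])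

text \<open>The Lyapunov equation makes the derivative of \<open>R\<close> along an orbit a positive form.\<close>
lemma ou_R_deriv:
  "((\<lambda>s. ou_R Q B (ou_D Q B s *v x)) has_real_derivative 1 / 2 * ((Q *v dual_orbit x s) \<bullet> dual_orbit x s)) (at s)"
proof -
  let ?z = "dual_orbit x s"
  have "((\<lambda>s. dual_orbit x s \<bullet> (S *v dual_orbit x s)) has_vector_derivative
      ?z \<bullet> (- (S *v (transpose B *v ?z))) + (- (transpose B *v ?z)) \<bullet> (S *v ?z)) (at s)"
    using bounded_bilinear.has_vector_derivative[OF bounded_bilinear_inner dual_orbit_deriv[of x s]
        ou_D_deriv[unfolded ou_D_eq, of x s]] .
  also have "?z \<bullet> (- (S *v (transpose B *v ?z))) + (- (transpose B *v ?z)) \<bullet> (S *v ?z)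
      = - (?z \<bullet> ((S ** transpose B + B ** S) *v ?z))"
    by (simp add: inner_matrix_vector matrix_vector_mult_add_rdistrib inner_add_right matrix_vector_mul_assoc
        del: transpose_matrix_vector)
  also have "S ** transpose B + B ** S = - Q"
    using lyapunov by (simp add: add.commute)
  also have "- (?z \<bullet> (- Q *v ?z)) = (Q *v ?z) \<bullet> ?z"
    by (simp add: inner_commute matrix_vector_mult_minus_left)
  finally have "((\<lambda>s. dual_orbit x s \<bullet> (S *v dual_orbit x s)) has_real_derivative (Q *v ?z) \<bullet> ?z) (at s)"
    by (simp add: has_real_derivative_iff_has_vector_derivative)
  then show ?thesis
    unfolding ou_R_orbit by (rule DERIV_cmult)
qed

lemma ou_R_bounds:
  obtains k where "1 \<le> k" "\<And>x. (norm x)\<^sup>2 \<le> k * ou_R Q B x" "\<And>x. ou_R Q B x \<le> k * (norm x)\<^sup>2"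
    "\<And>x y. ou_R Q B y - ou_R Q B x \<le> k * norm y * norm (y - x)"
proof -
  obtain l where l: "0 < l" "\<And>y. l * (norm y)\<^sup>2 \<le> (S *v y) \<bullet> y" by (rule S_form_bound) (rule that)
  obtain a where a: "0 < a" "\<And>x. norm (S *v x) \<le> a * norm x" by (rule matrix_vector_bound[of S]) (rule that)
  obtain d where d: "0 < d" "\<And>x. norm (matrix_inv S *v x) \<le> d * norm x" by (rule matrix_vector_bound[of "matrix_inv S"]) (rule that)
  have R0: "(norm x)\<^sup>2 \<le> (2 * a\<^sup>2 / l) * ou_R Q B x" for x
  proof -
    let ?z = "matrix_inv S *v x"
    have x: "x = S *v ?z" by (simp add: matrix_vector_mul_assoc S_inverse)
    have "norm x \<le> a * norm ?z" using a(2)[of ?z] x by simp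
    then have "(norm x)\<^sup>2 \<le> (a * norm ?z)\<^sup>2" by (intro power_mono) auto
    also have "\<dots> = (a\<^sup>2 / l) * (l * (norm ?z)\<^sup>2)" using l by (simp add: power_mult_distrib)
    also have "\<dots> \<le> (a\<^sup>2 / l) * ((S *v ?z) \<bullet> ?z)" using l by (intro mult_left_mono) auto
    also have "\<dots> = (2 * a\<^sup>2 / l) * ou_R Q B x" using x by (simp add: ou_R_eq inner_commute)
    finally show ?thesis .
  qed
  have Rnn: "0 \<le> ou_R Q B x" for x
  proof -
    have "0 \<le> (2 * a\<^sup>2 / l) * ou_R Q B x" using R0[of x] zero_le_power2[of "norm x"] by linarith
    then show ?thesis using a l by (simp add: zero_le_mult_iff zero_le_divide_iff)
  qed
  define k where "k = max 1 (max (2 * a\<^sup>2 / l) d)"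
  show ?thesis
  proof
    show "1 \<le> k" by (simp add: k_def)
    fix x y
    show "(norm x)\<^sup>2 \<le> k * ou_R Q B x"
      by (rule order_trans[OF R0]) (intro mult_right_mono Rnn, simp add: k_def)
    have "(matrix_inv S *v x) \<bullet> x \<le> norm (matrix_inv S *v x) * norm x" by (rule norm_cauchy_schwarz)
    also have "\<dots> \<le> (d * norm x) * norm x" using d(2)[of x] by (intro mult_right_mono) auto
    also have "\<dots> = d * (norm x)\<^sup>2" by (simp add: power2_eq_square)
    finally have "ou_R Q B x \<le> d * (norm x)\<^sup>2"
      using zero_le_mult_iff[of d "(norm x)\<^sup>2"] d(1) Rnn[of x] by (simp add: ou_R_eq)
    also have "\<dots> \<le> k * (norm x)\<^sup>2" by (intro mult_right_mono) (auto simp: k_def)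
    finally show "ou_R Q B x \<le> k * (norm x)\<^sup>2" .
    \<comment> \<open>Expansion of R about \<open>y\<close>: the quadratic remainder has a
      favourable sign, so the factor in front of |y - x| is the norm of \<open>y\<close> and not
      that of \<open>x\<close>.\<close>
    have "ou_R Q B y - ou_R Q B x = (matrix_inv S *v y) \<bullet> (y - x) - ou_R Q B (y - x)"
      using S_inv_self[of x y] S_inv_self[of y x]
      by (simp add: ou_R_eq matrix_vector_mult_diff_distrib inner_diff_left inner_diff_right algebra_simps inner_commute)
    also have "\<dots> \<le> (matrix_inv S *v y) \<bullet> (y - x)" using Rnn[of "y - x"] by simp
    also have "\<dots> \<le> norm (matrix_inv S *v y) * norm (y - x)" by (rule norm_cauchy_schwarz)
    also have "\<dots> \<le> (k * norm y) * norm (y - x)"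
    proof (intro mult_right_mono)
      have "norm (matrix_inv S *v y) \<le> d * norm y" by (rule d)
      also have "\<dots> \<le> k * norm y" by (intro mult_right_mono) (auto simp: k_def)
      finally show "norm (matrix_inv S *v y) \<le> k * norm y" .
    qed simp
    finally show "ou_R Q B y - ou_R Q B x \<le> k * norm y * norm (y - x)" .
  qed
qed

end

section \<open>The maximal operator of an expanding flow\<close>

text \<open>Zorn's lemma replaces the greedy choice, as \<open>I\<close> may be uncountable. The
  invariant of \<open>good\<close> is that an index meeting the chosen family meets a member ranked
  at most 1 above it. The slack 1 is there because infima of \<open>h\<close> need not be
  attained.\<close>

lemma vitali_selection:
  fixes h :: "'i \<Rightarrow> real" and F :: "'i \<Rightarrow> 'b set"
  assumes h: "\<And>i. i \<in> I \<Longrightarrow> b \<le> h i" and ne: "\<And>i. i \<in> I \<Longrightarrow> F i \<noteq> {}"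
  obtains J where "J \<subseteq> I" "disjoint_family_on F J"
    "\<And>i. i \<in> I \<Longrightarrow> \<exists>j\<in>J. h j \<le> h i + 1 \<and> F i \<inter> F j \<noteq> {}"
proof -
  define good where "good J \<longleftrightarrow> J \<subseteq> I \<and> disjoint_family_on F J \<and>
    (\<forall>i\<in>I. (\<exists>j\<in>J. F i \<inter> F j \<noteq> {}) \<longrightarrow> (\<exists>j\<in>J. h j \<le> h i + 1 \<and> F i \<inter> F j \<noteq> {}))" for J
  have "\<exists>M\<in>Collect good. \<forall>X\<in>Collect good. M \<subseteq> X \<longrightarrow> X = M"
  proof (rule subset_Zorn_nonempty)
    have "good {}" by (auto simp: good_def disjoint_family_on_def)
    then show "Collect good \<noteq> {}" by blast
    fix \<C> assume "\<C> \<noteq> {}" and ch: "subset.chain (Collect good) \<C>"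
    have g: "\<And>J. J \<in> \<C> \<Longrightarrow> good J" and
      tot: "\<And>X Y. X \<in> \<C> \<Longrightarrow> Y \<in> \<C> \<Longrightarrow> X \<subseteq> Y \<or> Y \<subseteq> X"
      using ch unfolding subset_chain_def by auto
    have "disjoint_family_on F (\<Union>\<C>)"
      unfolding disjoint_family_on_def
    proof (intro ballI impI)
      fix m n assume "m \<in> \<Union>\<C>" "n \<in> \<Union>\<C>" "m \<noteq> n"
      then obtain X where "X \<in> \<C>" "m \<in> X" "n \<in> X"
        using tot by blast
      with g[of X] \<open>m \<noteq> n\<close> show "F m \<inter> F n = {}"
        unfolding good_def disjoint_family_on_def by blast
    qed
    moreover have "\<exists>j\<in>\<Union>\<C>. h j \<le> h i + 1 \<and> F i \<inter> F j \<noteq> {}"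
      if i: "i \<in> I" "j \<in> \<Union>\<C>" "F i \<inter> F j \<noteq> {}" for i j
    proof -
      obtain X where X: "X \<in> \<C>" "j \<in> X" using i by blast
      with g[OF X(1)] i obtain j' where "j' \<in> X" "h j' \<le> h i + 1 \<and> F i \<inter> F j' \<noteq> {}"
        unfolding good_def by blast
      with X show ?thesis by blast
    qed
    ultimately show "\<Union>\<C> \<in> Collect good"
      using g unfolding good_def by blast
  qed
  then obtain J where J: "good J" and max: "\<And>X. good X \<Longrightarrow> J \<subseteq> X \<Longrightarrow> X = J"
    by auto
  have "\<exists>j\<in>J. F i \<inter> F j \<noteq> {}" if "i \<in> I" for i
  proof (rule ccontr)
    assume i: "\<not> ?thesis"
    define N where "N = {i \<in> I. \<forall>j\<in>J. F i \<inter> F j = {}}"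
    have N: "N \<noteq> {}" using i that by (auto simp: N_def)
    have bdd: "bdd_below (h ` N)" using h by (auto simp: N_def intro!: bdd_belowI2)
    \<comment> \<open>A near-minimiser among the indices that miss \<open>J\<close> can be added
      without breaking the invariant, which contradicts maximality.\<close>
    have "\<exists>y\<in>h ` N. y < Inf (h ` N) + 1"
      by (subst cInf_less_iff[symmetric]) (use N bdd in auto)
    then obtain j where j: "j \<in> N" "h j < Inf (h ` N) + 1" by auto
    have hj: "h j \<le> h i + 1" if "i \<in> N" for i
      using j(2) cInf_lower[OF imageI[OF that] bdd] by simp
    have "j \<notin> J"
      using j(1) ne[of j] by (auto simp: N_def)
    have "good (insert j J)"
      unfolding good_def
    proof (intro conjI ballI impI)
      show "insert j J \<subseteq> I" using j J by (auto simp: N_def good_def)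
      show "disjoint_family_on F (insert j J)"
        using J j \<open>j \<notin> J\<close> by (auto simp: disjoint_family_on_insert good_def N_def)
      fix i assume i: "i \<in> I" "\<exists>j\<in>insert j J. F i \<inter> F j \<noteq> {}"
      show "\<exists>j\<in>insert j J. h j \<le> h i + 1 \<and> F i \<inter> F j \<noteq> {}"
      proof (cases "i \<in> N")
        case True
        with hj i show ?thesis by (auto simp: N_def)
      next
        case False
        with i(1) have "\<exists>j\<in>J. F i \<inter> F j \<noteq> {}" by (auto simp: N_def)
        with J i(1) show ?thesis unfolding good_def by blast
      qed
    qed
    with max[of "insert j J"] \<open>j \<notin> J\<close> show False by blast
  qed
  with J show ?thesis
    using that[of J] unfolding good_def by blast
qed

text \<open>\<open>M\<close> weighs the disjoint sets, \<open>N\<close> the sets attached to them.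
  Only the \<open>F j\<close> are disjoint, while the \<open>Z j\<close> may overlap freely; the
  assumed comparison between the two measures takes the place of a doubling property.\<close>

lemma vitali_weak_type:
  fixes h :: "'i \<Rightarrow> real" and F :: "'i \<Rightarrow> 'b set" and Z :: "'i \<Rightarrow> 'a set"
  assumes "finite_measure M"
    and h: "\<And>i. i \<in> I \<Longrightarrow> b \<le> h i"
    and F: "\<And>i. i \<in> I \<Longrightarrow> F i \<in> sets M" "\<And>i. i \<in> I \<Longrightarrow> 0 < measure M (F i)"
    and Z: "\<And>i. i \<in> I \<Longrightarrow> Z i \<in> sets N" "\<And>i. i \<in> I \<Longrightarrow> emeasure N (Z i) \<le> c * emeasure M (F i)"
    and cover: "\<And>i j. i \<in> I \<Longrightarrow> j \<in> I \<Longrightarrow> h j \<le> h i + 1 \<Longrightarrow> F i \<inter> F j \<noteq> {} \<Longrightarrow> p i \<in> Z j"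
  obtains W where "W \<in> sets N" "p ` I \<subseteq> W" "emeasure N W \<le> c * emeasure M (space M)"
proof -
  interpret finite_measure M by fact
  obtain J where J: "J \<subseteq> I" "disjoint_family_on F J"
    "\<And>i. i \<in> I \<Longrightarrow> \<exists>j\<in>J. h j \<le> h i + 1 \<and> F i \<inter> F j \<noteq> {}"
  proof (rule vitali_selection[of I b h F, OF h])
    show "F i \<noteq> {}" if "i \<in> I" for i
      using F(2)[OF that] by auto
  qed blast+
  \<comment> \<open>Disjoint sets of positive mass in a finite measure space are countably many, so
    the selected family is countable although \<open>I\<close> may not be.\<close>
  have "(\<lambda>j. measure M (F j)) summable_on J"
  proof (rule nonneg_bdd_above_summable_on)
    have "sum (\<lambda>j. measure M (F j)) S \<le> measure M (space M)" if "S \<subseteq> J" "finite S" for S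
    proof -
      have "disjoint_family_on F S"
        using J(2) that(1) by (rule disjoint_family_on_mono[rotated])
      moreover have "F ` S \<subseteq> sets M" using that J F by auto
      ultimately have "sum (\<lambda>j. measure M (F j)) S = measure M (\<Union>j\<in>S. F j)"
        using that(2) by (intro finite_measure_finite_Union[symmetric]) auto
      also have "\<dots> \<le> measure M (space M)" by (rule bounded_measure)
      finally show ?thesis .
    qed
    then show "bdd_above (sum (\<lambda>j. measure M (F j)) ` {S. S \<subseteq> J \<and> finite S})"
      by (auto intro!: bdd_aboveI2)
  qed simp
  then have "countable {j \<in> J. measure M (F j) \<noteq> 0}"
    by (rule summable_countable_real)
  moreover have "{j \<in> J. measure M (F j) \<noteq> 0} = J"
    using J F(2) by force
  ultimately have cJ: "countable J" by simp
  define e where "e = to_nat_on J"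
  have e: "inj_on e J" using inj_on_to_nat_on[OF cJ] by (simp add: e_def)
  \<comment> \<open>Reindexing by the naturals for countable additivity. A number that codes no
    index gets the empty set, for which the comparison is trivial.\<close>
  define Z' where "Z' n = (\<Union>j\<in>{j\<in>J. e j = n}. Z j)" for n
  define F' where "F' n = (\<Union>j\<in>{j\<in>J. e j = n}. F j)" for n
  have sub: "{j\<in>J. e j = n} = {} \<or> (\<exists>j\<in>J. {j\<in>J. e j = n} = {j})" for n
  proof (rule disjCI)
    assume "\<not> (\<exists>j\<in>J. {j\<in>J. e j = n} = {j})"
    then show "{j\<in>J. e j = n} = {}"
      using e unfolding inj_on_def by blast
  qed
  have *: "Z' n \<in> sets N \<and> F' n \<in> sets M \<and> emeasure N (Z' n) \<le> c * emeasure M (F' n)" for n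
    using sub[of n]
  proof (elim disjE bexE)
    assume "{j\<in>J. e j = n} = {}"
    then show ?thesis unfolding Z'_def F'_def by (simp only: Union_empty image_empty) simp
  next
    fix j assume "j \<in> J" and n: "{j\<in>J. e j = n} = {j}"
    then have "j \<in> I" using J(1) by blast
    then show ?thesis unfolding Z'_def F'_def n using Z F by simp
  qed
  then have Z': "Z' n \<in> sets N" and F': "F' n \<in> sets M"
    and le: "emeasure N (Z' n) \<le> c * emeasure M (F' n)" for n
    by blast+
  have dis: "disjoint_family F'"
    unfolding disjoint_family_on_def
  proof (intro ballI impI)
    fix m n :: nat assume mn: "m \<noteq> n"
    have "x \<notin> F' n" if x: "x \<in> F' m" for x
    proof
      assume "x \<in> F' n"
      with x obtain i j where ij: "i \<in> J" "e i = m" "x \<in> F i" "j \<in> J" "e j = n" "x \<in> F j"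
        unfolding F'_def by auto
      with mn have "i \<noteq> j" by auto
      with ij J(2) have "F i \<inter> F j = {}" by (metis disjoint_family_onD)
      with ij show False by auto
    qed
    then show "F' m \<inter> F' n = {}" by auto
  qed
  have "emeasure N (\<Union>n. Z' n) \<le> (\<Sum>n. emeasure N (Z' n))"
    using Z' by (intro emeasure_subadditive_countably) auto
  also have "\<dots> \<le> (\<Sum>n. c * emeasure M (F' n))"
    using le by (intro suminf_le) auto
  also have "\<dots> = c * emeasure M (\<Union>n. F' n)"
    using F' dis by (subst suminf_emeasure[symmetric]) (auto intro: ennreal_suminf_cmult)
  also have "\<dots> \<le> c * emeasure M (space M)"
    using F' by (intro mult_left_mono emeasure_mono) (auto dest: sets.sets_into_space)
  finally have "emeasure N (\<Union>n. Z' n) \<le> c * emeasure M (space M)" .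
  moreover have "p ` I \<subseteq> (\<Union>n. Z' n)"
  proof safe
    fix i assume "i \<in> I"
    then obtain j where "j \<in> J" "h j \<le> h i + 1" "F i \<inter> F j \<noteq> {}" using J(3) by blast
    with cover[OF \<open>i \<in> I\<close>] J(1) have "p i \<in> Z j" by blast
    with \<open>j \<in> J\<close> show "p i \<in> (\<Union>n. Z' n)" unfolding Z'_def by auto
  qed
  ultimately show ?thesis
    using that[of "\<Union>n. Z' n"] Z' by blast
qed

lemma power_le_fact_exp:
  assumes "0 \<le> (x::real)"
  shows "x ^ n \<le> fact n * exp x"
proof -
  have "x ^ n / fact n \<le> exp x"
  proof -
    have "(\<Sum>k\<in>{n}. x ^ k /\<^sub>R fact k) \<le> (\<Sum>k. x ^ k /\<^sub>R fact k)"
      by (rule sum_le_suminf[OF summable_exp_generic]) (use assms in auto)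
    then show ?thesis by (simp add: exp_def divide_inverse mult.commute)
  qed
  then show ?thesis by (simp add: field_simps)
qed

lemma summable_power_exp: "summable (\<lambda>k::nat. exp (- real k) * real (k + 1) ^ n)"
proof (rule summable_comparison_test, intro exI allI impI)
  fix k :: nat
  \<comment> \<open>Half of the exponent pays for the power; the other half leaves a geometric
    series.\<close>
  have "(real (k + 1) / 2) ^ n \<le> fact n * exp (real (k + 1) / 2)"
    by (rule power_le_fact_exp) simp
  then have "real (k + 1) ^ n \<le> 2 ^ n * (fact n * exp (real (k + 1) / 2))"
    by (simp add: power_divide divide_le_eq mult.commute)
  then have "exp (- real k) * real (k + 1) ^ n \<le> exp (- real k) * (2 ^ n * (fact n * exp (real (k + 1) / 2)))"
    by (rule mult_left_mono) simp
  also have "\<dots> = 2 ^ n * fact n * exp (1 / 2) * exp (- 1 / 2) ^ k"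
  proof -
    have "exp (- 1 / 2) ^ k = exp (- (real k / 2))"
      by (simp add: exp_of_nat_mult[symmetric])
    moreover have "exp (- real k) * exp (real (k + 1) / 2) = exp (1 / 2) * exp (- (real k / 2))"
      unfolding mult_exp_exp by (simp add: field_simps)
    ultimately show ?thesis by simp
  qed
  finally show "norm (exp (- real k) * real (k + 1) ^ n)
      \<le> 2 ^ n * fact n * exp (1 / 2) * exp (- 1 / 2) ^ k"
    by simp
next
  show "summable (\<lambda>k. 2 ^ n * fact n * exp (1 / 2 :: real) * exp (- 1 / 2) ^ k)"
    by (intro summable_mult summable_geometric) simp
qed

text \<open>What the covering argument uses of R and D, freed from matrices.
  \<open>D_displacement\<close> charges a move along an orbit to the rise of R,
  \<open>D_growth\<close> charges the elapsed time to it, and \<open>D_near\<close> limits the speed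
  for short times. The first two are stated for forward time, in which R increases. A single
  \<open>K\<close> keeps track of all constants.\<close>

locale expanding_flow =
  fixes R :: "'a::euclidean_space \<Rightarrow> real" and D :: "real \<Rightarrow> 'a \<Rightarrow> 'a" and K :: real
  assumes K: "1 \<le> K"
    and R_continuous: "continuous_on UNIV R"
    and R_lower: "norm x ^ 2 \<le> K * R x"
    and R_upper: "R x \<le> K * norm x ^ 2"
    and R_diff: "R y - R x \<le> K * norm y * norm (y - x)"
    and D_continuous: "continuous_on UNIV (D t)"
    and D_add: "D s (D t x) = D (s + t) x"
    and D_zero: "D 0 x = x"
    and D_displacement: "0 \<le> s \<Longrightarrow> norm (D s x - x) * norm x \<le> K * (R (D s x) - R x)"
    and D_growth: "0 \<le> s \<Longrightarrow> s * norm x ^ 2 \<le> K * (R (D s x) - R x)"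
    and D_near: "0 \<le> s \<Longrightarrow> s \<le> 1 \<Longrightarrow> norm (D s x - x) \<le> K * s * norm x"
begin

section \<open>Geometry of intersecting tubes\<close>

lemma R_nonneg: "0 \<le> R x"
  using R_lower[of x] K mult_pos_neg[of K "R x"] zero_le_power2[of "norm x"] by (cases "R x < 0") auto

definition scale :: "real \<Rightarrow> real" where
  "scale t = sqrt (min t 1)"

lemma scale_pos: "0 < t \<Longrightarrow> 0 < scale t"
  and scale_le_1: "scale t \<le> 1"
  and scale_mono: "s \<le> t \<Longrightarrow> scale s \<le> scale t"
  by (auto simp: scale_def)

definition tube :: "real \<Rightarrow> real \<Rightarrow> 'a \<Rightarrow> 'a set" where
  "tube A t x = {u. norm (D (- t) u - x) < A * scale t}"

text \<open>Membership of \<open>y\<close> says that the density exp(-R y) is at most exp(L - R x)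
  exp(-|y - x| / (r P)), which is integrable in \<open>y\<close>. One shape serves both
  selections.\<close>

definition zone :: "real \<Rightarrow> real \<Rightarrow> real \<Rightarrow> 'a \<Rightarrow> 'a set" where
  "zone P L r x = {y. norm (y - x) / r \<le> P * (R y - R x + L)}"

text \<open>Over such a short time the flow displaces points of the ball by order A sqrt t, so the
  tube lies in a ball of radius 3 K A sqrt t about \<open>x\<close>. The ranking hypothesis means t
  \<le> e t1, hence sqrt t \<le> 2 sqrt t1, and 3 times 2 plus 3 gives the 9. The drop of R is
  bounded because sqrt t1 |x1| \<le> 1.\<close>

lemma near_tubes:
  assumes A: "1 \<le> A" and t: "0 < t" "t \<le> 1 / (1 + norm x)\<^sup>2" and t1: "0 < t1" "t1 \<le> 1 / (1 + norm x1)\<^sup>2"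
    and le: "- ln t1 \<le> - ln t + 1" and meet: "tube A t x \<inter> tube A t1 x1 \<noteq> {}"
  shows "norm (x - x1) \<le> 9 * K * A * scale t1" "R x1 - R x \<le> 9 * K ^ 2 * A"
proof -
  have tube: "norm (u - x) \<le> 3 * K * A * sqrt t" "scale t = sqrt t" "sqrt t * norm x \<le> 1"
    if u: "u \<in> tube A t x" and t: "0 < t" "t \<le> 1 / (1 + norm x)\<^sup>2" for t x u
  proof -
    have "1 / (1 + norm x)\<^sup>2 \<le> 1" by (simp add: divide_le_eq_1)
    then have t': "t \<le> 1" using t by simp
    then show sc: "scale t = sqrt t" by (simp add: scale_def)
    have q: "sqrt t \<le> 1 / (1 + norm x)"
      using real_sqrt_le_mono[OF t(2)] by (simp add: real_sqrt_divide)
    have "sqrt t * norm x \<le> sqrt t * (1 + norm x)"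
      using t by (intro mult_left_mono) auto
    also have "\<dots> \<le> 1 / (1 + norm x) * (1 + norm x)"
      using q by (intro mult_right_mono) auto
    also have "\<dots> = 1" using norm_ge_zero[of x] by (simp add: add_nonneg_eq_0_iff)
    finally show qx: "sqrt t * norm x \<le> 1" .
    define v where "v = D (- t) u"
    have v: "norm (v - x) \<le> A * sqrt t" using u sc by (simp add: tube_def v_def)
    have u: "u = D t v" by (simp add: v_def D_add D_zero)
    have "norm (u - x) \<le> norm (D t v - v) + norm (v - x)"
      using norm_triangle_ineq[of "D t v - v" "v - x"] by (simp add: u)
    also have "\<dots> \<le> K * t * norm v + A * sqrt t"
      using D_near[of t v] t t' v by simp
    also have "K * t * norm v \<le> K * t * (norm x + A * sqrt t)"
      using v norm_triangle_ineq[of "v - x" x] t K by (intro mult_left_mono) auto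
    also have "\<dots> = K * (sqrt t * (sqrt t * norm x) + t * (A * sqrt t))"
      using t by (simp add: algebra_simps)
    also have "\<dots> \<le> K * (sqrt t * 1 + 1 * (A * sqrt t))"
      using K t t' A qx by (intro mult_left_mono add_mono mult_right_mono) auto
    finally have "norm (u - x) \<le> K * sqrt t + K * (A * sqrt t) + A * sqrt t"
      by (simp add: algebra_simps)
    moreover have "K * sqrt t \<le> K * A * sqrt t" "A * sqrt t \<le> K * A * sqrt t"
      using A K t by (auto simp: mult_right_mono)
    ultimately show "norm (u - x) \<le> 3 * K * A * sqrt t" by (simp add: algebra_simps)
  qed
  obtain u where u: "u \<in> tube A t x" "u \<in> tube A t1 x1" using meet by blast
  note T = tube[OF u(1) t] and T1 = tube[OF u(2) t1]
  have "ln t \<le> ln (exp 1 * t1)" using le t1 by (simp add: ln_mult)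
  then have "t \<le> exp 1 * t1" using t t1 by simp
  also have "\<dots> \<le> 4 * t1"
    using t1 exp_le by (intro mult_right_mono) auto
  finally have "sqrt t \<le> sqrt (4 * t1)" by (rule real_sqrt_le_mono)
  then have tt: "sqrt t \<le> 2 * sqrt t1" by (simp add: real_sqrt_mult)
  have "norm (x - x1) \<le> norm (u - x) + norm (u - x1)"
    by norm
  also have "\<dots> \<le> 3 * K * A * (2 * sqrt t1) + 3 * K * A * sqrt t1"
  proof (rule add_mono[OF order_trans[OF T(1)] T1(1)])
    show "3 * K * A * sqrt t \<le> 3 * K * A * (2 * sqrt t1)"
      using K A by (intro mult_left_mono[OF tt]) auto
  qed
  finally show d: "norm (x - x1) \<le> 9 * K * A * scale t1" by (simp add: T1(2) algebra_simps)
  have "R x1 - R x \<le> K * norm x1 * norm (x - x1)"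
    using R_diff[of x1 x] by (simp add: norm_minus_commute)
  also have "\<dots> \<le> K * norm x1 * (9 * K * A * sqrt t1)"
    using d K by (intro mult_left_mono) (auto simp: T1(2))
  also have "\<dots> = 9 * K ^ 2 * A * (sqrt t1 * norm x1)"
    by (simp add: power2_eq_square)
  also have "\<dots> \<le> 9 * K ^ 2 * A * 1"
    using K A T1(3) by (intro mult_left_mono) auto
  finally show "R x1 - R x \<le> 9 * K ^ 2 * A" by simp
qed

text \<open>The centres are close to \<open>v\<close> and \<open>v1\<close>, which lie on the orbit
  of one common point \<open>u\<close>. So only the shift \<delta> between these two has to be
  bounded, and there the monotonicity of R along the orbit can be used.\<close>

lemma far_tubes:
  assumes A: "1 \<le> A" and t: "0 < t" and t1: "0 < t1" "1 / (1 + norm x1)\<^sup>2 \<le> t1"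
    and le: "R x1 \<le> R x + 1" and meet: "tube A t x \<inter> tube A t1 x1 \<noteq> {}"
  shows "norm (x - x1) \<le> 16800 * K ^ 9 * A\<^sup>2 * (R x - R x1 + 2) * scale t1"
proof -
  define \<rho> where "\<rho> = norm x1"
  define k where "k = R x - R x1 + 1"
  define q where "q = scale t"
  define q1 where "q1 = scale t1"
  obtain u where u: "u \<in> tube A t x" "u \<in> tube A t1 x1" using meet by blast
  define v where "v = D (- t) u"
  define v1 where "v1 = D (- t1) u"
  have k: "0 \<le> k" using le by (simp add: k_def)
  have q: "0 < q" "q \<le> 1" and q1: "0 < q1" "q1 \<le> 1"
    using scale_pos t t1(1) scale_le_1 by (auto simp: q_def q1_def)
  have vx: "norm (v - x) \<le> A * q" and v1x: "norm (v1 - x1) \<le> A * q1"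
    using u by (auto simp: tube_def v_def v1_def q_def q1_def)
  have Aq: "A * q \<le> A" "A * q1 \<le> A"
    using A q q1 by (auto simp: mult_left_le)
  have Kp: "K ^ i \<le> K ^ j" if "i \<le> j" for i j
    using K that by (rule power_increasing[rotated])
  have Kp1: "1 \<le> K ^ i" for i
    using K by (rule one_le_power)
  have \<rho>0: "0 \<le> \<rho>" by (simp add: \<rho>_def)
  \<comment> \<open>The far condition on t1. It lets additive constants be absorbed into multiples
    of q1 times \<rho>, once \<rho> is at least 1.\<close>
  have one: "1 \<le> q1 * (1 + \<rho>)"
  proof -
    have "1 / (1 + \<rho>)\<^sup>2 \<le> 1" by (simp add: divide_le_eq_1 \<rho>_def)
    then have "1 / (1 + \<rho>)\<^sup>2 \<le> min t1 1" using t1 by (simp add: \<rho>_def)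
    then have "sqrt (1 / (1 + \<rho>)\<^sup>2) \<le> q1"
      unfolding q1_def scale_def by (rule real_sqrt_le_mono)
    then have "1 / (1 + \<rho>) \<le> q1" using \<rho>0 by (simp add: real_sqrt_divide)
    then show ?thesis using \<rho>0 by (simp add: divide_le_eq)
  qed
  have goal: ?thesis
    if c: "norm (x - x1) \<le> c * A\<^sup>2 * (1 + k) * q1" "c \<le> 16800 * K ^ 9" for c
  proof -
    have "c * A\<^sup>2 * (1 + k) * q1 \<le> 16800 * K ^ 9 * A\<^sup>2 * (1 + k) * q1"
      using c(2) k q1 by (intro mult_right_mono) auto
    with c(1) show ?thesis by (simp add: k_def q1_def add.commute)
  qed
  show ?thesis
  proof (cases "\<rho> \<le> 4 * K\<^sup>2 * A")
    case True
    \<comment> \<open>here \<open>q1\<close> is bounded below in terms of \<open>A\<close>, and \<open>\<bar>x\<bar>\<close> is controlled by \<open>R x\<close>\<close>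
    have "(norm x)\<^sup>2 \<le> K * R x" by (rule R_lower)
    also have "\<dots> \<le> K * (K * \<rho>\<^sup>2 + k)"
      using R_upper[of x1] K by (intro mult_left_mono) (auto simp: k_def \<rho>_def)
    also have "\<dots> \<le> (K * \<rho> + K * (1 + k))\<^sup>2"
    proof -
      have "K * k \<le> K\<^sup>2 * (1 + k)\<^sup>2"
      proof (rule mult_mono)
        show "K \<le> K\<^sup>2" using Kp[of 1 2] by simp
        show "k \<le> (1 + k)\<^sup>2" using k by (simp add: power2_eq_square algebra_simps)
      qed (use k in auto)
      moreover have "0 \<le> (K * \<rho>) * (K * (1 + k))"
        using K \<rho>0 k by simp
      ultimately show ?thesis
        by (simp add: power2_eq_square algebra_simps)
    qed
    finally have "norm x \<le> K * \<rho> + K * (1 + k)"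
      by (rule power2_le_imp_le) (use K k \<rho>0 in auto)
    then have "norm (x - x1) \<le> K * \<rho> + K * (1 + k) + \<rho>"
      using norm_triangle_ineq4[of x x1] by (simp add: \<rho>_def)
    moreover have "1 * \<rho> \<le> K * \<rho>" using K \<rho>0 by (intro mult_right_mono)
    moreover have "(2 * K) * \<rho> \<le> 2 * K * (4 * K\<^sup>2 * A)"
      using K by (intro mult_left_mono[OF True]) auto
    ultimately have "norm (x - x1) \<le> 2 * K * (4 * K\<^sup>2 * A) + K * (1 + k)"
      by linarith
    also have "\<dots> \<le> 8 * K ^ 3 * A * (1 + k) + K ^ 3 * A * (1 + k)"
    proof (rule add_mono)
      have "8 * K ^ 3 * A * 1 \<le> 8 * K ^ 3 * A * (1 + k)"
        using K A k by (intro mult_left_mono) auto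
      then show "2 * K * (4 * K\<^sup>2 * A) \<le> 8 * K ^ 3 * A * (1 + k)"
        by (simp add: power2_eq_square power3_eq_cube)
      have "K * 1 \<le> K ^ 3 * A"
        using Kp[of 1 3] A K by (intro mult_mono) auto
      then show "K * (1 + k) \<le> K ^ 3 * A * (1 + k)"
        using k by (intro mult_right_mono) auto
    qed
    finally have 1: "norm (x - x1) \<le> 9 * K ^ 3 * A * (1 + k)" by (simp add: algebra_simps)
    have "1 \<le> K\<^sup>2 * A" using Kp1[of 2] A mult_mono[of 1 "K\<^sup>2" 1 A] by simp
    with True have "1 + \<rho> \<le> 5 * (K\<^sup>2 * A)" by simp
    then have 2: "1 \<le> q1 * (5 * (K\<^sup>2 * A))"
      using q1 by (intro order_trans[OF one] mult_left_mono) auto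
    have "norm (x - x1) \<le> (9 * K ^ 3 * A * (1 + k)) * (q1 * (5 * (K\<^sup>2 * A)))"
    proof -
      have "(9 * K ^ 3 * A * (1 + k)) * 1 \<le> (9 * K ^ 3 * A * (1 + k)) * (q1 * (5 * (K\<^sup>2 * A)))"
        using K A k by (intro mult_left_mono[OF 2]) auto
      with 1 show ?thesis by linarith
    qed
    also have "\<dots> = 45 * K ^ 5 * A\<^sup>2 * (1 + k) * q1"
      by (simp add: power2_eq_square eval_nat_numeral)
    finally show ?thesis
      by (rule goal) (use Kp[of 5 9] Kp1[of 9] in simp)
  next
    case False
    \<comment> \<open>The threshold makes |v1| comparable with \<rho>, since A q1 \<le> \<rho> / 4,
      and lets the term K^2 A q1 \<delta> below be absorbed on the left as \<delta> \<rho> /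
      4.\<close>
    then have big: "4 * (K\<^sup>2 * A) < \<rho>" by simp
    have "K * A \<le> K\<^sup>2 * A" and "1 * A \<le> K\<^sup>2 * A" and "K\<^sup>2 * 1 \<le> K\<^sup>2 * A"
      using Kp[of 1 2] Kp1[of 2] A mult_left_mono[of 1 A "K\<^sup>2"] by (auto intro: mult_right_mono)
    then have KA: "4 * (K * A) < \<rho>" "4 * A < \<rho>" "4 * K\<^sup>2 < \<rho>" using big by auto
    have \<rho>1: "1 \<le> \<rho>" using KA A by simp
    have two: "1 \<le> 2 * q1 * \<rho>"
    proof -
      have "q1 * (1 + \<rho>) \<le> q1 * (2 * \<rho>)" using q1 \<rho>1 by (intro mult_left_mono) auto
      with one show ?thesis by (simp add: mult_ac)
    qed
    have v1l: "\<rho> / 2 \<le> norm v1" and v1u: "norm v1 \<le> 2 * \<rho>"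
      using v1x Aq KA norm_triangle_ineq2[of x1 v1] norm_triangle_ineq2[of v1 x1]
      by (auto simp: \<rho>_def norm_minus_commute)
    define \<delta> where "\<delta> = norm (v - v1)"
    have \<delta>0: "0 \<le> \<delta>" by (simp add: \<delta>_def)
    have xx1: "norm (x - x1) \<le> A * q + \<delta> + A * q1"
      using vx v1x norm_triangle_ineq[of "x - v" "v - x1"] norm_triangle_ineq[of "v - v1" "v1 - x1"]
      by (simp add: \<delta>_def norm_minus_commute)
    show ?thesis
    proof (cases "t \<le> t1")
      case True
      have qq: "q \<le> q1" using True by (simp add: q_def q1_def scale_mono)
      \<comment> \<open>Now \<open>v\<close> lies ahead of \<open>v1\<close>. The rise of R between
        them is at most \<open>k\<close> plus the errors made in passing from \<open>x\<close> to
        \<open>v\<close> and from \<open>x1\<close> to \<open>v1\<close>.\<close>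
      have "v = D (t1 - t) v1" by (simp add: v_def v1_def D_add)
      then have d: "\<delta> * norm v1 \<le> K * (R v - R v1)"
        using D_displacement[of "t1 - t" v1] True by (simp add: \<delta>_def)
      have nv: "norm v \<le> \<delta> + 2 * \<rho>"
        using v1u norm_triangle_ineq[of "v - v1" v1] by (simp add: \<delta>_def)
      have "R v - R x \<le> K * norm v * norm (v - x)" by (rule R_diff)
      also have "\<dots> \<le> K * (\<delta> + 2 * \<rho>) * (A * q1)"
        using nv K A \<rho>0 \<delta>0 by (intro mult_mono order_trans[OF vx] mult_left_mono[OF qq]) auto
      finally have a1: "R v - R x \<le> K * (\<delta> + 2 * \<rho>) * (A * q1)" .
      have "R x1 - R v1 \<le> K * norm x1 * norm (x1 - v1)" by (rule R_diff)
      also have "\<dots> \<le> K * \<rho> * (A * q1)"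
        using v1x K \<rho>0 by (intro mult_mono) (auto simp: \<rho>_def norm_minus_commute)
      finally have a2: "R x1 - R v1 \<le> K * \<rho> * (A * q1)" .
      have "\<delta> * (\<rho> / 2) \<le> \<delta> * norm v1" using v1l \<delta>0 by (rule mult_left_mono)
      also note d
      also have "K * (R v - R v1) \<le> K * (k + K * (\<delta> + 3 * \<rho>) * (A * q1))"
        using a1 a2 K by (intro mult_left_mono) (auto simp: k_def algebra_simps)
      also have "\<dots> = K * k + (K\<^sup>2 * A * q1) * \<delta> + 3 * K\<^sup>2 * A * q1 * \<rho>"
        by (simp add: algebra_simps power2_eq_square)
      also have "(K\<^sup>2 * A * q1) * \<delta> \<le> (\<rho> / 4) * \<delta>"
      proof (intro mult_right_mono)
        have "K\<^sup>2 * A * q1 \<le> K\<^sup>2 * A * 1" using q1 A by (intro mult_left_mono) auto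
        then show "K\<^sup>2 * A * q1 \<le> \<rho> / 4" using big by simp
      qed (rule \<delta>0)
      finally have "\<delta> * \<rho> \<le> 4 * K * k * 1 + 12 * K\<^sup>2 * A * q1 * \<rho>" by (simp add: algebra_simps)
      also have "4 * K * k * 1 \<le> 4 * K * k * (2 * q1 * \<rho>)"
        using two K k by (intro mult_left_mono) auto
      finally have "\<delta> * \<rho> \<le> ((8 * K * k + 12 * K\<^sup>2 * A) * q1) * \<rho>"
        by (simp add: algebra_simps)
      then have \<delta>: "\<delta> \<le> (8 * K * k + 12 * K\<^sup>2 * A) * q1"
        using \<rho>1 by (simp add: mult_right_le_imp_le)
      have "norm (x - x1) \<le> A * q1 + (8 * K * k + 12 * K\<^sup>2 * A) * q1 + A * q1"
      proof -
        have "A * q \<le> A * q1" using A by (intro mult_left_mono[OF qq]) auto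
        with xx1 \<delta> show ?thesis by linarith
      qed
      also have "\<dots> = (2 * A + 8 * K * k + 12 * K\<^sup>2 * A) * q1" by (simp add: algebra_simps)
      also have "\<dots> \<le> (14 * K\<^sup>2 * A\<^sup>2 * (1 + k)) * q1"
      proof (rule mult_right_mono)
        have "1 * A \<le> K\<^sup>2 * A\<^sup>2"
          using Kp1[of 2] A power_increasing[of 1 2 A] by (intro mult_mono) auto
        moreover have "K * 1 \<le> K\<^sup>2 * A\<^sup>2"
          using Kp[of 1 2] A one_le_power[OF A, of 2] K by (intro mult_mono) auto
        moreover have "K\<^sup>2 * A \<le> K\<^sup>2 * A\<^sup>2" using A power_increasing[of 1 2 A] by (simp add: mult_left_mono)
        moreover have "K * k \<le> K\<^sup>2 * A\<^sup>2 * k"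
          using k calculation(2) by (intro mult_right_mono) auto
        ultimately have "2 * A + 8 * K * k + 12 * K\<^sup>2 * A \<le> 14 * (K\<^sup>2 * A\<^sup>2) + 8 * (K\<^sup>2 * A\<^sup>2 * k)"
          by simp
        also have "\<dots> \<le> 14 * (K\<^sup>2 * A\<^sup>2) + 14 * (K\<^sup>2 * A\<^sup>2 * k)"
          using k by simp
        finally show "2 * A + 8 * K * k + 12 * K\<^sup>2 * A \<le> 14 * K\<^sup>2 * A\<^sup>2 * (1 + k)"
          by (simp add: algebra_simps)
      qed (use q1 in simp)
      finally show ?thesis
        by (intro goal[of "14 * K\<^sup>2"]) (use Kp[of 2 9] Kp1[of 9] in \<open>auto simp: mult.assoc\<close>)
    next
      case False
      \<comment> \<open>now \<open>v\<close> lies behind \<open>v1\<close> on its orbit, so \<open>R x1 \<le> R x + 1\<close> forces \<open>t - t1\<close> to be at most a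
        multiple of \<open>A\<^sup>2 q1\<^sup>2\<close>\<close>
      define s where "s = t - t1"
      define y where "y = sqrt s"
      have s: "0 < s" using False by (simp add: s_def)
      have y: "0 < y" "y\<^sup>2 = s" using s by (auto simp: y_def)
      have v1: "v1 = D s v" by (simp add: v_def v1_def s_def D_add)
      have gr: "s * (norm v)\<^sup>2 \<le> K * (R v1 - R v)"
        using D_growth[of s v] s v1 by simp
      then have "0 \<le> K * (R v1 - R v)"
        using s by (metis less_imp_le mult_nonneg_nonneg order_trans zero_le_power2)
      then have Rv: "R v \<le> R v1" using K by (simp add: zero_le_mult_iff)
      have dis: "\<delta> * norm v \<le> K * (R v1 - R v)"
        using D_displacement[of s v] s v1 by (simp add: \<delta>_def norm_minus_commute)
      have "(norm v)\<^sup>2 \<le> K * R v" by (rule R_lower)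
      also have "\<dots> \<le> K * (K * (norm v1)\<^sup>2)"
        using Rv R_upper[of v1] K by (intro mult_left_mono) auto
      also have "\<dots> = (K * norm v1)\<^sup>2" by (simp add: power2_eq_square)
      finally have "norm v \<le> K * norm v1" by (rule power2_le_imp_le) (use K in auto)
      also have "\<dots> \<le> K * (2 * \<rho>)" using v1u K by (intro mult_left_mono) auto
      finally have vu: "norm v \<le> 2 * K * \<rho>" by simp
      have \<rho>K: "1 * \<rho> \<le> K * \<rho>" using K \<rho>0 by (intro mult_right_mono)
      then have xu: "norm x \<le> 3 * K * \<rho>"
        using vu vx Aq(1) KA(2) A norm_triangle_ineq2[of x v] norm_minus_commute[of x v] by linarith
      \<comment> \<open>The hypothesis \<open>le\<close> keeps R x from falling far below R x1, so
        \<open>x\<close>, and with it \<open>v\<close>, stays at distance of order \<rho> from the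
        origin.\<close>
      have xl: "\<rho> / 2 \<le> K * norm x"
      proof (rule power2_le_imp_le)
        have "\<rho>\<^sup>2 \<le> K * R x1" unfolding \<rho>_def by (rule R_lower)
        also have "\<dots> \<le> K * (K * (norm x)\<^sup>2 + 1)"
          using le R_upper[of x] K by (intro mult_left_mono) auto
        finally have "\<rho>\<^sup>2 \<le> (K * norm x)\<^sup>2 + K" by (simp add: power2_eq_square algebra_simps)
        moreover have "4 * K \<le> \<rho>\<^sup>2"
        proof -
          have "4 * K \<le> \<rho>" using KA Kp[of 1 2] by simp
          also have "\<dots> \<le> \<rho>\<^sup>2" using \<rho>1 by (simp add: power2_eq_square)
          finally show ?thesis .
        qed
        moreover have "(\<rho> / 2)\<^sup>2 = \<rho>\<^sup>2 / 4" by (simp add: power_divide)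
        ultimately show "(\<rho> / 2)\<^sup>2 \<le> (K * norm x)\<^sup>2"
          using zero_le_power2[of \<rho>] by linarith
      qed (use K in auto)
      have vl: "\<rho> / 4 \<le> K * norm v"
      proof -
        have "K * norm x \<le> K * (norm v + A)"
          using vx Aq K norm_triangle_ineq2[of x v] by (intro mult_left_mono) (auto simp: norm_minus_commute)
        then show ?thesis using xl KA by (simp add: algebra_simps)
      qed
      \<comment> \<open>The tube at the later time can be wider, but only by the square root of the
        time difference.\<close>
      have qy: "q \<le> q1 + y"
      proof -
        have "q \<le> sqrt (min t1 1 + s)"
          unfolding q_def scale_def by (rule real_sqrt_le_mono) (use s in \<open>auto simp: s_def min_def\<close>)
        also have "\<dots> \<le> sqrt (min t1 1) + sqrt s"
          using t1 s by (intro sqrt_add_le_add_sqrt) auto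
        finally show ?thesis by (simp add: q1_def scale_def y_def)
      qed
      \<comment> \<open>The rise of R from \<open>v\<close> to \<open>v1\<close> passes through
        \<open>x\<close> and \<open>x1\<close>: the three parts contribute 3, 2 and 2 to the factor
        7, the middle one being the 1 of \<open>le\<close> absorbed by \<open>two\<close>.\<close>
      define X where "X = 7 * K\<^sup>2 * A * \<rho> * (q1 + y)"
      have RX: "R v1 - R v \<le> X"
      proof -
        have "R v1 - R x1 \<le> K * norm v1 * norm (v1 - x1)" by (rule R_diff)
        also have "\<dots> \<le> K * (2 * \<rho>) * (A * q1)"
          using v1u v1x K \<rho>0 by (intro mult_mono) auto
        finally have a1: "R v1 - R x1 \<le> 2 * (K * A * \<rho> * q1)" by (simp add: algebra_simps)
        have "R x - R v \<le> K * norm x * norm (x - v)" by (rule R_diff)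
        also have "\<dots> \<le> K * (3 * K * \<rho>) * (A * (q1 + y))"
        proof (intro mult_mono)
          have "norm (x - v) \<le> A * q" using vx by (simp add: norm_minus_commute)
          also have "\<dots> \<le> A * (q1 + y)" using A by (intro mult_left_mono[OF qy]) auto
          finally show "norm (x - v) \<le> A * (q1 + y)" .
        qed (use xu K \<rho>0 in auto)
        finally have a2: "R x - R v \<le> 3 * (K\<^sup>2 * A * \<rho> * (q1 + y))"
          by (simp add: algebra_simps power2_eq_square)
        have a3: "1 \<le> 2 * (K\<^sup>2 * A * \<rho> * q1)"
        proof -
          have "1 * (q1 * \<rho>) \<le> (K\<^sup>2 * A) * (q1 * \<rho>)"
            using mult_mono[of 1 "K\<^sup>2" 1 A] Kp1[of 2] A q1 \<rho>0 by (intro mult_right_mono) auto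
          then show ?thesis using two by (simp add: algebra_simps)
        qed
        have a4: "K * A * \<rho> * q1 \<le> K\<^sup>2 * A * \<rho> * q1"
          using Kp[of 1 2] A q1 \<rho>0 by (intro mult_right_mono) auto
        have a5: "0 \<le> K\<^sup>2 * A * \<rho> * y" using A \<rho>0 y by simp
        show ?thesis
          using a1 a2 a3 a4 a5 le unfolding X_def by (simp add: algebra_simps)
      qed
      \<comment> \<open>Inserting the lower bound \<rho> / 4 \<le> K |v| into \<open>gr\<close>
        costs a factor 16 K^2, and 16 times 7 is 112.\<close>
      define G where "G = 112 * K ^ 5 * A"
      have G1: "1 \<le> G" using mult_mono[of 1 "K ^ 5" 1 A] Kp1[of 5] A K by (simp add: G_def)
      have yG: "y\<^sup>2 * \<rho> \<le> G * (q1 + y)"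
      proof -
        have "y\<^sup>2 * (\<rho> / 4)\<^sup>2 \<le> y\<^sup>2 * (K * norm v)\<^sup>2"
          using vl \<rho>0 by (intro mult_left_mono power_mono) auto
        also have "\<dots> = K\<^sup>2 * (s * (norm v)\<^sup>2)" by (simp add: y power_mult_distrib)
        also have "\<dots> \<le> K\<^sup>2 * (K * X)"
          using K by (intro mult_left_mono order_trans[OF gr] RX) auto
        finally have "(y\<^sup>2 * \<rho>) * \<rho> \<le> (G * (q1 + y)) * \<rho>"
          by (simp add: X_def G_def power2_eq_square eval_nat_numeral algebra_simps)
        then show ?thesis using \<rho>1 by (simp add: mult_right_le_imp_le)
      qed
      \<comment> \<open>Where y exceeds q1, \<open>yG\<close> gives y \<rho> \<le> 2 G; since 1
        \<le> 2 q1 \<rho>, a factor \<rho> can be cancelled.\<close>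
      have yq: "y \<le> 4 * G * q1"
      proof (cases "y \<le> q1")
        case True
        have "1 * q1 \<le> (4 * G) * q1" using G1 q1 by (intro mult_right_mono) auto
        with True show ?thesis by simp
      next
        case False
        have "(y * \<rho>) * y \<le> G * (q1 + y)" using yG by (simp add: power2_eq_square algebra_simps)
        also have "\<dots> \<le> G * (2 * y)" using False G1 by (intro mult_left_mono) auto
        also have "\<dots> = (2 * G) * y" by simp
        finally have "y * \<rho> \<le> 2 * G" using y(1) by (rule mult_right_le_imp_le)
        also have "\<dots> = 2 * G * 1" by simp
        also have "\<dots> \<le> 2 * G * (2 * q1 * \<rho>)" using two G1 by (intro mult_left_mono) auto
        also have "\<dots> = (4 * G * q1) * \<rho>" by simp
        finally show ?thesis using \<rho>1 by (simp add: mult_right_le_imp_le)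
      qed
      have q1G: "q1 \<le> G * q1" using G1 q1 by (simp add: mult_right_mono)
      have qyG: "q1 + y \<le> 5 * G * q1" using yq q1G by simp
      have \<delta>: "\<delta> \<le> 28 * K ^ 4 * A * (q1 + y)"
      proof -
        have "\<delta> * (\<rho> / 4) \<le> \<delta> * (K * norm v)" using vl \<delta>0 by (rule mult_left_mono)
        also have "\<dots> = K * (\<delta> * norm v)" by simp
        also have "\<dots> \<le> K * (K * X)"
          using K by (intro mult_left_mono order_trans[OF dis] RX) auto
        finally have "\<delta> * \<rho> \<le> (28 * K ^ 4 * A * (q1 + y)) * \<rho>"
          by (simp add: X_def power2_eq_square eval_nat_numeral algebra_simps)
        then show ?thesis using \<rho>1 by (simp add: mult_right_le_imp_le)
      qed
      have "norm (x - x1) \<le> A * (q1 + y) + 28 * K ^ 4 * A * (q1 + y) + A * (q1 + y)"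
      proof -
        have "A * q \<le> A * (q1 + y)" "A * q1 \<le> A * (q1 + y)"
          using A qy y by (auto intro!: mult_left_mono)
        with xx1 \<delta> show ?thesis by linarith
      qed
      also have "\<dots> = (2 * A + 28 * K ^ 4 * A) * (q1 + y)" by (simp add: algebra_simps)
      also have "\<dots> \<le> 30 * K ^ 4 * A * (q1 + y)"
      proof -
        have "1 * A \<le> K ^ 4 * A" using Kp1[of 4] A by (intro mult_right_mono) auto
        then have "2 * A + 28 * K ^ 4 * A \<le> 30 * (K ^ 4 * A)" by linarith
        then have "(2 * A + 28 * K ^ 4 * A) * (q1 + y) \<le> (30 * (K ^ 4 * A)) * (q1 + y)"
          using y q1 by (intro mult_right_mono) auto
        then show ?thesis by (simp add: algebra_simps)
      qed
      also have "\<dots> \<le> 30 * K ^ 4 * A * (5 * G * q1)"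
        using qyG K A by (intro mult_left_mono) auto
      \<comment> \<open>30 times 5 times 112: this case is the worst of the three and fixes the
        constant.\<close>
      also have "\<dots> = 16800 * K ^ 9 * A\<^sup>2 * q1"
        by (simp add: G_def power2_eq_square eval_nat_numeral algebra_simps)
      also have "\<dots> \<le> 16800 * K ^ 9 * A\<^sup>2 * q1 * (1 + k)"
        using mult_left_mono[of 1 "1 + k" "16800 * K ^ 9 * A\<^sup>2 * q1"] k q1 K by simp
      finally show ?thesis
        by (intro goal[of "16800 * K ^ 9"]) (auto simp: mult_ac)
    qed
  qed
qed

end

section \<open>Gaussian mass of zones and the weak type bound for one aperture\<close>

definition shell_const :: "'a::euclidean_space itself \<Rightarrow> real" where
  "shell_const _ = measure lborel (ball (0::'a) 1) * (\<Sum>k. exp (- real k) * real (k + 1) ^ DIM('a))"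

lemma ennreal_le_suminf: "f k \<le> (\<Sum>k. f k :: ennreal)"
  using sum_le_suminf[of f "{k}"] by simp

lemma shell_const_nonneg: "0 \<le> shell_const TYPE('a::euclidean_space)"
  unfolding shell_const_def by (intro mult_nonneg_nonneg suminf_nonneg summable_power_exp) auto

text \<open>Sliced by the integer part \<open>k\<close> of the scaled distance: the integrand is at
  most exp(-k) there, and the slice lies in a ball of radius r (k + 1). The constant depends on the
  dimension alone, which is why \<open>shell_const\<close> takes a type.\<close>

lemma nn_integral_exp_norm_le:
  fixes x :: "'a::euclidean_space"
  assumes r: "0 < r"
  shows "(\<integral>\<^sup>+y. ennreal (exp (- (norm (y - x) / r))) \<partial>lborel) \<le> ennreal (shell_const TYPE('a) * r ^ DIM('a))"
proof -
  let ?n = "DIM('a)" and ?V = "measure lborel (ball (0::'a) 1)"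
  define B where "B k = ball x (r * real (k + 1))" for k
  have "(\<integral>\<^sup>+y. ennreal (exp (- (norm (y - x) / r))) \<partial>lborel)
      \<le> (\<integral>\<^sup>+y. (\<Sum>k. ennreal (exp (- real k)) * indicator (B k) y) \<partial>lborel)"
  proof (intro nn_integral_mono)
    fix y
    define k where "k = nat \<lfloor>norm (y - x) / r\<rfloor>"
    have k: "real k \<le> norm (y - x) / r" "norm (y - x) / r < real (k + 1)"
      using r unfolding k_def by (auto simp: of_nat_nat) linarith+
    have "y \<in> B k"
      using k(2) r by (simp add: B_def dist_norm norm_minus_commute divide_less_eq mult.commute)
    then have "ennreal (exp (- (norm (y - x) / r))) \<le> ennreal (exp (- real k)) * indicator (B k) y"
      using k(1) by (simp add: ennreal_leI)
    also have "\<dots> \<le> (\<Sum>k. ennreal (exp (- real k)) * indicator (B k) y)"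
      by (rule ennreal_le_suminf)
    finally show "ennreal (exp (- (norm (y - x) / r))) \<le> (\<Sum>k. ennreal (exp (- real k)) * indicator (B k) y)" .
  qed
  also have "\<dots> = (\<Sum>k. \<integral>\<^sup>+y. ennreal (exp (- real k)) * indicator (B k) y \<partial>lborel)"
  proof (rule nn_integral_suminf)
    have [measurable]: "B k \<in> sets borel" for k by (simp add: B_def)
    show "(\<lambda>y. ennreal (exp (- real k)) * indicator (B k) y) \<in> borel_measurable lborel" for k
      by measurable
  qed
  also have "\<dots> = (\<Sum>k. ennreal (?V * r ^ ?n * (exp (- real k) * real (k + 1) ^ ?n)))"
  proof (rule suminf_cong)
    fix k
    have "emeasure lborel (B k) = ennreal (measure lborel (B k))"
      unfolding B_def using emeasure_lborel_ball_finite
      by (intro emeasure_eq_ennreal_measure) (auto simp: less_top)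
    also have "measure lborel (B k) = (r * real (k + 1)) ^ ?n * ?V"
      unfolding B_def using r by (intro content_ball_conv_unit_ball) simp
    finally have "emeasure lborel (B k) = ennreal ((r * real (k + 1)) ^ ?n * ?V)" .
    then show "(\<integral>\<^sup>+y. ennreal (exp (- real k)) * indicator (B k) y \<partial>lborel)
        = ennreal (?V * r ^ ?n * (exp (- real k) * real (k + 1) ^ ?n))"
      using r by (subst nn_integral_cmult_indicator)
        (auto simp: B_def ennreal_mult'[symmetric] power_mult_distrib mult_ac)
  qed
  also have "\<dots> = ennreal (\<Sum>k. ?V * r ^ ?n * (exp (- real k) * real (k + 1) ^ ?n))"
    using r by (intro suminf_ennreal2 summable_mult summable_power_exp) auto
  also have "(\<Sum>k. ?V * r ^ ?n * (exp (- real k) * real (k + 1) ^ ?n)) = shell_const TYPE('a) * r ^ ?n"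
    by (subst suminf_mult[OF summable_power_exp]) (simp add: shell_const_def)
  finally show ?thesis .
qed

context expanding_flow
begin

lemma R_measurable [measurable]: "R \<in> borel_measurable borel"
  by (rule borel_measurable_continuous_onI[OF R_continuous])

text \<open>Left unnormalised; the normalising factor of the invariant measure enters only as
  \<kappa> in \<open>ou_maximal_weak_type\<close>.\<close>

definition gauss :: "'a measure" where
  "gauss = density lborel (\<lambda>x. ennreal (exp (- R x)))"

lemma sets_gauss [simp]: "sets gauss = sets borel"
  by (simp add: gauss_def)

lemma zone_sets: "zone P L r x \<in> sets borel"
  unfolding zone_def by measurable

lemma tube_sets: "tube A t x \<in> sets borel"
proof -
  have "open (tube A t x)"
    unfolding tube_def
    by (intro open_Collect_less continuous_intros D_continuous)
  then show ?thesis by simp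
qed

lemma emeasure_zone_le:
  assumes r: "0 < r" and P: "0 < P"
  shows "emeasure gauss (zone P L r x)
    \<le> ennreal (exp (L - R x) * (shell_const TYPE('a) * (r * P) ^ DIM('a)))"
proof -
  have "emeasure gauss (zone P L r x)
      = (\<integral>\<^sup>+y. ennreal (exp (- R y)) * indicator (zone P L r x) y \<partial>lborel)"
    unfolding gauss_def using zone_sets by (intro emeasure_density) auto
  also have "\<dots> \<le> (\<integral>\<^sup>+y. ennreal (exp (L - R x)) * ennreal (exp (- (norm (y - x) / (r * P)))) \<partial>lborel)"
  proof (intro nn_integral_mono)
    fix y
    show "ennreal (exp (- R y)) * indicator (zone P L r x) y
        \<le> ennreal (exp (L - R x)) * ennreal (exp (- (norm (y - x) / (r * P))))"
    proof (cases "y \<in> zone P L r x")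
      case True
      then have "norm (y - x) / r / P \<le> R y - R x + L"
        using divide_right_mono[of "norm (y - x) / r" "P * (R y - R x + L)" P] P by (simp add: zone_def)
      then have "- R y \<le> (L - R x) + - (norm (y - x) / (r * P))" by simp
      then have "exp (- R y) \<le> exp (L - R x) * exp (- (norm (y - x) / (r * P)))"
        unfolding exp_add[symmetric] by simp
      with True show ?thesis by (simp add: ennreal_mult'[symmetric] ennreal_leI)
    qed simp
  qed
  also have "\<dots> = ennreal (exp (L - R x)) * (\<integral>\<^sup>+y. ennreal (exp (- (norm (y - x) / (r * P)))) \<partial>lborel)"
    by (intro nn_integral_cmult) measurable
  also have "\<dots> \<le> ennreal (exp (L - R x)) * ennreal (shell_const TYPE('a) * (r * P) ^ DIM('a))"
    using r P by (intro mult_left_mono nn_integral_exp_norm_le) auto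
  also have "\<dots> = ennreal (exp (L - R x) * (shell_const TYPE('a) * (r * P) ^ DIM('a)))"
    by (simp add: ennreal_mult')
  finally show ?thesis .
qed

text \<open>This is exp(L) P^n times the shell constant. L adds up the 9 K^2 A required by
  \<open>near_tubes\<close> and the 2 required by \<open>far_tubes\<close>, and P is the constant of
  \<open>far_tubes\<close>, which dominates the 9 K A of \<open>near_tubes\<close>.\<close>

definition aperture_const :: "real \<Rightarrow> real" where
  "aperture_const A = shell_const TYPE('a) * exp (9 * K\<^sup>2 * A + 2) * (16800 * K ^ 9 * A\<^sup>2) ^ DIM('a)"

lemma aperture_const_nonneg: "0 \<le> aperture_const A"
proof -
  have "0 \<le> 16800 * K ^ 9 * A\<^sup>2" using K by simp
  then have "0 \<le> (16800 * K ^ 9 * A\<^sup>2) ^ DIM('a)" by (rule zero_le_power)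
  then show ?thesis
    unfolding aperture_const_def using shell_const_nonneg[where 'a = 'a] by (intro mult_nonneg_nonneg) auto
qed

text \<open>The Vitali bound with tubes as disjoint sets and zones as attached sets; membership in
  \<open>I\<close> gives the comparison of their masses. The ranking \<open>h\<close> is a parameter
  because the two regimes need different ones.\<close>

lemma weak_type_of_selection:
  fixes h :: "'a \<Rightarrow> real \<Rightarrow> real"
  assumes \<mu>: "finite_measure \<mu>" "sets \<mu> = sets borel" and \<alpha>: "0 < \<alpha>" and A: "1 \<le> A"
    and h: "\<And>x t. (x, t) \<in> I \<Longrightarrow> 0 \<le> h x t"
    and I: "\<And>x t. (x, t) \<in> I \<Longrightarrow> 0 < t \<and> \<alpha> * (exp (- R x) * scale t ^ DIM('a)) < measure \<mu> (tube A t x)"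
    and meet: "\<And>x t x1 t1. (x, t) \<in> I \<Longrightarrow> (x1, t1) \<in> I \<Longrightarrow> h x1 t1 \<le> h x t + 1 \<Longrightarrow>
      tube A t x \<inter> tube A t1 x1 \<noteq> {} \<Longrightarrow>
      x \<in> zone (16800 * K ^ 9 * A\<^sup>2) (9 * K\<^sup>2 * A + 2) (scale t1) x1"
  obtains W where "W \<in> sets borel" "fst ` I \<subseteq> W"
    "emeasure gauss W \<le> ennreal (aperture_const A / \<alpha>) * emeasure \<mu> (space \<mu>)"
proof -
  interpret finite_measure \<mu> by fact
  let ?P = "16800 * K ^ 9 * A\<^sup>2" and ?L = "9 * K\<^sup>2 * A + 2"
  define F where "F = (\<lambda>(x, t). tube A t x)"
  define Z where "Z = (\<lambda>(x, t). zone ?P ?L (scale t) x)"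
  have P: "0 < ?P" using K A by simp
  obtain W where W: "W \<in> sets gauss" "fst ` I \<subseteq> W"
    "emeasure gauss W \<le> ennreal (aperture_const A / \<alpha>) * emeasure \<mu> (space \<mu>)"
  proof (rule vitali_weak_type[OF \<mu>(1), of I 0 "\<lambda>(x, t). h x t" F Z gauss "ennreal (aperture_const A / \<alpha>)" fst])
    fix i assume i: "i \<in> I"
    obtain x t where xt: "i = (x, t)" by (cases i)
    have t: "0 < t" and big: "\<alpha> * (exp (- R x) * scale t ^ DIM('a)) < measure \<mu> (F i)"
      using I[of x t] i xt by (auto simp: F_def)
    show "0 \<le> (case i of (x, t) \<Rightarrow> h x t)" using h i xt by auto
    show "F i \<in> sets \<mu>" using tube_sets \<mu>(2) by (simp add: F_def xt)
    have "0 < \<alpha> * (exp (- R x) * scale t ^ DIM('a))" using \<alpha> scale_pos[OF t] by simp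
    with big show "0 < measure \<mu> (F i)" by linarith
    show "Z i \<in> sets gauss" using zone_sets by (simp add: Z_def xt)
    have "emeasure gauss (Z i) \<le> ennreal (exp (?L - R x) * (shell_const TYPE('a) * (scale t * ?P) ^ DIM('a)))"
      unfolding Z_def xt prod.case by (rule emeasure_zone_le[OF scale_pos[OF t] P])
    also have "exp (?L - R x) * (shell_const TYPE('a) * (scale t * ?P) ^ DIM('a))
        = aperture_const A * (exp (- R x) * scale t ^ DIM('a))"
      by (simp only: aperture_const_def power_mult_distrib diff_conv_add_uminus exp_add mult_ac)
    also have "\<dots> \<le> aperture_const A / \<alpha> * measure \<mu> (F i)"
    proof -
      have "exp (- R x) * scale t ^ DIM('a) \<le> measure \<mu> (F i) / \<alpha>"
        using big \<alpha> by (simp add: pos_le_divide_eq mult.commute)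
      from mult_left_mono[OF this aperture_const_nonneg[of A]] show ?thesis by simp
    qed
    finally show "emeasure gauss (Z i) \<le> ennreal (aperture_const A / \<alpha>) * emeasure \<mu> (F i)"
      using aperture_const_nonneg[of A] \<alpha>
      by (simp add: emeasure_eq_measure ennreal_mult'[symmetric] ennreal_leI)
    fix j assume j: "j \<in> I" "(case j of (x, t) \<Rightarrow> h x t) \<le> (case i of (x, t) \<Rightarrow> h x t) + 1" "F i \<inter> F j \<noteq> {}"
    with meet i show "fst i \<in> Z j"
      by (cases j) (auto simp: F_def Z_def xt)
  qed blast
  then show ?thesis using that[of W] by simp
qed

text \<open>Concluding with a Borel cover avoids any question of measurability of the exceptional
  set. The two regimes are covered separately, whence the factor 2.\<close>

lemma weak_type_fixed_aperture:
  assumes \<mu>: "finite_measure \<mu>" "sets \<mu> = sets borel" and \<alpha>: "0 < \<alpha>" and A: "1 \<le> A"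
  obtains W where "W \<in> sets borel"
    "{x. \<exists>t>0. \<alpha> * (exp (- R x) * scale t ^ DIM('a)) < measure \<mu> (tube A t x)} \<subseteq> W"
    "emeasure gauss W \<le> ennreal (2 * aperture_const A / \<alpha>) * emeasure \<mu> (space \<mu>)"
proof -
  let ?P = "16800 * K ^ 9 * A\<^sup>2" and ?L = "9 * K\<^sup>2 * A + 2"
  define good where "good x t \<longleftrightarrow> 0 < t \<and> \<alpha> * (exp (- R x) * scale t ^ DIM('a)) < measure \<mu> (tube A t x)" for x t
  define I1 where "I1 = {(x, t). good x t \<and> t \<le> 1 / (1 + norm x)\<^sup>2}"
  define I2 where "I2 = {(x, t). good x t \<and> 1 / (1 + norm x)\<^sup>2 \<le> t}"
  have P: "9 * K * A \<le> ?P"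
  proof -
    have "K \<le> K ^ 9" "A \<le> A\<^sup>2"
      using power_increasing[of 1 9 K] power_increasing[of 1 2 A] K A by auto
    then have "9 * K * A \<le> 16800 * K ^ 9 * A\<^sup>2"
      using K A by (intro mult_mono) auto
    then show ?thesis .
  qed
  have L: "0 \<le> 9 * K\<^sup>2 * A" using A by simp
  \<comment> \<open>Ranking by - ln t turns the additive slack 1 into a factor e between times, and
    it is nonnegative because t \<le> 1 in this regime.\<close>
  obtain W1 where W1: "W1 \<in> sets borel" "fst ` I1 \<subseteq> W1"
    "emeasure gauss W1 \<le> ennreal (aperture_const A / \<alpha>) * emeasure \<mu> (space \<mu>)"
  proof (rule weak_type_of_selection[OF \<mu> \<alpha> A, of I1 "\<lambda>x t. - ln t"])
    fix x :: 'a and t assume i: "(x, t) \<in> I1"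
    then show "0 < t \<and> \<alpha> * (exp (- R x) * scale t ^ DIM('a)) < measure \<mu> (tube A t x)"
      by (auto simp: I1_def good_def)
    have "1 / (1 + norm x)\<^sup>2 \<le> 1" by (simp add: divide_le_eq_1)
    with i have "0 < t" "t \<le> 1" by (auto simp: I1_def good_def)
    then show "0 \<le> - ln t" by simp
    fix x1 :: 'a and t1 assume j: "(x1, t1) \<in> I1" "- ln t1 \<le> - ln t + 1" "tube A t x \<inter> tube A t1 x1 \<noteq> {}"
    have near: "norm (x - x1) \<le> 9 * K * A * scale t1" "R x1 - R x \<le> 9 * K ^ 2 * A"
      using near_tubes[OF A _ _ _ _ j(2,3)] i j(1) by (auto simp: I1_def good_def)
    have "0 < scale t1" using j(1) by (auto simp: I1_def good_def scale_pos)
    then have "norm (x - x1) / scale t1 \<le> 9 * K * A" using near(1) by (simp add: divide_le_eq)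
    also have "\<dots> \<le> ?P * 1" using P by simp
    also have "\<dots> \<le> ?P * (R x - R x1 + ?L)" using near(2) K by (intro mult_left_mono) auto
    finally show "x \<in> zone ?P ?L (scale t1) x1" by (simp add: zone_def)
  qed blast
  \<comment> \<open>Ranking by R: the slack 1 of the selection is exactly the hypothesis
    \<open>le\<close> of \<open>far_tubes\<close>.\<close>
  obtain W2 where W2: "W2 \<in> sets borel" "fst ` I2 \<subseteq> W2"
    "emeasure gauss W2 \<le> ennreal (aperture_const A / \<alpha>) * emeasure \<mu> (space \<mu>)"
  proof (rule weak_type_of_selection[OF \<mu> \<alpha> A, of I2 "\<lambda>x t. R x"])
    fix x :: 'a and t assume i: "(x, t) \<in> I2"
    then show "0 < t \<and> \<alpha> * (exp (- R x) * scale t ^ DIM('a)) < measure \<mu> (tube A t x)"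
      by (auto simp: I2_def good_def)
    show "0 \<le> R x" by (rule R_nonneg)
    fix x1 :: 'a and t1 assume j: "(x1, t1) \<in> I2" "R x1 \<le> R x + 1" "tube A t x \<inter> tube A t1 x1 \<noteq> {}"
    have far: "norm (x - x1) \<le> ?P * (R x - R x1 + 2) * scale t1"
      using far_tubes[OF A _ _ _ j(2,3)] i j(1) by (auto simp: I2_def good_def)
    have "0 < scale t1" using j(1) by (auto simp: I2_def good_def scale_pos)
    then have "norm (x - x1) / scale t1 \<le> ?P * (R x - R x1 + 2)" using far by (simp add: divide_le_eq)
    also have "\<dots> \<le> ?P * (R x - R x1 + ?L)" using K L by (intro mult_left_mono) auto
    finally show "x \<in> zone ?P ?L (scale t1) x1" by (simp add: zone_def)
  qed blast
  have "emeasure gauss (W1 \<union> W2) \<le> emeasure gauss W1 + emeasure gauss W2"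
    using W1 W2 by (intro emeasure_subadditive) auto
  also have "\<dots> \<le> ennreal (aperture_const A / \<alpha>) * emeasure \<mu> (space \<mu>)
      + ennreal (aperture_const A / \<alpha>) * emeasure \<mu> (space \<mu>)"
    by (intro add_mono W1 W2)
  also have "\<dots> = ennreal (2 * aperture_const A / \<alpha>) * emeasure \<mu> (space \<mu>)"
    using \<alpha> aperture_const_nonneg[of A]
    by (simp add: distrib_right[symmetric] ennreal_plus[symmetric] del: ennreal_plus)
  finally have "emeasure gauss (W1 \<union> W2) \<le> ennreal (2 * aperture_const A / \<alpha>) * emeasure \<mu> (space \<mu>)" .
  moreover have "{x. \<exists>t>0. \<alpha> * (exp (- R x) * scale t ^ DIM('a)) < measure \<mu> (tube A t x)} \<subseteq> W1 \<union> W2"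
  proof safe
    fix x t assume "0 < t" "\<alpha> * (exp (- R x) * scale t ^ DIM('a)) < measure \<mu> (tube A t x)" "x \<notin> W2"
    then have "(x, t) \<in> I1 \<union> I2" by (auto simp: I1_def I2_def good_def)
    with W1(2) W2(2) \<open>x \<notin> W2\<close> show "x \<in> W1" by force
  qed
  ultimately show ?thesis using that[of "W1 \<union> W2"] W1 W2 by blast
qed


end

section \<open>Summation over apertures\<close>

lemma completing_square_bound:
  fixes a c x :: real
  assumes c: "0 < c"
  shows "a * x - c * x\<^sup>2 \<le> a\<^sup>2 / (4 * c)"
proof -
  have "4 * c * (a * x - c * x\<^sup>2) = a\<^sup>2 - (a - 2 * c * x)\<^sup>2"
    by (simp add: power2_eq_square algebra_simps)
  also have "\<dots> \<le> a\<^sup>2" by simp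
  finally show ?thesis using c by (simp add: pos_le_divide_eq mult.commute)
qed

context expanding_flow
begin

text \<open>The factor 2^(m + 1) arises because the level \<alpha> is shared among the apertures in
  the proportions 2^(-(m + 1)).\<close>

lemma summable_aperture_const:
  assumes c: "0 < c"
  shows "summable (\<lambda>m::nat. 2 * aperture_const (real (m + 1)) * 2 ^ (m + 1) * exp (- c * real m ^ 2))"
proof (rule summable_comparison_test, intro exI allI impI)
  fix m :: nat
  let ?n = "DIM('a)" and ?A = "real (m + 1)"
  \<comment> \<open>9 K^2 comes from the aperture constant, and one unit each from bounding 2^(m +
    1) and the power of \<open>?A\<close> by exponentials of \<open>?A\<close>.\<close>
  define a where "a = 9 * K\<^sup>2 + 2"
  define C where "C = 2 * shell_const TYPE('a) * exp 2 * (16800 * K ^ 9) ^ ?n * fact (2 * ?n)"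
  have C: "0 \<le> C" unfolding C_def using K shell_const_nonneg[where 'a = 'a] by simp
  have "?A ^ (2 * ?n) \<le> fact (2 * ?n) * exp ?A" by (rule power_le_fact_exp) simp
  moreover have "2 ^ (m + 1) \<le> exp ?A"
  proof -
    have "(2::real) ^ (m + 1) \<le> exp 1 ^ (m + 1)"
      using exp_ge_add_one_self[of 1] by (intro power_mono) auto
    also have "exp 1 ^ (m + 1) = exp ?A"
      using exp_of_nat_mult[of "m + 1" "1::real"] by (simp only: mult_1_right)
    finally show ?thesis .
  qed
  ultimately have "?A ^ (2 * ?n) * 2 ^ (m + 1) \<le> (fact (2 * ?n) * exp ?A) * exp ?A"
    by (intro mult_mono) auto
  then have "(2 * shell_const TYPE('a) * exp (9 * K\<^sup>2 * ?A + 2) * (16800 * K ^ 9) ^ ?n) * (?A ^ (2 * ?n) * 2 ^ (m + 1))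
      \<le> (2 * shell_const TYPE('a) * exp (9 * K\<^sup>2 * ?A + 2) * (16800 * K ^ 9) ^ ?n) * ((fact (2 * ?n) * exp ?A) * exp ?A)"
    using K shell_const_nonneg[where 'a = 'a] by (intro mult_left_mono) auto
  also have "\<dots> = C * (exp (9 * K\<^sup>2 * ?A) * exp ?A * exp ?A)"
    by (simp add: C_def exp_add mult_ac)
  also have "exp (9 * K\<^sup>2 * ?A) * exp ?A * exp ?A = exp (a * ?A)"
    unfolding mult_exp_exp by (simp add: a_def algebra_simps)
  also have "(2 * shell_const TYPE('a) * exp (9 * K\<^sup>2 * ?A + 2) * (16800 * K ^ 9) ^ ?n) * (?A ^ (2 * ?n) * 2 ^ (m + 1))
      = 2 * aperture_const ?A * 2 ^ (m + 1)"
    unfolding power_mult[of ?A 2 ?n] by (simp only: aperture_const_def power_mult_distrib mult_ac)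
  finally have "2 * aperture_const ?A * 2 ^ (m + 1) \<le> C * exp (a * ?A)" .
  then have "2 * aperture_const ?A * 2 ^ (m + 1) * exp (- c * real m ^ 2)
      \<le> C * exp (a * ?A) * exp (- c * real m ^ 2)"
    by (rule mult_right_mono) simp
  also have "\<dots> = C * exp (a * ?A - c * real m ^ 2)"
    by (simp add: exp_diff exp_minus divide_inverse)
  \<comment> \<open>One more unit of exponent is spent on completing the square, so that exp(-m) is
    left over for a geometric series.\<close>
  also have "\<dots> \<le> C * exp (a + (a + 1)\<^sup>2 / (4 * c) - real m)"
  proof -
    have 1: "(a + 1) * real m - c * (real m)\<^sup>2 \<le> (a + 1)\<^sup>2 / (4 * c)"
      using c by (rule completing_square_bound)
    have "a * ?A = a * real m + a" "(a + 1) * real m = a * real m + real m"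
      by (simp_all add: distrib_left distrib_right)
    with 1 have "a * ?A - c * real m ^ 2 \<le> a + (a + 1)\<^sup>2 / (4 * c) - real m"
      by linarith
    then show ?thesis using C by (intro mult_left_mono) auto
  qed
  also have "\<dots> = C * exp (a + (a + 1)\<^sup>2 / (4 * c)) * exp (real m * - 1)"
    by (simp only: mult.assoc exp_add[symmetric]) simp
  also have "exp (real m * - 1) = exp (- 1) ^ m"
    by (rule exp_of_nat_mult)
  finally show "norm (2 * aperture_const ?A * 2 ^ (m + 1) * exp (- c * real m ^ 2))
      \<le> C * exp (a + (a + 1)\<^sup>2 / (4 * c)) * exp (- 1) ^ m"
    using aperture_const_nonneg by simp
qed (rule summable_mult, rule summable_geometric, simp)

definition flow_kernel :: "real \<Rightarrow> real \<Rightarrow> 'a \<Rightarrow> 'a \<Rightarrow> real" where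
  "flow_kernel c t x u = exp (R x) / scale t ^ DIM('a) * exp (- c * (norm (D (- t) u - x) / scale t)\<^sup>2)"

text \<open>Used in contrapositive form: if the kernel average exceeds \<alpha>, then some single
  aperture exceeds its share. The factor exp(c m^2) in the share is exactly what the kernel loses on
  the m-th layer.\<close>

lemma nn_integral_flow_kernel_le:
  assumes \<mu>: "finite_measure \<mu>" "sets \<mu> = sets borel" and \<alpha>: "0 < \<alpha>" and c: "0 < c" and t: "0 < t"
    and small: "\<And>m::nat. measure \<mu> (tube (real (m + 1)) t x)
      \<le> \<alpha> * exp (c * real m ^ 2) / 2 ^ (m + 1) * (exp (- R x) * scale t ^ DIM('a))"
  shows "(\<integral>\<^sup>+u. ennreal (flow_kernel c t x u) \<partial>\<mu>) \<le> ennreal \<alpha>"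
proof -
  interpret finite_measure \<mu> by fact
  have s: "0 < scale t" using t by (rule scale_pos)
  define E where "E = exp (R x) / scale t ^ DIM('a)"
  have E: "0 < E" using s by (simp add: E_def)
  let ?T = "\<lambda>m::nat. tube (real (m + 1)) t x"
  have T [measurable]: "?T m \<in> sets \<mu>" for m using tube_sets \<mu>(2) by simp
  have "(\<integral>\<^sup>+u. ennreal (flow_kernel c t x u) \<partial>\<mu>)
      \<le> (\<integral>\<^sup>+u. (\<Sum>m. ennreal (E * exp (- c * real m ^ 2)) * indicator (?T m) u) \<partial>\<mu>)"
  proof (intro nn_integral_mono)
    fix u
    define r where "r = norm (D (- t) u - x) / scale t"
    \<comment> \<open>Rounding down bounds the kernel by its value at \<open>m\<close>, while the
      point itself lies in the tube of aperture m + 1.\<close>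
    define m where "m = nat \<lfloor>r\<rfloor>"
    have r: "0 \<le> r" using s by (simp add: r_def)
    have m: "real m \<le> r" "r < real (m + 1)"
      using r unfolding m_def by (auto simp: of_nat_nat) linarith+
    have "u \<in> ?T m"
      using m(2) s by (simp add: tube_def r_def divide_less_eq mult.commute)
    moreover have "flow_kernel c t x u \<le> E * exp (- c * real m ^ 2)"
      using m(1) c E unfolding flow_kernel_def E_def[symmetric] r_def[symmetric]
      by (intro mult_left_mono) (auto intro!: power_mono)
    ultimately have "ennreal (flow_kernel c t x u) \<le> ennreal (E * exp (- c * real m ^ 2)) * indicator (?T m) u"
      by (simp add: ennreal_leI)
    also have "\<dots> \<le> (\<Sum>m. ennreal (E * exp (- c * real m ^ 2)) * indicator (?T m) u)"
      by (rule ennreal_le_suminf)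
    finally show "ennreal (flow_kernel c t x u) \<le> (\<Sum>m. ennreal (E * exp (- c * real m ^ 2)) * indicator (?T m) u)" .
  qed
  also have "\<dots> = (\<Sum>m. \<integral>\<^sup>+u. ennreal (E * exp (- c * real m ^ 2)) * indicator (?T m) u \<partial>\<mu>)"
    by (rule nn_integral_suminf) measurable
  also have "\<dots> \<le> (\<Sum>m. ennreal (\<alpha> * (1 / 2) ^ Suc m))"
  proof (intro suminf_le)
    fix m
    have "(\<integral>\<^sup>+u. ennreal (E * exp (- c * real m ^ 2)) * indicator (?T m) u \<partial>\<mu>)
        = ennreal (E * exp (- c * real m ^ 2) * measure \<mu> (?T m))"
      using E unfolding nn_integral_cmult_indicator[OF T] by (simp add: emeasure_eq_measure ennreal_mult')
    also have "\<dots> \<le> ennreal (E * exp (- c * real m ^ 2)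
        * (\<alpha> * exp (c * real m ^ 2) / 2 ^ (m + 1) * (exp (- R x) * scale t ^ DIM('a))))"
      using E by (intro ennreal_leI mult_left_mono small) auto
    also have "E * exp (- c * real m ^ 2)
        * (\<alpha> * exp (c * real m ^ 2) / 2 ^ (m + 1) * (exp (- R x) * scale t ^ DIM('a)))
        = \<alpha> * (1 / 2) ^ Suc m"
      using s by (simp add: E_def exp_minus power_divide field_simps)
    finally show "(\<integral>\<^sup>+u. ennreal (E * exp (- c * real m ^ 2)) * indicator (?T m) u \<partial>\<mu>)
        \<le> ennreal (\<alpha> * (1 / 2) ^ Suc m)" .
  qed auto
  also have "\<dots> = ennreal (\<Sum>m. \<alpha> * (1 / 2) ^ Suc m)"
    using \<alpha> power_half_series by (intro suminf_ennreal2 summable_mult) (auto simp: sums_iff)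
  also have "(\<Sum>m. \<alpha> * (1 / 2) ^ Suc m) = \<alpha>"
    using sums_mult[OF power_half_series, of \<alpha>] by (simp add: sums_iff)
  finally show ?thesis .
qed

text \<open>Every exceptional point is exceptional for some aperture \<open>m\<close> at the level
  \<beta> m, so the union of the covers works and the constant is the sum of \<open>b\<close>. It is
  fixed before \<mu> and \<alpha>.\<close>

theorem flow_maximal_weak_type:
  assumes c: "0 < c"
  obtains C where "0 \<le> C"
    "\<And>\<mu> \<alpha>. finite_measure \<mu> \<Longrightarrow> sets \<mu> = sets borel \<Longrightarrow> 0 < \<alpha> \<Longrightarrow>
      \<exists>W\<in>sets borel. {x. \<exists>t>0. ennreal \<alpha> < (\<integral>\<^sup>+u. ennreal (flow_kernel c t x u) \<partial>\<mu>)} \<subseteq> W \<and>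
        emeasure gauss W \<le> ennreal (C / \<alpha>) * emeasure \<mu> (space \<mu>)"
proof
  define b where "b m = 2 * aperture_const (real (m + 1)) * 2 ^ (m + 1) * exp (- c * real m ^ 2)" for m :: nat
  have b0: "0 \<le> b m" for m using aperture_const_nonneg by (simp add: b_def)
  have bs: "summable b" unfolding b_def by (rule summable_aperture_const[OF c])
  show "0 \<le> suminf b" by (rule suminf_nonneg[OF bs b0])
  fix \<mu> :: "'a measure" and \<alpha> :: real
  assume \<mu>: "finite_measure \<mu>" "sets \<mu> = sets borel" and \<alpha>: "0 < \<alpha>"
  define \<beta> where "\<beta> m = \<alpha> * exp (c * real m ^ 2) / 2 ^ (m + 1)" for m :: nat
  have \<beta>: "0 < \<beta> m" for m using \<alpha> by (simp add: \<beta>_def)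
  define good where "good m W \<longleftrightarrow> W \<in> sets borel \<and>
    {x. \<exists>t>0. \<beta> m * (exp (- R x) * scale t ^ DIM('a)) < measure \<mu> (tube (real (m + 1)) t x)} \<subseteq> W \<and>
    emeasure gauss W \<le> ennreal (2 * aperture_const (real (m + 1)) / \<beta> m) * emeasure \<mu> (space \<mu>)"
    for m W
  have "\<exists>W. good m W" for m
  proof -
    have "1 \<le> real (m + 1)" by simp
    then show ?thesis
      by (rule weak_type_fixed_aperture[OF \<mu> \<beta>[of m]]) (intro exI, unfold good_def, intro conjI; assumption)
  qed
  then obtain W where good: "\<And>m. good m (W m)"
    by metis
  note W = good[unfolded good_def, THEN conjunct1] good[unfolded good_def, THEN conjunct2, THEN conjunct1]
    good[unfolded good_def, THEN conjunct2, THEN conjunct2]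
  show "\<exists>W\<in>sets borel. {x. \<exists>t>0. ennreal \<alpha> < (\<integral>\<^sup>+u. ennreal (flow_kernel c t x u) \<partial>\<mu>)} \<subseteq> W \<and>
        emeasure gauss W \<le> ennreal (suminf b / \<alpha>) * emeasure \<mu> (space \<mu>)"
  proof (intro bexI[of _ "\<Union>m. W m"] conjI subsetI)
    fix x assume "x \<in> {x. \<exists>t>0. ennreal \<alpha> < (\<integral>\<^sup>+u. ennreal (flow_kernel c t x u) \<partial>\<mu>)}"
    then obtain t where t: "0 < t" "\<not> (\<integral>\<^sup>+u. ennreal (flow_kernel c t x u) \<partial>\<mu>) \<le> ennreal \<alpha>"
      by (auto simp: not_le)
    then obtain m where "\<not> measure \<mu> (tube (real (m + 1)) t x) \<le> \<beta> m * (exp (- R x) * scale t ^ DIM('a))"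
      using nn_integral_flow_kernel_le[OF \<mu> \<alpha> c t(1), of x] unfolding \<beta>_def by blast
    then have "x \<in> W m" using W(2)[of m] t(1) by (auto simp: not_le)
    then show "x \<in> (\<Union>m. W m)" by blast
  next
    have "emeasure gauss (\<Union>m. W m) \<le> (\<Sum>m. emeasure gauss (W m))"
      using W(1) by (intro emeasure_subadditive_countably) auto
    also have "\<dots> \<le> (\<Sum>m. ennreal (b m / \<alpha>) * emeasure \<mu> (space \<mu>))"
    proof (intro suminf_le)
      fix m
      have eq: "2 * aperture_const (real (m + 1)) / \<beta> m = b m / \<alpha>"
      proof -
        have "x / (\<alpha> * e / p) = x * p * inverse e / \<alpha>" for x e p :: real
          by (simp add: divide_inverse)
        moreover have "exp (- c * (real m)\<^sup>2) = inverse (exp (c * (real m)\<^sup>2))"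
          by (simp only: exp_minus mult_minus_left)
        ultimately show ?thesis
          unfolding b_def \<beta>_def by simp
      qed
      show "emeasure gauss (W m) \<le> ennreal (b m / \<alpha>) * emeasure \<mu> (space \<mu>)"
        using W(3)[of m] unfolding eq .
    qed auto
    also have "\<dots> = (\<Sum>m. ennreal (b m / \<alpha>)) * emeasure \<mu> (space \<mu>)"
      by (rule ennreal_suminf_multc)
    also have "(\<Sum>m. ennreal (b m / \<alpha>)) = ennreal (suminf b / \<alpha>)"
      using b0 bs \<alpha> suminf_divide[OF bs, of \<alpha>] by (subst suminf_ennreal2) (auto intro: summable_divide)
    finally show "emeasure gauss (\<Union>m. W m) \<le> ennreal (suminf b / \<alpha>) * emeasure \<mu> (space \<mu>)" .
  qed (use W(1) in auto)
qed

end

section \<open>The Mehler kernel and the Ornstein--Uhlenbeck flow\<close>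

context ornstein_uhlenbeck
begin

section \<open>The Ornstein--Uhlenbeck flow is an expanding flow\<close>

lemma ou_R_orbit_mono:
  assumes "0 \<le> s"
  shows "ou_R Q B x \<le> ou_R Q B (ou_D Q B s *v x)"
proof -
  have "ou_R Q B (ou_D Q B 0 *v x) \<le> ou_R Q B (ou_D Q B s *v x)"
    by (rule nonneg_derivative_imp_le[OF assms ou_R_deriv]) (simp add: Q_form_nonneg)
  then show ?thesis by (simp add: ou_D_zero)
qed

text \<open>R does not decrease along the orbit, and at time \<open>s\<close> it is half the form of
  S at the dual orbit. Comparing it with its value at \<open>x\<close> gives the bound uniformly in
  \<open>s\<close>.\<close>

lemma dual_orbit_lower_bound:
  obtains p where "0 < p" "\<And>s x. 0 \<le> s \<Longrightarrow> norm x \<le> p * norm (dual_orbit x s)"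
proof -
  obtain k where k: "1 \<le> k" "\<And>x. (norm x)\<^sup>2 \<le> k * ou_R Q B x" "\<And>x. ou_R Q B x \<le> k * (norm x)\<^sup>2"
    "\<And>x y. ou_R Q B y - ou_R Q B x \<le> k * norm y * norm (y - x)"
    by (rule ou_R_bounds) (rule that)
  obtain a where a: "0 < a" "\<And>x. norm (S *v x) \<le> a * norm x" by (rule matrix_vector_bound[of S]) (rule that)
  \<comment> \<open>From j \<le> (1 + j)^2 for j \<ge> 0; this avoids a square root.\<close>
  define p where "p = 1 + k * a / 2"
  have ka: "0 \<le> k * a / 2" using k(1) a(1) by simp
  have pa: "k * a / 2 \<le> p\<^sup>2"
  proof -
    have "j \<le> (1 + j)\<^sup>2" if "0 \<le> j" for j :: real
      using that by (simp add: power2_eq_square algebra_simps)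
    from this[OF ka] show ?thesis by (simp only: p_def)
  qed
  have "norm x \<le> p * norm (dual_orbit x s)" if s: "0 \<le> s" for s x
  proof (rule power2_le_imp_le)
    let ?z = "dual_orbit x s"
    have "?z \<bullet> (S *v ?z) \<le> norm ?z * norm (S *v ?z)" by (rule norm_cauchy_schwarz)
    also have "\<dots> \<le> norm ?z * (a * norm ?z)" by (intro mult_left_mono a) auto
    finally have z: "?z \<bullet> (S *v ?z) \<le> a * (norm ?z)\<^sup>2" by (simp add: power2_eq_square mult_ac)
    have "(norm x)\<^sup>2 \<le> k * ou_R Q B x" by (rule k)
    also have "\<dots> \<le> k * ou_R Q B (ou_D Q B s *v x)"
      using k(1) by (intro mult_left_mono ou_R_orbit_mono s) auto
    also have "\<dots> \<le> k * (1 / 2 * (a * (norm ?z)\<^sup>2))"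
      unfolding ou_R_orbit using z k(1) by (intro mult_left_mono) auto
    also have "\<dots> = (k * a / 2) * (norm ?z)\<^sup>2" by simp
    also have "\<dots> \<le> p\<^sup>2 * (norm ?z)\<^sup>2" using pa by (intro mult_right_mono) auto
    finally show "(norm x)\<^sup>2 \<le> (p * norm ?z)\<^sup>2" by (simp add: power_mult_distrib)
    show "0 \<le> p * norm ?z" using ka by (simp add: p_def)
  qed
  moreover have "0 < p" using ka by (simp add: p_def)
  ultimately show ?thesis using that[of p] by simp
qed

text \<open>With z the dual orbit, R grows at rate at least a multiple of |z|^2, the speed is at
  most a multiple of |z|, and |x| is at most a multiple of |z|. So both |x|^2 and |x| times the
  speed are dominated by the growth of R, and integration gives the first two bounds. For times up
  to 1, |z| is at most a multiple of |x|, which gives the third.\<close>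

lemma orbit_bounds:
  obtains k where "1 \<le> k"
    "\<And>s x. 0 \<le> s \<Longrightarrow> s * (norm x)\<^sup>2 \<le> k * (ou_R Q B (ou_D Q B s *v x) - ou_R Q B x)"
    "\<And>s x. 0 \<le> s \<Longrightarrow> norm (ou_D Q B s *v x - x) * norm x \<le> k * (ou_R Q B (ou_D Q B s *v x) - ou_R Q B x)"
    "\<And>s x. 0 \<le> s \<Longrightarrow> s \<le> 1 \<Longrightarrow> norm (ou_D Q B s *v x - x) \<le> k * s * norm x"
proof -
  obtain q where q: "1 \<le> q" "\<And>x. (norm x)\<^sup>2 \<le> q * ((Q *v x) \<bullet> x)" "\<And>x. (Q *v x) \<bullet> x \<le> q * (norm x)\<^sup>2"
    by (rule Q_bounds) (rule that)
  obtain p where p: "0 < p" "\<And>s x. 0 \<le> s \<Longrightarrow> norm x \<le> p * norm (dual_orbit x s)"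
    by (rule dual_orbit_lower_bound) (rule that)
  obtain a where a: "0 < a" "\<And>x. norm ((S ** transpose B) *v x) \<le> a * norm x"
    by (rule matrix_vector_bound[of "S ** transpose B"]) (rule that)
  obtain b where b: "1 \<le> b" "\<And>s x. \<bar>s\<bar> \<le> 1 \<Longrightarrow> norm (N s *v x) \<le> b * norm x"
    by (rule matrix_exp_local_bound[of "transpose B", folded N_def]) (rule that)
  obtain d where d: "0 < d" "\<And>x. norm (matrix_inv S *v x) \<le> d * norm x"
    by (rule matrix_vector_bound[of "matrix_inv S"]) (rule that)
  have sp: "\<bar>e \<bullet> (S *v (transpose B *v z))\<bar> \<le> norm e * (a * norm z)" for e z
  proof -
    have "\<bar>e \<bullet> (S *v (transpose B *v z))\<bar> \<le> norm e * norm ((S ** transpose B) *v z)"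
      unfolding matrix_vector_mul_assoc by (rule Cauchy_Schwarz_ineq2)
    also have "\<dots> \<le> norm e * (a * norm z)" by (intro mult_left_mono a) auto
    finally show ?thesis .
  qed
  have inner_deriv: "((\<lambda>s. e \<bullet> (ou_D Q B s *v x)) has_real_derivative - (e \<bullet> (S *v (transpose B *v dual_orbit x s)))) (at s)"
    for e x s
    using bounded_linear.has_vector_derivative[OF bounded_linear_inner_right[of e] ou_D_deriv[of x s]]
    by (simp add: has_real_derivative_iff_has_vector_derivative)
  have growth: "s * (norm x)\<^sup>2 \<le> (2 * q * p\<^sup>2) * (ou_R Q B (ou_D Q B s *v x) - ou_R Q B x)" if s: "0 \<le> s" for s x
  proof -
    define f where "f r = (2 * q * p\<^sup>2) * ou_R Q B (ou_D Q B r *v x) - r * (norm x)\<^sup>2" for r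
    have "f 0 \<le> f s"
    proof (rule nonneg_derivative_imp_le[OF s])
      fix r :: real assume r: "0 \<le> r"
      let ?z = "dual_orbit x r"
      show "(f has_real_derivative (2 * q * p\<^sup>2) * (1 / 2 * ((Q *v ?z) \<bullet> ?z)) - 1 * (norm x)\<^sup>2) (at r)"
        unfolding f_def
        by (intro DERIV_diff DERIV_cmult DERIV_cmult_right DERIV_ident ou_R_deriv)
      have "(norm x)\<^sup>2 \<le> (p * norm ?z)\<^sup>2" using p(2)[OF r] by (intro power_mono) auto
      also have "\<dots> = p\<^sup>2 * (norm ?z)\<^sup>2" by (simp add: power_mult_distrib)
      also have "\<dots> \<le> p\<^sup>2 * (q * ((Q *v ?z) \<bullet> ?z))" by (intro mult_left_mono q) auto
      finally show "0 \<le> (2 * q * p\<^sup>2) * (1 / 2 * ((Q *v ?z) \<bullet> ?z)) - 1 * (norm x)\<^sup>2"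
        by (simp add: mult_ac)
    qed
    then show ?thesis by (simp add: f_def ou_D_zero algebra_simps)
  qed
  define L where "L = 2 * q * a * p"
  have L0: "0 \<le> L" using q(1) a(1) p(1) by (simp add: L_def)
  have disp: "norm (ou_D Q B s *v x - x) * norm x \<le> L * (ou_R Q B (ou_D Q B s *v x) - ou_R Q B x)" if s: "0 \<le> s" for s x
  proof (cases "ou_D Q B s *v x - x = 0")
    case True
    then show ?thesis using ou_R_orbit_mono[OF s, of x] L0 by simp
  next
    case False
    \<comment> \<open>The final displacement serves as a fixed test vector: a scalar derivative then
      suffices, and one factor |e| is cancelled at the end.\<close>
    define e where "e = ou_D Q B s *v x - x"
    define f where "f r = (L * norm e) * ou_R Q B (ou_D Q B r *v x) - norm x * (e \<bullet> (ou_D Q B r *v x))" for r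
    have "f 0 \<le> f s"
    proof (rule nonneg_derivative_imp_le[OF s])
      fix r :: real assume r: "0 \<le> r"
      let ?z = "dual_orbit x r"
      show "(f has_real_derivative (L * norm e) * (1 / 2 * ((Q *v ?z) \<bullet> ?z))
          - norm x * - (e \<bullet> (S *v (transpose B *v ?z)))) (at r)"
        unfolding f_def
        by (intro DERIV_diff DERIV_cmult inner_deriv ou_R_deriv)
      have "norm x * - (e \<bullet> (S *v (transpose B *v ?z))) \<le> (p * norm ?z) * (norm e * (a * norm ?z))"
        using p(2)[OF r] sp[of e ?z] p(1)
        by (intro order_trans[OF mult_left_mono mult_right_mono]) (auto simp: a(1) less_imp_le)
      also have "\<dots> = (p * a * norm e) * (norm ?z)\<^sup>2" by (simp add: power2_eq_square)
      also have "\<dots> \<le> (p * a * norm e) * (q * ((Q *v ?z) \<bullet> ?z))"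
        using p(1) a(1) by (intro mult_left_mono q) auto
      finally show "0 \<le> (L * norm e) * (1 / 2 * ((Q *v ?z) \<bullet> ?z)) - norm x * - (e \<bullet> (S *v (transpose B *v ?z)))"
        by (simp add: L_def mult_ac)
    qed
    then have "norm x * (e \<bullet> (ou_D Q B s *v x) - e \<bullet> x)
        \<le> (L * norm e) * (ou_R Q B (ou_D Q B s *v x) - ou_R Q B x)"
      by (simp add: f_def ou_D_zero algebra_simps)
    also have "e \<bullet> (ou_D Q B s *v x) - e \<bullet> x = norm e * norm e"
      unfolding inner_diff_right[symmetric] e_def[symmetric] by (simp add: power2_norm_eq_inner[symmetric] power2_eq_square)
    finally have "(norm e * norm x) * norm e \<le> (L * (ou_R Q B (ou_D Q B s *v x) - ou_R Q B x)) * norm e"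
      by (simp add: mult_ac)
    moreover have "0 < norm e" using False by (simp add: e_def)
    ultimately show ?thesis unfolding e_def by (rule mult_right_le_imp_le)
  qed
  define H where "H = a * b * d"
  have near: "norm (ou_D Q B s *v x - x) \<le> H * s * norm x" if s: "0 \<le> s" "s \<le> 1" for s x
  proof (cases "ou_D Q B s *v x - x = 0")
    case True
    then show ?thesis using s a(1) b(1) d(1) by (simp add: H_def)
  next
    case False
    define e where "e = ou_D Q B s *v x - x"
    define f where "f r = (H * norm x * norm e) * r - e \<bullet> (ou_D Q B r *v x)" for r
    have "f 0 \<le> f s"
    proof (rule nonneg_derivative_imp_le[OF s(1)])
      fix r :: real assume r: "0 \<le> r" "r \<le> s"
      let ?z = "dual_orbit x r"
      show "(f has_real_derivative (H * norm x * norm e) * 1 - - (e \<bullet> (S *v (transpose B *v ?z)))) (at r)"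
        unfolding f_def by (intro DERIV_diff DERIV_cmult DERIV_ident inner_deriv)
      have "norm ?z \<le> b * norm (matrix_inv S *v x)"
        unfolding dual_orbit_def using r s by (intro b) auto
      also have "\<dots> \<le> b * (d * norm x)" using b(1) by (intro mult_left_mono d) auto
      finally have z: "norm ?z \<le> b * (d * norm x)" .
      have "- (e \<bullet> (S *v (transpose B *v ?z))) \<le> norm e * (a * norm ?z)" using sp[of e ?z] by linarith
      also have "\<dots> \<le> norm e * (a * (b * (d * norm x)))"
        using a(1) z by (intro mult_left_mono) auto
      finally show "0 \<le> (H * norm x * norm e) * 1 - - (e \<bullet> (S *v (transpose B *v ?z)))"
        by (simp add: H_def mult_ac)
    qed
    then have "e \<bullet> (ou_D Q B s *v x) - e \<bullet> x \<le> (H * norm x * norm e) * s"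
      by (simp add: f_def ou_D_zero)
    also have "e \<bullet> (ou_D Q B s *v x) - e \<bullet> x = norm e * norm e"
      unfolding inner_diff_right[symmetric] e_def[symmetric] by (simp add: power2_norm_eq_inner[symmetric] power2_eq_square)
    finally have "norm e * norm e \<le> (H * s * norm x) * norm e" by (simp add: mult_ac)
    moreover have "0 < norm e" using False by (simp add: e_def)
    ultimately show ?thesis unfolding e_def by (rule mult_right_le_imp_le)
  qed
  define k where "k = max 1 (max (2 * q * p\<^sup>2) (max L H))"
  show ?thesis
  proof
    show "1 \<le> k" by (simp add: k_def)
    fix s :: real and x :: "real^'n" assume s: "0 \<le> s"
    have R: "0 \<le> ou_R Q B (ou_D Q B s *v x) - ou_R Q B x" using ou_R_orbit_mono[OF s, of x] by simp
    show "s * (norm x)\<^sup>2 \<le> k * (ou_R Q B (ou_D Q B s *v x) - ou_R Q B x)"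
      by (rule order_trans[OF growth[OF s]]) (intro mult_right_mono R, simp add: k_def)
    show "norm (ou_D Q B s *v x - x) * norm x \<le> k * (ou_R Q B (ou_D Q B s *v x) - ou_R Q B x)"
      by (rule order_trans[OF disp[OF s]]) (intro mult_right_mono R, simp add: k_def)
    assume s1: "s \<le> 1"
    show "norm (ou_D Q B s *v x - x) \<le> k * s * norm x"
      using s by (intro order_trans[OF near[OF s s1]] mult_right_mono) (auto simp: k_def)
  qed
qed

lemma ex_expanding_flow: "\<exists>K. expanding_flow (ou_R Q B) (\<lambda>t. (*v) (ou_D Q B t)) K"
proof -
  obtain k where k: "1 \<le> k" "\<And>x. (norm x)\<^sup>2 \<le> k * ou_R Q B x" "\<And>x. ou_R Q B x \<le> k * (norm x)\<^sup>2"
    "\<And>x y. ou_R Q B y - ou_R Q B x \<le> k * norm y * norm (y - x)"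
    by (rule ou_R_bounds) (rule that)
  obtain h where h: "1 \<le> h"
    "\<And>s x. 0 \<le> s \<Longrightarrow> s * (norm x)\<^sup>2 \<le> h * (ou_R Q B (ou_D Q B s *v x) - ou_R Q B x)"
    "\<And>s x. 0 \<le> s \<Longrightarrow> norm (ou_D Q B s *v x - x) * norm x \<le> h * (ou_R Q B (ou_D Q B s *v x) - ou_R Q B x)"
    "\<And>s x. 0 \<le> s \<Longrightarrow> s \<le> 1 \<Longrightarrow> norm (ou_D Q B s *v x - x) \<le> h * s * norm x"
    by (rule orbit_bounds) (rule that)
  have R0: "0 \<le> ou_R Q B x" for x
  proof -
    have "0 \<le> k * ou_R Q B x" using k(2)[of x] zero_le_power2[of "norm x"] by linarith
    then show ?thesis using k(1) by (simp add: zero_le_mult_iff)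
  qed
  let ?K = "max k h"
  have "expanding_flow (ou_R Q B) (\<lambda>t. (*v) (ou_D Q B t)) ?K"
  proof
    show "1 \<le> ?K" using k(1) by simp
    show "continuous_on UNIV (ou_R Q B)"
      unfolding ou_R_eq[abs_def] by (intro continuous_intros)
    show "continuous_on UNIV ((*v) (ou_D Q B t))" for t
      by (rule linear_continuous_on[OF matrix_vector_mul_bounded_linear])
    show "ou_D Q B s *v (ou_D Q B t *v x) = ou_D Q B (s + t) *v x" for s t x by (rule ou_D_add)
    show "ou_D Q B 0 *v x = x" for x by (rule ou_D_zero)
    fix x y
    show "(norm x)\<^sup>2 \<le> ?K * ou_R Q B x"
      by (rule order_trans[OF k(2)]) (intro mult_right_mono R0, simp)
    show "ou_R Q B x \<le> ?K * (norm x)\<^sup>2"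
      by (rule order_trans[OF k(3)]) (intro mult_right_mono, auto)
    show "ou_R Q B y - ou_R Q B x \<le> ?K * norm y * norm (y - x)"
      by (rule order_trans[OF k(4)]) (intro mult_right_mono, auto)
  next
    fix s :: real and x assume s: "0 \<le> s"
    have R: "0 \<le> ou_R Q B (ou_D Q B s *v x) - ou_R Q B x" using ou_R_orbit_mono[OF s, of x] by simp
    show "norm (ou_D Q B s *v x - x) * norm x \<le> ?K * (ou_R Q B (ou_D Q B s *v x) - ou_R Q B x)"
      by (rule order_trans[OF h(3)[OF s]]) (intro mult_right_mono R, simp)
    show "s * (norm x)\<^sup>2 \<le> ?K * (ou_R Q B (ou_D Q B s *v x) - ou_R Q B x)"
      by (rule order_trans[OF h(2)[OF s]]) (intro mult_right_mono R, simp)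
    assume s1: "s \<le> 1"
    show "norm (ou_D Q B s *v x - x) \<le> ?K * s * norm x"
      using s by (intro order_trans[OF h(4)[OF s s1]] mult_right_mono) auto
  qed
  then show ?thesis by blast
qed

text \<open>In terms of \<open>w = D\<^sub>-\<^sub>t u - x\<close> the exponent of the kernel splits into a part that is good
  for large \<open>t\<close> and a part that is good for small \<open>t\<close>.\<close>
lemma mehler_exponent:
  assumes t: "0 < t" and w: "w = ou_D Q B (- t) *v u - x"
  shows "((matrix_inv (T t) - matrix_inv S) *v (u - ou_D Q B t *v x)) \<bullet> (u - ou_D Q B t *v x)
    = (matrix_inv S *v w) \<bullet> w + (matrix_inv (T t) *v (M t *v w)) \<bullet> (M t *v w)"
proof -
  define y where "y = u - ou_D Q B t *v x"
  define z where "z = dual_orbit w t"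
  let ?b = "M t *v w"
  have Nz: "N t *v z = matrix_inv S *v w"
    by (simp add: z_def dual_orbit_def matrix_vector_mul_assoc matrix_mul_assoc N_minus)
  have "ou_D Q B t *v w = u - ou_D Q B t *v x"
    by (simp add: w matrix_vector_mult_diff_distrib ou_D_add ou_D_zero)
  then have y: "y = S *v z" by (simp add: y_def z_def ou_D_eq)
  have "M t *v (S *v (N t *v z)) = ?b"
    unfolding Nz by (simp add: matrix_vector_mul_assoc S_inverse)
  \<comment> \<open>By \<open>T_decomp\<close>, T t differs from S by M t S N t, which sends z to M
    t w. Hence the inverse of T t maps y to z plus a correction, and this z cancels against the
    inverse of S applied to y.\<close>
  then have Tz: "T t *v z = y - ?b"
    using t by (simp add: T_decomp y matrix_vector_mult_diff_rdistrib matrix_vector_mul_assoc matrix_mul_assoc)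
  then have "matrix_inv (T t) *v (y - ?b) = z"
    using T_inverse[OF t] by (simp flip: Tz add: matrix_vector_mul_assoc)
  then have 1: "matrix_inv (T t) *v y = z + matrix_inv (T t) *v ?b"
    by (simp add: matrix_vector_mult_diff_distrib algebra_simps)
  have 2: "matrix_inv S *v y = z" by (simp add: y matrix_vector_mul_assoc S_inverse)
  have "(matrix_inv (T t) *v ?b) \<bullet> (T t *v z) = (T t *v (matrix_inv (T t) *v ?b)) \<bullet> z"
    using t by (simp add: inner_matrix_vector[of "T t"] transpose_T)
  also have "\<dots> = ?b \<bullet> z" using T_inverse[OF t] by (simp add: matrix_vector_mul_assoc matrix_mul_assoc)
  also have "\<dots> = w \<bullet> (matrix_inv S *v w)"
    by (simp only: inner_matrix_vector transpose_M Nz)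
  finally have 3: "(matrix_inv (T t) *v ?b) \<bullet> (T t *v z) = w \<bullet> (matrix_inv S *v w)" .
  have "((matrix_inv (T t) - matrix_inv S) *v y) \<bullet> y = (matrix_inv (T t) *v ?b) \<bullet> (T t *v z + ?b)"
    by (simp add: matrix_vector_mult_diff_rdistrib 1 2 Tz)
  then show ?thesis
    using 3 by (simp add: y_def inner_add_right inner_commute)
qed

text \<open>For t \<le> 1 the second term is at least |M t w|^2 / (C t), and M t w is comparable
  with w. For t > 1 the first term alone suffices, since then \<open>min t 1\<close> is 1.\<close>

lemma mehler_exponent_bound:
  obtains c where "0 < c" "\<And>t w. 0 < t \<Longrightarrow>
    c * (norm w)\<^sup>2 / min t 1 \<le> (matrix_inv S *v w) \<bullet> w + (matrix_inv (T t) *v (M t *v w)) \<bullet> (M t *v w)"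
proof -
  obtain k where k: "1 \<le> k" "\<And>x. (norm x)\<^sup>2 \<le> k * ou_R Q B x" "\<And>x. ou_R Q B x \<le> k * (norm x)\<^sup>2"
    "\<And>x y. ou_R Q B y - ou_R Q B x \<le> k * norm y * norm (y - x)"
    by (rule ou_R_bounds) (rule that)
  obtain l C where l: "0 < l" "0 < C"
    "\<And>t y. 0 \<le> t \<Longrightarrow> l * min t 1 * (norm y)\<^sup>2 \<le> (T t *v y) \<bullet> y"
    "\<And>t y. 0 \<le> t \<Longrightarrow> t \<le> 1 \<Longrightarrow> (T t *v y) \<bullet> y \<le> C * t * (norm y)\<^sup>2"
    by (rule T_form_bounds) (rule that)
  obtain b where b: "1 \<le> b" "\<And>s x. \<bar>s\<bar> \<le> 1 \<Longrightarrow> norm (M s *v x) \<le> b * norm x"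
    by (rule matrix_exp_local_bound[of B, folded M_def]) (rule that)
  define c where "c = min (2 / k) (1 / (C * b\<^sup>2))"
  have Cb: "0 < C * b\<^sup>2" using l b by simp
  show ?thesis
  proof
    show "0 < c" using k(1) Cb by (simp add: c_def)
    fix t :: real and w assume t: "0 < t"
    let ?b = "M t *v w" and ?y = "matrix_inv (T t) *v (M t *v w)"
    have Ty: "T t *v ?y = ?b" using T_inverse[OF t] by (simp add: matrix_vector_mul_assoc matrix_mul_assoc)
    have Tnn: "0 \<le> (T t *v y) \<bullet> y" for y
      using order_trans[OF _ l(3)[of t y], of 0] l(1) t by simp
    have S: "(2 / k) * (norm w)\<^sup>2 \<le> (matrix_inv S *v w) \<bullet> w"
      using k(2)[of w] k(1) by (simp add: ou_R_eq field_simps)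
    then have S0: "0 \<le> (matrix_inv S *v w) \<bullet> w"
      using k(1) order_trans[OF _ S, of 0] by simp
    show "c * (norm w)\<^sup>2 / min t 1 \<le> (matrix_inv S *v w) \<bullet> w + ?y \<bullet> ?b"
    proof (cases "t \<le> 1")
      case True
      have "w = M (- t) *v ?b" by (simp add: matrix_vector_mul_assoc M_minus)
      then have "norm w \<le> b * norm ?b" using b(2)[of "- t" ?b] True t by simp
      then have "(norm w)\<^sup>2 \<le> (b * norm ?b)\<^sup>2" by (intro power_mono) auto
      also have "\<dots> = b\<^sup>2 * (norm ?b)\<^sup>2" by (simp add: power_mult_distrib)
      finally have w: "(norm w)\<^sup>2 \<le> b\<^sup>2 * (norm ?b)\<^sup>2" .
      have "c * (norm w)\<^sup>2 \<le> (1 / (C * b\<^sup>2)) * (b\<^sup>2 * (norm ?b)\<^sup>2)"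
        using Cb w by (intro mult_mono) (auto simp: c_def)
      also have "\<dots> = (norm ?b)\<^sup>2 / C" using b(1) by simp
      finally have "c * (norm w)\<^sup>2 / t \<le> (norm ?b)\<^sup>2 / C / t"
        using t by (intro divide_right_mono) auto
      also have "\<dots> = (norm (T t *v ?y))\<^sup>2 / (C * t)" by (simp add: Ty)
      also have "\<dots> \<le> ?y \<bullet> (T t *v ?y)"
        using t True l(2) by (intro inverse_form_lower_bound Tnn l(4) transpose_T) auto
      finally show ?thesis using S0 True by (simp add: Ty min_def)
    next
      case False
      have "c * (norm w)\<^sup>2 \<le> (2 / k) * (norm w)\<^sup>2" by (intro mult_right_mono) (auto simp: c_def)
      moreover have "0 \<le> ?y \<bullet> ?b" using Tnn[of ?y] by (simp add: Ty inner_commute)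
      ultimately show ?thesis using S False by (simp add: min_def)
    qed
  qed
qed

lemma det_T_lower_bound:
  obtains C where "0 \<le> C" "\<And>t. 0 < t \<Longrightarrow> \<bar>sqrt (det S / det (T t))\<bar> \<le> C / sqrt (min t 1) ^ CARD('n)"
proof -
  let ?n = "CARD('n)"
  obtain l C where l: "0 < l" "0 < C"
    "\<And>t y. 0 \<le> t \<Longrightarrow> l * min t 1 * (norm y)\<^sup>2 \<le> (T t *v y) \<bullet> y"
    "\<And>t y. 0 \<le> t \<Longrightarrow> t \<le> 1 \<Longrightarrow> (T t *v y) \<bullet> y \<le> C * t * (norm y)\<^sup>2"
    by (rule T_form_bounds) (rule that)
  define D where "D = \<bar>det S\<bar> * fact ?n / l ^ ?n"
  have D0: "0 \<le> D" using l(1) by (simp add: D_def)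
  \<comment> \<open>The real \<open>sqrt\<close> is odd, so absolute values can be estimated without
    the signs of the determinants.\<close>
  have sqrt_abs: "\<bar>sqrt r\<bar> = sqrt \<bar>r\<bar>" for r
    by (cases "0 \<le> r") (simp_all add: real_sqrt_minus[symmetric])
  have "\<bar>sqrt (det S / det (T t))\<bar> \<le> sqrt D / sqrt (min t 1) ^ ?n" if t: "0 < t" for t
  proof -
    define m where "m = min t 1"
    have m: "0 < m" using t by (simp add: m_def)
    have "0 < l * m" using l m by simp
    moreover have "l * m * norm y \<le> norm (T t *v y)" for y
      using l(3)[of t] t unfolding m_def by (intro norm_lower_bound_of_form) auto
    ultimately have dT: "(l * m) ^ ?n \<le> fact ?n * \<bar>det (T t)\<bar>"
      by (rule matrix_inv_of_lower_bound(3))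
    have lm: "0 < (l * m) ^ ?n" using l m by simp
    then have T0: "0 < \<bar>det (T t)\<bar>" using dT by (cases "det (T t) = 0") auto
    have "\<bar>det S\<bar> * (l * m) ^ ?n \<le> \<bar>det S\<bar> * (fact ?n * \<bar>det (T t)\<bar>)"
      by (intro mult_left_mono dT) auto
    then have "\<bar>det S\<bar> / \<bar>det (T t)\<bar> \<le> \<bar>det S\<bar> * fact ?n / (l * m) ^ ?n"
      using T0 lm by (simp add: pos_divide_le_eq pos_le_divide_eq mult_ac)
    also have "\<dots> = D / m ^ ?n" by (simp add: D_def power_mult_distrib)
    finally have "sqrt (\<bar>det S\<bar> / \<bar>det (T t)\<bar>) \<le> sqrt (D / m ^ ?n)"
      by (rule real_sqrt_le_mono)
    then show ?thesis by (simp add: sqrt_abs abs_divide real_sqrt_divide real_sqrt_power m_def)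
  qed
  moreover have "0 \<le> sqrt D" using D0 by simp
  ultimately show ?thesis using that[of "sqrt D"] by simp
qed

lemma mehler_kernel_bound:
  obtains C c where "0 < C" "0 < c" "\<And>t x u. 0 < t \<Longrightarrow> \<bar>mehler_kernel Q B t x u\<bar>
    \<le> C * (exp (ou_R Q B x) / sqrt (min t 1) ^ CARD('n)
        * exp (- c * (norm (ou_D Q B (- t) *v u - x) / sqrt (min t 1))\<^sup>2))"
proof -
  obtain C where C: "0 \<le> C" "\<And>t. 0 < t \<Longrightarrow> \<bar>sqrt (det S / det (T t))\<bar> \<le> C / sqrt (min t 1) ^ CARD('n)"
    by (rule det_T_lower_bound) (rule that)
  obtain c where c: "0 < c" "\<And>t w. 0 < t \<Longrightarrow>
    c * (norm w)\<^sup>2 / min t 1 \<le> (matrix_inv S *v w) \<bullet> w + (matrix_inv (T t) *v (M t *v w)) \<bullet> (M t *v w)"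
    by (rule mehler_exponent_bound) (rule that)
  show ?thesis
  proof
    \<comment> \<open>The 1 is added to make the constant positive, as the level is later divided by
      it; the half comes from the factor 1/2 in the kernel exponent.\<close>
    show "0 < C + 1" "0 < c / 2" using C(1) c(1) by auto
    fix t :: real and x u :: "real^'n" assume t: "0 < t"
    define w where "w = ou_D Q B (- t) *v u - x"
    define F where "F = ((matrix_inv (T t) - matrix_inv S) *v (u - ou_D Q B t *v x)) \<bullet> (u - ou_D Q B t *v x)"
    have "c * (norm w)\<^sup>2 / min t 1 \<le> F"
      unfolding F_def mehler_exponent[OF t w_def] by (rule c(2)[OF t])
    moreover have "(norm w / sqrt (min t 1))\<^sup>2 = (norm w)\<^sup>2 / min t 1"
      using t by (simp add: power_divide)
    ultimately have F: "exp (- 1 / 2 * F) \<le> exp (- (c / 2) * (norm w / sqrt (min t 1))\<^sup>2)"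
      by simp
    have s: "0 < sqrt (min t 1) ^ CARD('n)" using t by simp
    have "C / sqrt (min t 1) ^ CARD('n) \<le> (C + 1) / sqrt (min t 1) ^ CARD('n)"
      using s by (intro divide_right_mono) auto
    with C(2)[OF t] have d: "\<bar>sqrt (det S / det (T t))\<bar> \<le> (C + 1) / sqrt (min t 1) ^ CARD('n)" by linarith
    have "\<bar>mehler_kernel Q B t x u\<bar> = \<bar>sqrt (det S / det (T t))\<bar> * exp (ou_R Q B x) * exp (- 1 / 2 * F)"
      unfolding mehler_kernel_def S_def[symmetric] T_def[symmetric] F_def[symmetric] by (simp only: abs_mult abs_exp_cancel)
    also have "\<dots> \<le> (C + 1) / sqrt (min t 1) ^ CARD('n) * exp (ou_R Q B x)
        * exp (- (c / 2) * (norm w / sqrt (min t 1))\<^sup>2)"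
      using d F C(1) s by (intro mult_mono) auto
    finally show "\<bar>mehler_kernel Q B t x u\<bar> \<le> (C + 1) * (exp (ou_R Q B x) / sqrt (min t 1) ^ CARD('n)
        * exp (- (c / 2) * (norm (ou_D Q B (- t) *v u - x) / sqrt (min t 1))\<^sup>2))"
      by (simp add: w_def)
  qed
qed


section \<open>Measurability of level sets and the weak type bound\<close>

lemma ou_R_continuous: "continuous_on X (ou_R Q B)"
  unfolding ou_R_eq[abs_def] by (intro continuous_intros)

lemma mehler_kernel_continuous:
  "continuous_on UNIV (\<lambda>u. mehler_kernel Q B t x u)" "continuous_on UNIV (\<lambda>x. mehler_kernel Q B t x u)"
proof -
  have D: "continuous_on UNIV (\<lambda>x. A *v g x)" if "continuous_on UNIV g"
    for A :: "real^'n^'n" and g :: "real^'n \<Rightarrow> real^'n"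
    using bounded_linear.continuous_on[OF matrix_vector_mul_bounded_linear that] .
  show "continuous_on UNIV (\<lambda>u. mehler_kernel Q B t x u)" "continuous_on UNIV (\<lambda>x. mehler_kernel Q B t x u)"
    unfolding mehler_kernel_def by (intro continuous_intros ou_R_continuous D)+
qed

lemma ou_gauss_eq:
  "ou_gauss Q B \<infinity> = density lborel (\<lambda>y. ennreal
    ((2 * pi) powr (- real CARD('n) / 2) * det S powr (- 1 / 2) * exp (- ou_R Q B y)))"
  unfolding ou_gauss_def S_def[symmetric] ou_R_eq by simp

lemma sets_ou_gauss: "sets (ou_gauss Q B \<infinity>) = sets borel"
  by (simp add: ou_gauss_def)

text \<open>The kernel is bounded in \<open>u\<close> by a multiple of exp(R x), and R is bounded
  along a convergent sequence, so a multiple of |f| dominates the integrands.\<close>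

lemma ou_semigroup_continuous:
  fixes f :: "real^'n \<Rightarrow> 'b::{banach, second_countable_topology}"
  assumes t: "0 < t" and f: "integrable (ou_gauss Q B \<infinity>) f"
  shows "continuous_on UNIV (ou_semigroup Q B t f)"
proof -
  obtain C c where C: "0 < C" "0 < c" "\<And>t x u. 0 < t \<Longrightarrow> \<bar>mehler_kernel Q B t x u\<bar>
    \<le> C * (exp (ou_R Q B x) / sqrt (min t 1) ^ CARD('n)
        * exp (- c * (norm (ou_D Q B (- t) *v u - x) / sqrt (min t 1))\<^sup>2))"
    by (rule mehler_kernel_bound) (rule that)
  define a where "a = sqrt (min t 1) ^ CARD('n)"
  have a: "0 < a" using t by (simp add: a_def)
  have bound: "\<bar>mehler_kernel Q B t x u\<bar> \<le> C * exp r / a" if "ou_R Q B x \<le> r" for x u r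
  proof -
    have "exp (ou_R Q B x) / a * exp (- c * (norm (ou_D Q B (- t) *v u - x) / sqrt (min t 1))\<^sup>2)
        \<le> exp r / a * 1"
      using that a C(2) by (intro mult_mono divide_right_mono) auto
    with mult_left_mono[OF this, of C] C(3)[OF t, of x u] C(1) show ?thesis
      by (simp add: a_def)
  qed
  have fm: "f \<in> borel_measurable (ou_gauss Q B \<infinity>)" using f by (rule borel_measurable_integrable)
  have Km: "(\<lambda>u. mehler_kernel Q B t x u) \<in> borel_measurable (ou_gauss Q B \<infinity>)" for x
    using borel_measurable_continuous_onI[OF mehler_kernel_continuous(1)]
    by (simp add: measurable_cong_sets[OF sets_ou_gauss refl])
  have "(\<lambda>k. ou_semigroup Q B t f (X k)) \<longlonglongrightarrow> ou_semigroup Q B t f x" if X: "X \<longlonglongrightarrow> x" for X x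
  proof -
    have "(\<lambda>k. ou_R Q B (X k)) \<longlonglongrightarrow> ou_R Q B x"
      using ou_R_continuous[of UNIV] X by (auto simp: continuous_on_sequentially o_def)
    then have "Bseq (\<lambda>k. ou_R Q B (X k))"
      by (intro convergent_imp_Bseq convergentI)
    then obtain r where r: "\<And>k. \<bar>ou_R Q B (X k)\<bar> \<le> r"
      by (auto simp: Bseq_def)
    show ?thesis
      unfolding ou_semigroup_def
    proof (rule integral_dominated_convergence[where w = "\<lambda>u. C * exp r / a * norm (f u)"])
      show "(\<lambda>u. mehler_kernel Q B t x u *\<^sub>R f u) \<in> borel_measurable (ou_gauss Q B \<infinity>)"
        "(\<lambda>u. mehler_kernel Q B t (X k) u *\<^sub>R f u) \<in> borel_measurable (ou_gauss Q B \<infinity>)" for k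
        by (intro borel_measurable_scaleR Km fm)+
      show "integrable (ou_gauss Q B \<infinity>) (\<lambda>u. C * exp r / a * norm (f u))"
        using f by simp
      show "AE u in ou_gauss Q B \<infinity>. (\<lambda>k. mehler_kernel Q B t (X k) u *\<^sub>R f u) \<longlonglongrightarrow> mehler_kernel Q B t x u *\<^sub>R f u"
      proof (intro AE_I2 tendsto_scaleR tendsto_const)
        fix u
        show "(\<lambda>k. mehler_kernel Q B t (X k) u) \<longlonglongrightarrow> mehler_kernel Q B t x u"
          using mehler_kernel_continuous(2)[of t u] X by (auto simp: continuous_on_sequentially o_def)
      qed
      show "AE u in ou_gauss Q B \<infinity>. norm (mehler_kernel Q B t (X k) u *\<^sub>R f u) \<le> C * exp r / a * norm (f u)" for k
      proof (intro AE_I2)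
        fix u
        have "ou_R Q B (X k) \<le> r" using r[of k] by simp
        from mult_right_mono[OF bound[OF this, of u], of "norm (f u)"]
        show "norm (mehler_kernel Q B t (X k) u *\<^sub>R f u) \<le> C * exp r / a * norm (f u)" by simp
      qed
    qed
  qed
  then show ?thesis
    by (auto simp: continuous_on_sequentially o_def)
qed

text \<open>The supremum runs over uncountably many times, so measurability is obtained from
  openness: the level set is a union of open sets.\<close>

lemma maximal_level_set_open:
  fixes f :: "real^'n \<Rightarrow> 'b::{banach, second_countable_topology}"
  assumes f: "integrable (ou_gauss Q B \<infinity>) f" and \<alpha>: "0 < \<alpha>"
  shows "{x. ennreal \<alpha> < ou_maximal Q B f x} = (\<Union>t\<in>{0<..}. {x. \<alpha> < norm (ou_semigroup Q B t f x)})"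
    "open {x. ennreal \<alpha> < ou_maximal Q B f x}"
proof -
  show eq: "{x. ennreal \<alpha> < ou_maximal Q B f x} = (\<Union>t\<in>{0<..}. {x. \<alpha> < norm (ou_semigroup Q B t f x)})"
    using \<alpha> by (auto simp: ou_maximal_def less_SUP_iff ennreal_less_iff)
  show "open {x. ennreal \<alpha> < ou_maximal Q B f x}"
    unfolding eq
    by (intro open_UN ballI open_Collect_less continuous_on_const continuous_on_norm ou_semigroup_continuous f) auto
qed

text \<open>The flow theorem is applied to the measure with density |f| relative to the invariant
  measure, whose total mass is the L^1 norm. Of the three factors of the constant, \<kappa>
  normalises the Gaussian, \<open>C0\<close> comes from the kernel bound and \<open>C1\<close> from
  the flow theorem.\<close>

lemma ou_maximal_weak_type:
  obtains C where "0 \<le> C" "\<And>(f :: real^'n \<Rightarrow> 'b::{banach, second_countable_topology}) \<alpha>.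
    0 < \<alpha> \<Longrightarrow> integrable (ou_gauss Q B \<infinity>) f \<Longrightarrow>
    emeasure (ou_gauss Q B \<infinity>) {x. ennreal \<alpha> < ou_maximal Q B f x}
      \<le> ennreal (C / \<alpha> * (\<integral>x. norm (f x) \<partial>ou_gauss Q B \<infinity>))"
proof -
  let ?\<gamma> = "ou_gauss Q B \<infinity>"
  obtain K where "expanding_flow (ou_R Q B) (\<lambda>t. (*v) (ou_D Q B t)) K"
    using ex_expanding_flow by blast
  then interpret flow: expanding_flow "ou_R Q B" "\<lambda>t. (*v) (ou_D Q B t)" K .
  obtain C0 c where C0: "0 < C0" "0 < c" "\<And>t x u. 0 < t \<Longrightarrow> \<bar>mehler_kernel Q B t x u\<bar>
    \<le> C0 * (exp (ou_R Q B x) / sqrt (min t 1) ^ CARD('n)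
        * exp (- c * (norm (ou_D Q B (- t) *v u - x) / sqrt (min t 1))\<^sup>2))"
    by (rule mehler_kernel_bound) (rule that)
  have kernel: "\<bar>mehler_kernel Q B t x u\<bar> \<le> C0 * flow.flow_kernel c t x u" if "0 < t" for t x u
    using C0(3)[OF that, of x u] by (simp add: flow.flow_kernel_def flow.scale_def)
  obtain C1 where C1: "0 \<le> C1" "\<And>\<mu> \<alpha>. finite_measure \<mu> \<Longrightarrow> sets \<mu> = sets borel \<Longrightarrow> 0 < \<alpha> \<Longrightarrow>
      \<exists>W\<in>sets borel. {x. \<exists>t>0. ennreal \<alpha> < (\<integral>\<^sup>+u. ennreal (flow.flow_kernel c t x u) \<partial>\<mu>)} \<subseteq> W \<and>
        emeasure flow.gauss W \<le> ennreal (C1 / \<alpha>) * emeasure \<mu> (space \<mu>)"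
    by (rule flow.flow_maximal_weak_type[OF C0(2)]) (rule that)
  define \<kappa> where "\<kappa> = (2 * pi) powr (- real CARD('n) / 2) * det S powr (- 1 / 2)"
  have \<kappa>: "0 \<le> \<kappa>" by (simp add: \<kappa>_def)
  have \<gamma>: "emeasure ?\<gamma> W = ennreal \<kappa> * emeasure flow.gauss W" if W: "W \<in> sets borel" for W
  proof -
    have [measurable]: "ou_R Q B \<in> borel_measurable borel" by (rule flow.R_measurable)
    have "emeasure ?\<gamma> W = (\<integral>\<^sup>+x. ennreal (\<kappa> * exp (- ou_R Q B x)) * indicator W x \<partial>lborel)"
      unfolding ou_gauss_eq \<kappa>_def[symmetric] using W by (intro emeasure_density) auto
    also have "\<dots> = (\<integral>\<^sup>+x. ennreal \<kappa> * (ennreal (exp (- ou_R Q B x)) * indicator W x) \<partial>lborel)"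
      using \<kappa> by (simp add: ennreal_mult' mult.assoc)
    also have "\<dots> = ennreal \<kappa> * (\<integral>\<^sup>+x. ennreal (exp (- ou_R Q B x)) * indicator W x \<partial>lborel)"
      using W by (intro nn_integral_cmult) auto
    also have "(\<integral>\<^sup>+x. ennreal (exp (- ou_R Q B x)) * indicator W x \<partial>lborel) = emeasure flow.gauss W"
      unfolding flow.gauss_def using W by (intro emeasure_density[symmetric]) auto
    finally show ?thesis .
  qed
  show ?thesis
  proof
    show "0 \<le> \<kappa> * (C1 * C0)" using \<kappa> C1(1) C0(1) by simp
    fix f :: "real^'n \<Rightarrow> 'b" and \<alpha> :: real
    assume \<alpha>: "0 < \<alpha>" and f: "integrable ?\<gamma> f"
    have fm [measurable]: "f \<in> borel_measurable ?\<gamma>" using f by (rule borel_measurable_integrable)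
    define \<mu> where "\<mu> = density ?\<gamma> (\<lambda>u. ennreal (norm (f u)))"
    define I where "I = (\<integral>x. norm (f x) \<partial>?\<gamma>)"
    have I: "0 \<le> I" by (simp add: I_def)
    have sets: "sets \<mu> = sets borel" by (simp add: \<mu>_def sets_ou_gauss)
    have mass: "emeasure \<mu> (space \<mu>) = ennreal I"
    proof -
      have "emeasure \<mu> (space \<mu>) = (\<integral>\<^sup>+u. ennreal (norm (f u)) * indicator (space ?\<gamma>) u \<partial>?\<gamma>)"
        unfolding \<mu>_def space_density by (intro emeasure_density) auto
      also have "\<dots> = (\<integral>\<^sup>+u. ennreal (norm (f u)) \<partial>?\<gamma>)"
        by (intro nn_integral_cong) simp
      also have "\<dots> = ennreal I"
        unfolding I_def using f by (intro nn_integral_eq_integral) auto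
      finally show ?thesis .
    qed
    then have fin: "finite_measure \<mu>"
      by (intro finite_measureI) simp
    have "0 < \<alpha> / C0" using \<alpha> C0(1) by simp
    from C1(2)[OF fin sets this] obtain W where W: "W \<in> sets borel"
      "{x. \<exists>t>0. ennreal (\<alpha> / C0) < (\<integral>\<^sup>+u. ennreal (flow.flow_kernel c t x u) \<partial>\<mu>)} \<subseteq> W"
      "emeasure flow.gauss W \<le> ennreal (C1 / (\<alpha> / C0)) * emeasure \<mu> (space \<mu>)"
      by auto
    have bound: "ennreal (norm (ou_semigroup Q B t f x))
        \<le> ennreal C0 * (\<integral>\<^sup>+u. ennreal (flow.flow_kernel c t x u) \<partial>\<mu>)" if t: "0 < t" for t x
    proof (cases "integrable ?\<gamma> (\<lambda>u. mehler_kernel Q B t x u *\<^sub>R f u)")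
      \<comment> \<open>A Bochner integral that does not exist has the value 0, so the bound is
        trivial.\<close>
      case False
      then show ?thesis by (simp add: ou_semigroup_def not_integrable_integral_eq)
    next
      case True
      have "continuous_on UNIV (\<lambda>u. flow.flow_kernel c t x u)"
        unfolding flow.flow_kernel_def
        by (intro continuous_intros flow.D_continuous) (use flow.scale_pos[OF t] in auto)
      then have Fm [measurable]: "(\<lambda>u. flow.flow_kernel c t x u) \<in> borel_measurable ?\<gamma>"
        using borel_measurable_continuous_onI by (simp add: measurable_cong_sets[OF sets_ou_gauss refl])
      have F0: "0 \<le> flow.flow_kernel c t x u" for u
        using flow.scale_pos[OF t] by (simp add: flow.flow_kernel_def)
      have "ennreal (norm (ou_semigroup Q B t f x)) \<le> (\<integral>\<^sup>+u. ennreal (norm (mehler_kernel Q B t x u *\<^sub>R f u)) \<partial>?\<gamma>)"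
        unfolding ou_semigroup_def by (rule integral_norm_bound_ennreal[OF True])
      also have "\<dots> \<le> (\<integral>\<^sup>+u. ennreal C0 * (ennreal (norm (f u)) * ennreal (flow.flow_kernel c t x u)) \<partial>?\<gamma>)"
      proof (intro nn_integral_mono)
        fix u
        have "norm (mehler_kernel Q B t x u *\<^sub>R f u) \<le> C0 * flow.flow_kernel c t x u * norm (f u)"
          using kernel[OF t, of x u] by (simp add: mult_right_mono)
        then have "ennreal (norm (mehler_kernel Q B t x u *\<^sub>R f u)) \<le> ennreal (C0 * flow.flow_kernel c t x u * norm (f u))"
          by (rule ennreal_leI)
        also have "\<dots> = ennreal C0 * (ennreal (norm (f u)) * ennreal (flow.flow_kernel c t x u))"
          using C0(1) F0[of u] by (simp add: ennreal_mult mult_ac)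
        finally show "ennreal (norm (mehler_kernel Q B t x u *\<^sub>R f u))
            \<le> ennreal C0 * (ennreal (norm (f u)) * ennreal (flow.flow_kernel c t x u))" .
      qed
      also have "\<dots> = ennreal C0 * (\<integral>\<^sup>+u. ennreal (norm (f u)) * ennreal (flow.flow_kernel c t x u) \<partial>?\<gamma>)"
        by (intro nn_integral_cmult) measurable
      also have "(\<integral>\<^sup>+u. ennreal (norm (f u)) * ennreal (flow.flow_kernel c t x u) \<partial>?\<gamma>)
          = (\<integral>\<^sup>+u. ennreal (flow.flow_kernel c t x u) \<partial>\<mu>)"
        unfolding \<mu>_def by (intro nn_integral_density[symmetric]) measurable
      finally show ?thesis .
    qed
    have "{x. ennreal \<alpha> < ou_maximal Q B f x} \<subseteq> W"
    proof
      fix x assume "x \<in> {x. ennreal \<alpha> < ou_maximal Q B f x}"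
      then obtain t where t: "0 < t" "\<alpha> < norm (ou_semigroup Q B t f x)"
        unfolding maximal_level_set_open(1)[OF f \<alpha>] by auto
      have "ennreal C0 * ennreal (\<alpha> / C0) = ennreal \<alpha>"
        using C0(1) \<alpha> by (simp add: ennreal_mult[symmetric])
      also have "\<dots> < ennreal (norm (ou_semigroup Q B t f x))"
        using t(2) \<alpha> by (simp add: ennreal_less_iff)
      also have "\<dots> \<le> ennreal C0 * (\<integral>\<^sup>+u. ennreal (flow.flow_kernel c t x u) \<partial>\<mu>)"
        by (rule bound[OF t(1)])
      finally have "ennreal (\<alpha> / C0) < (\<integral>\<^sup>+u. ennreal (flow.flow_kernel c t x u) \<partial>\<mu>)"
        by (meson linorder_not_less mult_left_mono zero_le)
      with W(2) t(1) show "x \<in> W" by blast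
    qed
    then have "emeasure ?\<gamma> {x. ennreal \<alpha> < ou_maximal Q B f x} \<le> emeasure ?\<gamma> W"
      using W(1) by (intro emeasure_mono) (auto simp: sets_ou_gauss)
    also have "\<dots> \<le> ennreal \<kappa> * (ennreal (C1 / (\<alpha> / C0)) * ennreal I)"
      unfolding \<gamma>[OF W(1)] mass[symmetric] by (intro mult_left_mono W(3)) auto
    also have "\<dots> = ennreal (\<kappa> * (C1 * C0) / \<alpha> * I)"
      using \<kappa> C1(1) C0(1) \<alpha> I by (simp add: ennreal_mult[symmetric] mult_ac)
    finally show "emeasure ?\<gamma> {x. ennreal \<alpha> < ou_maximal Q B f x}
        \<le> ennreal (\<kappa> * (C1 * C0) / \<alpha> * (\<integral>x. norm (f x) \<partial>?\<gamma>))"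
      by (simp add: I_def)
  qed
qed

end

theorem theorem1p1:
  fixes Q B :: "real^'n^'n"
  assumes "symmetric_matrix Q" and "positive_definite Q"
    and "\<And>z. complex_eigenvalue B z \<Longrightarrow> Re z < 0"
  shows "\<exists>C::real. \<forall>f :: real^'n \<Rightarrow> complex. \<forall>\<alpha>>0. integrable (ou_gauss Q B \<infinity>) f \<longrightarrow>
    {x. ou_maximal Q B f x > ennreal \<alpha>} \<in> sets (ou_gauss Q B \<infinity>) \<and>
    emeasure (ou_gauss Q B \<infinity>) {x. ou_maximal Q B f x > ennreal \<alpha>}
      \<le> ennreal (C / \<alpha> * (\<integral>x. norm (f x) \<partial>ou_gauss Q B \<infinity>))"
proof -
  interpret ornstein_uhlenbeck Q B
    using assms by unfold_locales
  obtain C where "0 \<le> C" and C: "\<And>(f :: real^'n \<Rightarrow> complex) \<alpha>.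
    0 < \<alpha> \<Longrightarrow> integrable (ou_gauss Q B \<infinity>) f \<Longrightarrow>
    emeasure (ou_gauss Q B \<infinity>) {x. ennreal \<alpha> < ou_maximal Q B f x}
      \<le> ennreal (C / \<alpha> * (\<integral>x. norm (f x) \<partial>ou_gauss Q B \<infinity>))"
    by (rule ou_maximal_weak_type) (rule that)
  show ?thesis
  proof (intro exI[of _ C] allI impI conjI)
    fix f :: "real^'n \<Rightarrow> complex" and \<alpha> :: real
    assume \<alpha>: "0 < \<alpha>" and f: "integrable (ou_gauss Q B \<infinity>) f"
    show "{x. ou_maximal Q B f x > ennreal \<alpha>} \<in> sets (ou_gauss Q B \<infinity>)"
      using maximal_level_set_open(2)[OF f \<alpha>] by (simp add: sets_ou_gauss)
    show "emeasure (ou_gauss Q B \<infinity>) {x. ou_maximal Q B f x > ennreal \<alpha>}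
        \<le> ennreal (C / \<alpha> * (\<integral>x. norm (f x) \<partial>ou_gauss Q B \<infinity>))"
      by (rule C[OF \<alpha> f])
  qed
qed

end
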